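(* Let $M$ be a closed smooth manifold of dimension $4$ with an almost symplectic structure $\omega$, let $E\to M$ be a real vector bundle of rank $2m$ with an almost symplectic structure $\mathsf{b}$, and let $\nabla\in\mathcal{C}(E,\mathsf{b})$. Then: (i) $\ast R^\nabla=R^\nabla$ if and only if $R^\nabla=\frac12\,\mathrm{sRic}^\nabla\otimes\omega$. (ii) $\ast R^\nabla=-R^\nabla$ if and only if $\mathrm{sRic}^\nabla=0$.
   Context: Let $\dim M=2n$ (so here $n=2$). An almost symplectic structure on $M$ is a non-degenerate $2$-form $\omega$ (not assumed closed). Write $\omega^{(k)}=\frac{1}{k!}\omega^k$. An almost symplectic structure on $E$ is a smooth fibrewise non-degenerate skew-symmetric bilinear form $\mathsf{b}$ on $E$. Let $(e_1,\dots,e_{2n})$ be a local symplectic frame of $TM$, i.e. $\omega(e_i,e_j)=\omega(e_{n+i},e_{n+j})=0$ and $\omega(e_i,e_{n+j})=\delta_{ij}$ for $i,j=1,\dots,n$, and let $J$ be the local almost complex structure with $Je_i=e_{n+i}$ (so $Je_{n+i}=-e_i$) for $i\le n$. Likewise let $(f_1,\dots,f_{2m})$ be a local symplectic frame of $(E,\mathsf{b})$ and $J'$ the local almost complex structure in $E$ with $J'f_i=f_{m+i}$, $J'f_{m+i}=-f_i$ for $i\le m$. The following pairings do not depend on the choice of symplectic frames: for $K,L\in\Gamma(\mathrm{End}(E))$, $$\mathsf{b}(K,L)=\sum_{i=1}^{2m}\mathsf{b}(Kf_i,LJ'f_i),$$ and for $\alpha,\beta\in\Omega^k(M,\mathrm{End}(E))$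 (the $\mathrm{End}(E)$-valued $k$-forms), $$\mathsf{b}(\alpha,\beta)=\sum_{1\le i_1<\dots<i_k\le 2n}\mathsf{b}(\alpha(e_{i_1},\dots,e_{i_k}),\beta(Je_{i_1},\dots,Je_{i_k})).$$ Let $(\alpha,\alpha')\mapsto\mathsf{b}(\alpha\wedge\alpha')$, $\Omega^k(M,\mathrm{End}(E))\times\Omega^l(M,\mathrm{End}(E))\to\Omega^{k+l}(M)$, be the bilinear map determined by $\mathsf{b}((K\otimes\varphi)\wedge(L\otimes\psi))=\mathsf{b}(K,L)\,\varphi\wedge\psi$. The symplectic Hodge operator is the unique isomorphism $\ast:\Omega^k(M,\mathrm{End}(E))\to\Omega^{2n-k}(M,\mathrm{End}(E))$ with $\mathsf{b}(\alpha,\beta)\,\omega^{(n)}=\mathsf{b}(\alpha\wedge\ast\beta)$ for all $\alpha,\beta\in\Omega^k(M,\mathrm{End}(E))$. $\mathcal{C}(E,\mathsf{b})$ is the space of symplectic connections in $E$, i.e. connections $\nabla$ in $E$ with $X(\mathsf{b}(\xi_1,\xi_2))=\mathsf{b}(\nabla_X\xi_1,\xi_2)+\mathsf{b}(\xi_1,\nabla_X\xi_2)$ for all vector fields $X$ and sections $\xi_1,\xi_2$ of $E$. The curvature $R^\nabla\in\Omega^2(M,\mathrm{End}(E))$ is $R^\nabla(X,Y)\xi=\nabla_X\nabla_Y\xi-\nabla_Y\nabla_X\xi-\nabla_{[X,Y]}\xi$. The symplectic Ricci operator $\mathrm{sRic}^\nabla\in\Gamma(\mathrm{End}(E))$ is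 $\mathrm{sRic}^\nabla(\xi)=\sum_{i=1}^n R^\nabla(e_i,Je_i)\xi$. *)

theory Defs
  imports "HOL-Analysis.Analysis" "HOL-Library.Function_Algebras"
begin

text \<open>
  Functions into a real vector space form a real vector space pointwise. Tangent vectors
  (derivations), endomorphisms, sections and forms below are all functions of this kind.
\<close>

instantiation "fun" :: (type, real_vector) real_vector
begin

definition "c *\<^sub>R f = (\<lambda>x. c *\<^sub>R f x)"

instance
  by standard (simp_all add: scaleR_fun_def fun_eq_iff scaleR_add_right scaleR_add_left)

end

lemma scaleR_fun_apply [simp]: "(c *\<^sub>R f) x = c *\<^sub>R f x"
  by (simp add: scaleR_fun_def)


section \<open>Smooth manifolds\<close>

text \<open>Only used for open sets S: f is k times continuously differentiable on S.\<close>

primrec Ck_on :: "nat \<Rightarrow> 'a::euclidean_space set \<Rightarrow> ('a \<Rightarrow> 'b::real_normed_vector) \<Rightarrow> bool" where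
  "Ck_on 0 S f \<longleftrightarrow> continuous_on S f"
| "Ck_on (Suc k) S f \<longleftrightarrow>
     (\<forall>x\<in>S. f differentiable (at x)) \<and> (\<forall>v. Ck_on k S (\<lambda>x. frechet_derivative f (at x) v))"

definition smooth_on :: "'a::euclidean_space set \<Rightarrow> ('a \<Rightarrow> 'b::real_normed_vector) \<Rightarrow> bool" where
  "smooth_on S f \<longleftrightarrow> (\<forall>k. Ck_on k S f)"

text \<open>
  The manifold is the whole type 'm; a chart is a pair of its domain and its coordinate map,
  and the smooth structure is the one generated by the atlas, which need not be maximal.
\<close>

type_synonym ('m, 'a) atlas = "('m set \<times> ('m \<Rightarrow> 'a)) set"

definition smooth_atlas :: "('m::topological_space, 'a::euclidean_space) atlas \<Rightarrow> bool" where
  "smooth_atlas A \<longleftrightarrow>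
     (\<Union>(U, \<phi>)\<in>A. U) = UNIV \<and>
     (\<forall>(U, \<phi>)\<in>A. open U \<and> open (\<phi> ` U) \<and> homeomorphism U (\<phi> ` U) \<phi> (inv_into U \<phi>)) \<and>
     (\<forall>(U, \<phi>)\<in>A. \<forall>(V, \<psi>)\<in>A. smooth_on (\<phi> ` (U \<inter> V)) (\<psi> \<circ> inv_into U \<phi>))"

definition closed_manifold ::
  "('m::{t2_space, second_countable_topology}, 'a::euclidean_space) atlas \<Rightarrow> bool" where
  "closed_manifold A \<longleftrightarrow> smooth_atlas A \<and> compact (UNIV :: 'm set)"

definition smooth_fun_on ::
  "('m::topological_space, 'a::euclidean_space) atlas \<Rightarrow> 'm set \<Rightarrow> ('m \<Rightarrow> real) \<Rightarrow> bool" where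
  "smooth_fun_on A W f \<longleftrightarrow> (\<forall>(U, \<phi>)\<in>A. smooth_on (\<phi> ` (U \<inter> W)) (f \<circ> inv_into U \<phi>))"

definition smooth_funs :: "('m::topological_space, 'a::euclidean_space) atlas \<Rightarrow> ('m \<Rightarrow> real) set" where
  "smooth_funs A = {f. smooth_fun_on A UNIV f}"

text \<open>
  Tangent vectors at p are the derivations at p of the algebra of smooth functions. They are
  required to vanish on non-smooth functions, so that equality of derivations is equality in HOL.
\<close>

type_synonym 'm tangent = "('m \<Rightarrow> real) \<Rightarrow> real"

definition tangent_space ::
  "('m::topological_space, 'a::euclidean_space) atlas \<Rightarrow> 'm \<Rightarrow> 'm tangent set" where
  "tangent_space A p = {D.
     (\<forall>f\<in>smooth_funs A. \<forall>g\<in>smooth_funs A. D (\<lambda>x. f x + g x) = D f + D g) \<and>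
     (\<forall>c. \<forall>f\<in>smooth_funs A. D (\<lambda>x. c * f x) = c * D f) \<and>
     (\<forall>f\<in>smooth_funs A. \<forall>g\<in>smooth_funs A. D (\<lambda>x. f x * g x) = D f * g p + f p * D g) \<and>
     (\<forall>f. f \<notin> smooth_funs A \<longrightarrow> D f = 0)}"

definition vector_fields ::
  "('m::topological_space, 'a::euclidean_space) atlas \<Rightarrow> ('m \<Rightarrow> 'm tangent) set" where
  "vector_fields A = {X. (\<forall>p. X p \<in> tangent_space A p) \<and>
     (\<forall>f\<in>smooth_funs A. (\<lambda>p. X p f) \<in> smooth_funs A)}"

definition lie_bracket :: "('m \<Rightarrow> 'm tangent) \<Rightarrow> ('m \<Rightarrow> 'm tangent) \<Rightarrow> 'm \<Rightarrow> 'm tangent" where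
  "lie_bracket X Y = (\<lambda>p f. X p (\<lambda>q. Y q f) - Y p (\<lambda>q. X q f))"


section \<open>Vector bundles\<close>

definition indexed_basis :: "nat \<Rightarrow> 'v::real_vector set \<Rightarrow> (nat \<Rightarrow> 'v) \<Rightarrow> bool" where
  "indexed_basis r V e \<longleftrightarrow>
     inj_on e {..<r} \<and> independent (e ` {..<r}) \<and> span (e ` {..<r}) = V"

text \<open>
  A vector bundle is given by its fibres E p and by local trivialisations. The fibres are
  subspaces of one real vector space 'v; this is no restriction, since any family of vector
  spaces embeds into its direct sum. No relation between fibres over different points is
  imposed by 'v: a point of the total space is a pair (p, x) with x in E p.
  A local trivialisation over the open set U is recorded as the local frame s over U that
  corresponds to the standard basis of the model space. The topology and the smooth structure
  of the total space are the ones induced by these trivialisations.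
\<close>

type_synonym ('m, 'v) frames = "('m set \<times> (nat \<Rightarrow> 'm \<Rightarrow> 'v)) set"

definition smooth_in_frame ::
  "('m::topological_space, 'a::euclidean_space) atlas \<Rightarrow> nat \<Rightarrow> 'm set \<Rightarrow>
    (nat \<Rightarrow> 'm \<Rightarrow> 'v::real_vector) \<Rightarrow> ('m \<Rightarrow> 'v) \<Rightarrow> bool" where
  "smooth_in_frame A r W s \<xi> \<longleftrightarrow>
     (\<exists>c. (\<forall>i<r. smooth_fun_on A W (c i)) \<and> (\<forall>p\<in>W. \<xi> p = (\<Sum>i<r. c i p *\<^sub>R s i p)))"

definition vector_bundle ::
  "('m::topological_space, 'a::euclidean_space) atlas \<Rightarrow> nat \<Rightarrow>
    ('m \<Rightarrow> 'v::real_vector set) \<Rightarrow> ('m, 'v) frames \<Rightarrow> bool" where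
  "vector_bundle A r E F \<longleftrightarrow>
     (\<Union>(U, s)\<in>F. U) = UNIV \<and>
     (\<forall>(U, s)\<in>F. open U \<and> (\<forall>p\<in>U. indexed_basis r (E p) (\<lambda>i. s i p))) \<and>
     (\<forall>(U, s)\<in>F. \<forall>(U', s')\<in>F. \<forall>j<r. smooth_in_frame A r (U \<inter> U') s (s' j))"

definition sections ::
  "('m::topological_space, 'a::euclidean_space) atlas \<Rightarrow> nat \<Rightarrow>
    ('m \<Rightarrow> 'v::real_vector set) \<Rightarrow> ('m, 'v) frames \<Rightarrow> ('m \<Rightarrow> 'v) set" where
  "sections A r E F =
     {\<xi>. (\<forall>p. \<xi> p \<in> E p) \<and> (\<forall>(U, s)\<in>F. smooth_in_frame A r U s \<xi>)}"

text \<open>Endomorphisms of the subspace V, extended by 0 outside V.\<close>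

definition endos :: "'v::real_vector set \<Rightarrow> ('v \<Rightarrow> 'v) set" where
  "endos V = {K. (\<forall>x\<in>V. K x \<in> V) \<and> (\<forall>x\<in>V. \<forall>y\<in>V. K (x + y) = K x + K y) \<and>
     (\<forall>c. \<forall>x\<in>V. K (c *\<^sub>R x) = c *\<^sub>R K x) \<and> (\<forall>x. x \<notin> V \<longrightarrow> K x = 0)}"


section \<open>Differential forms\<close>

text \<open>
  A k-form takes a list of k tangent vectors at p. By convention it vanishes on all other
  lists, so that equality of forms is equality in HOL.
\<close>

type_synonym ('m, 'w) form = "'m \<Rightarrow> 'm tangent list \<Rightarrow> 'w"

definition alternating_on ::
  "nat \<Rightarrow> 't::real_vector set \<Rightarrow> 'w::real_vector set \<Rightarrow> ('t list \<Rightarrow> 'w) \<Rightarrow> bool" where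
  "alternating_on k V W a \<longleftrightarrow>
     (\<forall>vs. length vs = k \<and> set vs \<subseteq> V \<longrightarrow> a vs \<in> W) \<and>
     (\<forall>vs. \<not> (length vs = k \<and> set vs \<subseteq> V) \<longrightarrow> a vs = 0) \<and>
     (\<forall>vs i u v c. length vs = k \<and> set vs \<subseteq> V \<and> i < k \<and> u \<in> V \<and> v \<in> V \<longrightarrow>
        a (vs[i := c *\<^sub>R u + v]) = c *\<^sub>R a (vs[i := u]) + a (vs[i := v])) \<and>
     (\<forall>vs i j. length vs = k \<and> set vs \<subseteq> V \<and> i < j \<and> j < k \<and> vs ! i = vs ! j \<longrightarrow> a vs = 0)"

definition real_forms ::
  "('m::topological_space, 'a::euclidean_space) atlas \<Rightarrow> nat \<Rightarrow> ('m, real) form set" where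
  "real_forms A k = {\<phi>. (\<forall>p. alternating_on k (tangent_space A p) UNIV (\<phi> p)) \<and>
     (\<forall>Xs. length Xs = k \<and> set Xs \<subseteq> vector_fields A \<longrightarrow>
        (\<lambda>p. \<phi> p (map (\<lambda>X. X p) Xs)) \<in> smooth_funs A)}"

definition endo_forms ::
  "('m::topological_space, 'a::euclidean_space) atlas \<Rightarrow> nat \<Rightarrow>
    ('m \<Rightarrow> 'v::real_vector set) \<Rightarrow> ('m, 'v) frames \<Rightarrow> nat \<Rightarrow> ('m, 'v \<Rightarrow> 'v) form set" where
  "endo_forms A r E F k = {\<alpha>. (\<forall>p. alternating_on k (tangent_space A p) (endos (E p)) (\<alpha> p)) \<and>
     (\<forall>Xs. length Xs = k \<and> set Xs \<subseteq> vector_fields A \<longrightarrow>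
        (\<forall>\<xi>\<in>sections A r E F. (\<lambda>p. \<alpha> p (map (\<lambda>X. X p) Xs) (\<xi> p)) \<in> sections A r E F))}"

definition tensor_form :: "('m \<Rightarrow> 'v \<Rightarrow> 'v::real_vector) \<Rightarrow> ('m, real) form \<Rightarrow> ('m, 'v \<Rightarrow> 'v) form" where
  "tensor_form K \<phi> = (\<lambda>p vs. \<phi> p vs *\<^sub>R K p)"

text \<open>
  Wedge product of a k-form and an l-form whose values are paired by B. The normalisation is
  the one for which the product of dual basis covectors has value 1 on the basis.
\<close>

definition wedge_with ::
  "('m \<Rightarrow> 'w \<Rightarrow> 'w' \<Rightarrow> real) \<Rightarrow> nat \<Rightarrow> nat \<Rightarrow> ('m, 'w) form \<Rightarrow> ('m, 'w') form \<Rightarrow> ('m, real) form" where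
  "wedge_with B k l \<alpha> \<beta> = (\<lambda>p vs.
     if length vs = k + l then
       (\<Sum>\<sigma> | \<sigma> permutes {..<k + l}. of_int (sign \<sigma>) *
          B p (\<alpha> p (map (\<lambda>i. vs ! \<sigma> i) [0..<k])) (\<beta> p (map (\<lambda>i. vs ! \<sigma> i) [k..<k + l])))
       / (fact k * fact l)
     else 0)"

definition wedge :: "nat \<Rightarrow> nat \<Rightarrow> ('m, real) form \<Rightarrow> ('m, real) form \<Rightarrow> ('m, real) form" where
  "wedge k l = wedge_with (\<lambda>_. (*)) k l"

text \<open>The k-fold wedge power of a 2-form.\<close>

primrec wedge_power :: "('m, real) form \<Rightarrow> nat \<Rightarrow> ('m, real) form" where
  "wedge_power \<omega> 0 = (\<lambda>p vs. if vs = [] then 1 else 0)"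
| "wedge_power \<omega> (Suc k) = wedge 2 (2 * k) \<omega> (wedge_power \<omega> k)"

definition divided_power :: "('m, real) form \<Rightarrow> nat \<Rightarrow> ('m, real) form" where
  "divided_power \<omega> k = (\<lambda>p vs. wedge_power \<omega> k p vs / fact k)"


section \<open>Almost symplectic structures\<close>

definition almost_symplectic_form ::
  "('m::topological_space, 'a::euclidean_space) atlas \<Rightarrow> ('m, real) form \<Rightarrow> bool" where
  "almost_symplectic_form A \<omega> \<longleftrightarrow> \<omega> \<in> real_forms A 2 \<and>
     (\<forall>p. \<forall>u\<in>tangent_space A p. (\<forall>v\<in>tangent_space A p. \<omega> p [u, v] = 0) \<longrightarrow> u = 0)"

definition almost_symplectic_bundle ::
  "('m::topological_space, 'a::euclidean_space) atlas \<Rightarrow> nat \<Rightarrow>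
    ('m \<Rightarrow> 'v::real_vector set) \<Rightarrow> ('m, 'v) frames \<Rightarrow> ('m \<Rightarrow> 'v \<Rightarrow> 'v \<Rightarrow> real) \<Rightarrow> bool" where
  "almost_symplectic_bundle A r E F b \<longleftrightarrow>
     (\<forall>p. \<forall>x\<in>E p. \<forall>y\<in>E p. \<forall>z\<in>E p. b p (x + y) z = b p x z + b p y z) \<and>
     (\<forall>p c. \<forall>x\<in>E p. \<forall>y\<in>E p. b p (c *\<^sub>R x) y = c * b p x y) \<and>
     (\<forall>p. \<forall>x\<in>E p. \<forall>y\<in>E p. b p x y = - b p y x) \<and>
     (\<forall>p. \<forall>x\<in>E p. (\<forall>y\<in>E p. b p x y = 0) \<longrightarrow> x = 0) \<and>
     (\<forall>\<xi>\<in>sections A r E F. \<forall>\<eta>\<in>sections A r E F. (\<lambda>p. b p (\<xi> p) (\<eta> p)) \<in> smooth_funs A)"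

text \<open>
  Symplectic frames, with indices starting from 0. Everything computed from frames below is a
  pointwise expression in the values of the frame and independent of the frame, so that a
  frame of the single fibre over p suffices; one is chosen by Hilbert choice.
\<close>

definition symplectic_basis ::
  "nat \<Rightarrow> 'v::real_vector set \<Rightarrow> ('v \<Rightarrow> 'v \<Rightarrow> real) \<Rightarrow> (nat \<Rightarrow> 'v) \<Rightarrow> bool" where
  "symplectic_basis n V B e \<longleftrightarrow> indexed_basis (2 * n) V e \<and>
     (\<forall>i<n. \<forall>j<n. B (e i) (e j) = 0 \<and> B (e (n + i)) (e (n + j)) = 0 \<and>
        B (e i) (e (n + j)) = of_bool (i = j))"

text \<open>The value on e i of the complex structure J determined by the frame e.\<close>

definition frame_J :: "nat \<Rightarrow> (nat \<Rightarrow> 'v::real_vector) \<Rightarrow> nat \<Rightarrow> 'v" where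
  "frame_J n e i = (if i < n then e (n + i) else - e (i - n))"

definition half_dim :: "('m, 'a::euclidean_space) atlas \<Rightarrow> nat" where
  "half_dim A = DIM('a) div 2"

definition tangent_frame ::
  "('m::topological_space, 'a::euclidean_space) atlas \<Rightarrow> ('m, real) form \<Rightarrow> 'm \<Rightarrow> nat \<Rightarrow> 'm tangent" where
  "tangent_frame A \<omega> p =
     (SOME e. symplectic_basis (half_dim A) (tangent_space A p) (\<lambda>u v. \<omega> p [u, v]) e)"

definition bundle_frame ::
  "nat \<Rightarrow> ('m \<Rightarrow> 'v::real_vector set) \<Rightarrow> ('m \<Rightarrow> 'v \<Rightarrow> 'v \<Rightarrow> real) \<Rightarrow> 'm \<Rightarrow> nat \<Rightarrow> 'v" where
  "bundle_frame m E b p = (SOME f. symplectic_basis m (E p) (b p) f)"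

definition endo_pairing ::
  "nat \<Rightarrow> ('m \<Rightarrow> 'v::real_vector set) \<Rightarrow> ('m \<Rightarrow> 'v \<Rightarrow> 'v \<Rightarrow> real) \<Rightarrow>
    'm \<Rightarrow> ('v \<Rightarrow> 'v) \<Rightarrow> ('v \<Rightarrow> 'v) \<Rightarrow> real" where
  "endo_pairing m E b p K L =
     (let f = bundle_frame m E b p in \<Sum>i<2 * m. b p (K (f i)) (L (frame_J m f i)))"

definition form_pairing ::
  "('m::topological_space, 'a::euclidean_space) atlas \<Rightarrow> ('m, real) form \<Rightarrow> nat \<Rightarrow>
    ('m \<Rightarrow> 'v::real_vector set) \<Rightarrow> ('m \<Rightarrow> 'v \<Rightarrow> 'v \<Rightarrow> real) \<Rightarrow> nat \<Rightarrow>
    ('m, 'v \<Rightarrow> 'v) form \<Rightarrow> ('m, 'v \<Rightarrow> 'v) form \<Rightarrow> 'm \<Rightarrow> real" where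
  "form_pairing A \<omega> m E b k \<alpha> \<beta> p =
     (let n = half_dim A; e = tangent_frame A \<omega> p in
      \<Sum>js | length js = k \<and> sorted_wrt (<) js \<and> set js \<subseteq> {..<2 * n}.
        endo_pairing m E b p (\<alpha> p (map e js)) (\<beta> p (map (frame_J n e) js)))"

definition pairing_wedge ::
  "nat \<Rightarrow> ('m \<Rightarrow> 'v::real_vector set) \<Rightarrow> ('m \<Rightarrow> 'v \<Rightarrow> 'v \<Rightarrow> real) \<Rightarrow> nat \<Rightarrow> nat \<Rightarrow>
    ('m, 'v \<Rightarrow> 'v) form \<Rightarrow> ('m, 'v \<Rightarrow> 'v) form \<Rightarrow> ('m, real) form" where
  "pairing_wedge m E b k l = wedge_with (endo_pairing m E b) k l"

text \<open>On decomposable forms this bilinear map is the pairing times the wedge product.\<close>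

lemma pairing_wedge_tensor:
  assumes bdl: "vector_bundle A r E F"
    and symp: "almost_symplectic_bundle A r E F b"
    and K: "\<And>p. K p \<in> endos (E p)" and L: "\<And>p. L p \<in> endos (E p)"
  shows "pairing_wedge m E b k l (tensor_form K \<phi>) (tensor_form L \<psi>) =
    (\<lambda>p vs. endo_pairing m E b p (K p) (L p) * wedge k l \<phi> \<psi> p vs)"
proof -
  have sub: "subspace (E p)" for p
  proof -
    have "p \<in> (\<Union>(U, s)\<in>F. U)"
      using bdl unfolding vector_bundle_def by (elim conjE) simp
    then obtain U s where "(U, s) \<in> F" "p \<in> U" by auto
    with bdl have "indexed_basis r (E p) (\<lambda>i. s i p)"
      unfolding vector_bundle_def by blast
    then have "span ((\<lambda>i. s i p) ` {..<r}) = E p"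
      by (simp add: indexed_basis_def)
    then show ?thesis using subspace_span[of "(\<lambda>i. s i p) ` {..<r}"] by simp
  qed
  have val: "G x \<in> E p" if "G \<in> endos (E p)" for G p x
    using that subspace_0[OF sub[of p]] by (cases "x \<in> E p") (auto simp: endos_def)
  note symp' = symp[unfolded almost_symplectic_bundle_def, THEN conjunct2]
  have left: "b p (c *\<^sub>R x) y = c * b p x y" if "x \<in> E p" "y \<in> E p" for p c x y
    using symp'[THEN conjunct1] that by blast
  have skew: "b p x y = - b p y x" if "x \<in> E p" "y \<in> E p" for p x y
    using symp'[THEN conjunct2, THEN conjunct1] that by blast
  have both: "b p (c *\<^sub>R x) (d *\<^sub>R y) = b p x y * (c * d)" if xy: "x \<in> E p" "y \<in> E p" for p c d x y
  proof -
    have y': "d *\<^sub>R y \<in> E p" using subspace_scale[OF sub[of p] xy(2)] .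
    have "b p (c *\<^sub>R x) (d *\<^sub>R y) = c * b p x (d *\<^sub>R y)" by (rule left[OF xy(1) y'])
    also have "b p x (d *\<^sub>R y) = - b p (d *\<^sub>R y) x" by (rule skew[OF xy(1) y'])
    also have "b p (d *\<^sub>R y) x = d * b p y x" by (rule left[OF xy(2) xy(1)])
    also have "b p y x = - b p x y" by (rule skew[OF xy(2) xy(1)])
    finally show ?thesis by simp
  qed
  have pair: "endo_pairing m E b p (c *\<^sub>R K p) (d *\<^sub>R L p) =
      endo_pairing m E b p (K p) (L p) * (c * d)" for p c d
    by (simp add: endo_pairing_def Let_def both val K L sum_distrib_right)
  have expand: "of_int u * (q * (x * y)) = q * (of_int u * x * y)" for u :: int and q x y :: real
    by simp
  show ?thesis
    unfolding pairing_wedge_def wedge_def wedge_with_def tensor_form_def pair expand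
    by (auto simp: fun_eq_iff sum_distrib_left mult.assoc)
qed


section \<open>The symplectic Hodge operator\<close>

text \<open>
  Isomorphisms are those of modules over the smooth functions. The requirement that H be
  extensional fixes its value outside the space of k-forms.
\<close>

definition is_hodge_star ::
  "('m::topological_space, 'a::euclidean_space) atlas \<Rightarrow> ('m, real) form \<Rightarrow> nat \<Rightarrow>
    ('m \<Rightarrow> 'v::real_vector set) \<Rightarrow> ('m, 'v) frames \<Rightarrow> ('m \<Rightarrow> 'v \<Rightarrow> 'v \<Rightarrow> real) \<Rightarrow> nat \<Rightarrow>
    (('m, 'v \<Rightarrow> 'v) form \<Rightarrow> ('m, 'v \<Rightarrow> 'v) form) \<Rightarrow> bool" where
  "is_hodge_star A \<omega> m E F b k H \<longleftrightarrow>
     (let n = half_dim A; \<Omega> = endo_forms A (2 * m) E F in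
      H \<in> extensional (\<Omega> k) \<and>
      bij_betw H (\<Omega> k) (\<Omega> (2 * n - k)) \<and>
      (\<forall>\<alpha>\<in>\<Omega> k. \<forall>\<beta>\<in>\<Omega> k. H (\<alpha> + \<beta>) = H \<alpha> + H \<beta>) \<and>
      (\<forall>f\<in>smooth_funs A. \<forall>\<alpha>\<in>\<Omega> k. H (\<lambda>p. f p *\<^sub>R \<alpha> p) = (\<lambda>p. f p *\<^sub>R H \<alpha> p)) \<and>
      (\<forall>\<alpha>\<in>\<Omega> k. \<forall>\<beta>\<in>\<Omega> k.
         (\<lambda>p. form_pairing A \<omega> m E b k \<alpha> \<beta> p *\<^sub>R divided_power \<omega> n p) =
         pairing_wedge m E b k (2 * n - k) \<alpha> (H \<beta>)))"

definition hodge_star ::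
  "('m::topological_space, 'a::euclidean_space) atlas \<Rightarrow> ('m, real) form \<Rightarrow> nat \<Rightarrow>
    ('m \<Rightarrow> 'v::real_vector set) \<Rightarrow> ('m, 'v) frames \<Rightarrow> ('m \<Rightarrow> 'v \<Rightarrow> 'v \<Rightarrow> real) \<Rightarrow> nat \<Rightarrow>
    ('m, 'v \<Rightarrow> 'v) form \<Rightarrow> ('m, 'v \<Rightarrow> 'v) form" where
  "hodge_star A \<omega> m E F b k = (THE H. is_hodge_star A \<omega> m E F b k H)"


section \<open>Connections, curvature and the symplectic Ricci operator\<close>

definition connection ::
  "('m::topological_space, 'a::euclidean_space) atlas \<Rightarrow> nat \<Rightarrow>
    ('m \<Rightarrow> 'v::real_vector set) \<Rightarrow> ('m, 'v) frames \<Rightarrow>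
    (('m \<Rightarrow> 'm tangent) \<Rightarrow> ('m \<Rightarrow> 'v) \<Rightarrow> 'm \<Rightarrow> 'v) \<Rightarrow> bool" where
  "connection A r E F D \<longleftrightarrow>
     (\<forall>X\<in>vector_fields A. \<forall>\<xi>\<in>sections A r E F. D X \<xi> \<in> sections A r E F) \<and>
     (\<forall>X\<in>vector_fields A. \<forall>Y\<in>vector_fields A. \<forall>\<xi>\<in>sections A r E F.
        D (X + Y) \<xi> = D X \<xi> + D Y \<xi>) \<and>
     (\<forall>f\<in>smooth_funs A. \<forall>X\<in>vector_fields A. \<forall>\<xi>\<in>sections A r E F.
        D (\<lambda>p. f p *\<^sub>R X p) \<xi> = (\<lambda>p. f p *\<^sub>R D X \<xi> p)) \<and>
     (\<forall>X\<in>vector_fields A. \<forall>\<xi>\<in>sections A r E F. \<forall>\<eta>\<in>sections A r E F.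
        D X (\<xi> + \<eta>) = D X \<xi> + D X \<eta>) \<and>
     (\<forall>f\<in>smooth_funs A. \<forall>X\<in>vector_fields A. \<forall>\<xi>\<in>sections A r E F.
        D X (\<lambda>p. f p *\<^sub>R \<xi> p) = (\<lambda>p. X p f *\<^sub>R \<xi> p + f p *\<^sub>R D X \<xi> p))"

definition symplectic_connection ::
  "('m::topological_space, 'a::euclidean_space) atlas \<Rightarrow> nat \<Rightarrow>
    ('m \<Rightarrow> 'v::real_vector set) \<Rightarrow> ('m, 'v) frames \<Rightarrow> ('m \<Rightarrow> 'v \<Rightarrow> 'v \<Rightarrow> real) \<Rightarrow>
    (('m \<Rightarrow> 'm tangent) \<Rightarrow> ('m \<Rightarrow> 'v) \<Rightarrow> 'm \<Rightarrow> 'v) \<Rightarrow> bool" where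
  "symplectic_connection A r E F b D \<longleftrightarrow> connection A r E F D \<and>
     (\<forall>X\<in>vector_fields A. \<forall>\<xi>\<in>sections A r E F. \<forall>\<eta>\<in>sections A r E F. \<forall>p.
        X p (\<lambda>q. b q (\<xi> q) (\<eta> q)) = b p (D X \<xi> p) (\<eta> p) + b p (\<xi> p) (D X \<eta> p))"

text \<open>
  The curvature is a form, i.e. acts on tangent vectors and on vectors of the fibre: it is the
  endomorphism-valued 2-form that gives the usual expression on vector fields and sections.
\<close>

definition curvature ::
  "('m::topological_space, 'a::euclidean_space) atlas \<Rightarrow> nat \<Rightarrow>
    ('m \<Rightarrow> 'v::real_vector set) \<Rightarrow> ('m, 'v) frames \<Rightarrow>
    (('m \<Rightarrow> 'm tangent) \<Rightarrow> ('m \<Rightarrow> 'v) \<Rightarrow> 'm \<Rightarrow> 'v) \<Rightarrow> ('m, 'v \<Rightarrow> 'v) form" where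
  "curvature A r E F D = (THE R. R \<in> endo_forms A r E F 2 \<and>
     (\<forall>X\<in>vector_fields A. \<forall>Y\<in>vector_fields A. \<forall>\<xi>\<in>sections A r E F. \<forall>p.
        R p [X p, Y p] (\<xi> p) =
          D X (D Y \<xi>) p - D Y (D X \<xi>) p - D (lie_bracket X Y) \<xi> p))"

definition symplectic_ricci ::
  "('m::topological_space, 'a::euclidean_space) atlas \<Rightarrow> ('m, real) form \<Rightarrow> nat \<Rightarrow>
    ('m \<Rightarrow> 'v::real_vector set) \<Rightarrow> ('m, 'v) frames \<Rightarrow>
    (('m \<Rightarrow> 'm tangent) \<Rightarrow> ('m \<Rightarrow> 'v) \<Rightarrow> 'm \<Rightarrow> 'v) \<Rightarrow> 'm \<Rightarrow> 'v \<Rightarrow> 'v" where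
  "symplectic_ricci A \<omega> r E F D p =
     (let n = half_dim A; e = tangent_frame A \<omega> p in
      \<Sum>i<n. curvature A r E F D p [e i, frame_J n e i])"

end

(*
  On a symplectic 4-space the symplectic Hodge operator on endomorphism-valued 2-forms is
  *a = (tr a) omega - a, where tr a = sum_i a(e_i, J e_i) is the contraction with omega.
  Since tr (R^nabla) is the symplectic Ricci operator and omega vanishes nowhere, both
  equivalences follow pointwise from this formula.  The substance is that the operator exists and
  is unique and that the curvature is a form.  For the smoothness of tr a one uses
  a wedge omega = (tr a) omega^2 / 2, evaluated on a local frame of vector fields, where omega^2 has
  no zeros; uniqueness is tested on the forms (df wedge dg) b(eta, .) xi.
*)
theory Submission
  imports Defs
begin

section \<open>Calculus of continuously differentiable functions\<close>

text \<open>The formula for the operator splits a 2-form into K omega, with K an endomorphism, and a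
  part with tr = 0. Since tr omega = 2, the operator is the identity on the first part and minus the
  identity on the second; hence the factor 1/2 in (i) and the vanishing trace in (ii).

  Two features of the definitions shape the work. Frames are chosen separately at each point, so
  nothing computed from them is visibly smooth, and the trace needs a frame-free description.
  Tangent vectors are abstract derivations of the algebra of global smooth functions, and
  connections act on global fields and sections. So even the fact that tangent spaces have dimension
  4 rests on Hadamard's lemma, and every local object (coordinates, coordinate fields, frames of E,
  inverses of functions) is cut off by a bump function before it can be used.

  Identities between 4-forms are reduced to a single evaluation: on a 4-dimensional space an
  alternating 4-form is determined by its value on one basis.\<close>

lemma Ck_on_subset: "Ck_on k S f \<Longrightarrow> T \<subseteq> S \<Longrightarrow> Ck_on k T f"
  by (induction k arbitrary: f) (auto intro: continuous_on_subset)

text \<open>Equality on an open set is equality near each of its points, so the derivatives at these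
  points agree as well.\<close>

lemma Ck_on_cong:
  assumes "open S" "\<And>x. x \<in> S \<Longrightarrow> f x = g x" "Ck_on k S f"
  shows "Ck_on k S g"
  using assms(2,3)
proof (induction k arbitrary: f g)
  case 0
  then show ?case by (auto intro: continuous_on_eq)
next
  case (Suc k)
  have der: "(g has_derivative frechet_derivative f (at x)) (at x)" if "x \<in> S" for x
    by (rule has_derivative_transform_within_open[OF _ assms(1) that, of f])
      (use Suc.prems that in \<open>auto simp: frechet_derivative_works[symmetric]\<close>)
  have "frechet_derivative f (at x) = frechet_derivative g (at x)" if "x \<in> S" for x
    by (rule frechet_derivative_at[OF der[OF that]])
  then have "Ck_on k S (\<lambda>x. frechet_derivative g (at x) v)" for v
    using Suc.IH[of "\<lambda>x. frechet_derivative f (at x) v" "\<lambda>x. frechet_derivative g (at x) v"]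
      Suc.prems(2) by auto
  with der show ?case by (auto simp: differentiable_def)
qed

text \<open>\<open>frechet_derivative\<close> is a choice among derivatives; by uniqueness at a
  point of the full space, any derivative known explicitly can replace it. The differentiation rules
  below enter through this form.\<close>

lemma Ck_on_SucI:
  assumes S: "open S" and der: "\<And>x. x \<in> S \<Longrightarrow> (f has_derivative f' x) (at x)"
    and "\<And>v. Ck_on k S (\<lambda>x. f' x v)"
  shows "Ck_on (Suc k) S f"
proof -
  have "f' x = frechet_derivative f (at x)" if "x \<in> S" for x
    by (rule frechet_derivative_at[OF der[OF that]])
  then have "Ck_on k S (\<lambda>x. frechet_derivative f (at x) v)" for v
    using Ck_on_cong[OF S _ assms(3)] by auto
  with der show ?thesis by (auto simp: differentiable_def)
qed

lemma Ck_on_Suc_derivative: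
  assumes "Ck_on (Suc k) S f" "x \<in> S"
  shows "(f has_derivative frechet_derivative f (at x)) (at x)"
  using assms by (auto simp: frechet_derivative_works[symmetric])

lemma Ck_on_SucD: "Ck_on (Suc k) S f \<Longrightarrow> Ck_on k S f"
proof (induction k arbitrary: f)
  case 0
  then show ?case
    by (auto intro!: continuous_at_imp_continuous_on differentiable_imp_continuous_within)
next
  case (Suc k)
  then show ?case by (metis Ck_on.simps(2))
qed


text \<open>The neighbourhoods may vary with the point, since each clause of \<open>Ck_on\<close>
  speaks about one point at a time.\<close>

lemma Ck_on_local:
  assumes "\<And>x. x \<in> S \<Longrightarrow> \<exists>T. open T \<and> x \<in> T \<and> Ck_on k T f"
  shows "Ck_on k S f"
  using assms
proof (induction k arbitrary: f)
  case 0
  then show ?case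
    by (auto intro!: continuous_at_imp_continuous_on simp: continuous_on_eq_continuous_at)
      (metis continuous_on_eq_continuous_at)
next
  case (Suc k)
  have "\<exists>T. open T \<and> x \<in> T \<and> Ck_on k T (\<lambda>x. frechet_derivative f (at x) v)" if "x \<in> S" for x v
    using Suc.prems[OF that] by auto
  then have "Ck_on k S (\<lambda>x. frechet_derivative f (at x) v)" for v
    by (rule Suc.IH)
  moreover have "f differentiable (at x)" if "x \<in> S" for x
    using Suc.prems[OF that] by auto
  ultimately show ?case by auto
qed

lemma Ck_on_const: "Ck_on k S (\<lambda>x. c)"
  by (induction k arbitrary: c) auto

lemma Ck_on_bounded_linear:
  assumes "open S" "bounded_linear f"
  shows "Ck_on k S f"
proof (cases k)
  case 0
  then show ?thesis by (simp add: assms(2) linear_continuous_on)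
next
  case (Suc j)
  show ?thesis unfolding Suc
    by (rule Ck_on_SucI[OF assms(1) bounded_linear_imp_has_derivative[OF assms(2)] Ck_on_const])
qed

lemma Ck_on_add:
  assumes "open S" "Ck_on k S f" "Ck_on k S g"
  shows "Ck_on k S (\<lambda>x. f x + g x)"
  using assms(2,3)
proof (induction k arbitrary: f g)
  case 0
  then show ?case by (auto intro: continuous_intros)
next
  case (Suc k)
  show ?case
    by (rule Ck_on_SucI[OF assms(1) has_derivative_add[OF Ck_on_Suc_derivative[OF Suc.prems(1)]
            Ck_on_Suc_derivative[OF Suc.prems(2)]]])
      (use Suc in auto)
qed

lemma Ck_on_sum:
  assumes "open S" "\<And>i. i \<in> I \<Longrightarrow> Ck_on k S (f i)"
  shows "Ck_on k S (\<lambda>x. \<Sum>i\<in>I. f i x)"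
  using assms(2)
  by (induction I rule: infinite_finite_induct) (auto intro!: Ck_on_const Ck_on_add[OF assms(1)])

text \<open>By the Leibniz rule the derivative is a sum of two expressions of the same shape, each
  pairing one function with a derivative of the other. The general h covers products, scalar
  multiples and inner products at once.\<close>

lemma Ck_on_bilinear:
  assumes "open S" "bounded_bilinear h" "Ck_on k S f" "Ck_on k S g"
  shows "Ck_on k S (\<lambda>x. h (f x) (g x))"
  using assms(3,4)
proof (induction k arbitrary: f g)
  case 0
  then show ?case by (auto intro: bounded_bilinear.continuous_on[OF assms(2)])
next
  case (Suc k)
  show ?case
    by (rule Ck_on_SucI[OF assms(1) bounded_bilinear.FDERIV[OF assms(2)
            Ck_on_Suc_derivative[OF Suc.prems(1)] Ck_on_Suc_derivative[OF Suc.prems(2)]]])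
      (use Suc in \<open>auto intro!: Ck_on_add[OF assms(1)] Suc.IH simp: Ck_on_SucD simp del: Ck_on.simps
         simp: Ck_on.simps(2)[of k S f] Ck_on.simps(2)[of k S g]\<close>)
qed

lemmas Ck_on_mult = Ck_on_bilinear[OF _ bounded_bilinear_mult]
lemmas Ck_on_scaleR = Ck_on_bilinear[OF _ bounded_bilinear_scaleR]
lemmas Ck_on_inner = Ck_on_bilinear[OF _ bounded_bilinear_inner]

text \<open>In the chain rule both the linear map and its argument depend on x. Expanding the
  argument in \<open>Basis\<close> leaves products of a scalar with a partial derivative of g
  composed with f, to which the induction hypothesis for g applies.\<close>

lemma Ck_on_compose:
  fixes f :: "'a::euclidean_space \<Rightarrow> 'b::euclidean_space" and g :: "'b \<Rightarrow> 'c::real_normed_vector"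
  assumes S: "open S" and T: "open T" and f: "Ck_on k S f" and g: "Ck_on k T g" and im: "f ` S \<subseteq> T"
  shows "Ck_on k S (\<lambda>x. g (f x))"
  using f g
proof (induction k arbitrary: g)
  case 0
  then show ?case using im by (auto intro: continuous_on_compose2)
next
  case (Suc k)
  let ?f' = "\<lambda>x. frechet_derivative f (at x)" and ?g' = "\<lambda>y. frechet_derivative g (at y)"
  have der: "((\<lambda>x. g (f x)) has_derivative (\<lambda>v. ?g' (f x) (?f' x v))) (at x)" if "x \<in> S" for x
    using diff_chain_at[OF Ck_on_Suc_derivative[OF Suc.prems(1) that]
        Ck_on_Suc_derivative[OF Suc.prems(2)]] im that by (auto simp: o_def)
  have eq: "?g' (f x) (?f' x v) = (\<Sum>b\<in>Basis. (?f' x v \<bullet> b) *\<^sub>R ?g' (f x) b)" if "x \<in> S" for x v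
  proof -
    have "linear (?g' (f x))"
      using Ck_on_Suc_derivative[OF Suc.prems(2)] im that has_derivative_linear by blast
    then show ?thesis
      by (subst (1) euclidean_representation[of "?f' x v", symmetric])
        (simp add: linear_sum linear_scale)
  qed
  have "Ck_on k S (\<lambda>x. (\<Sum>b\<in>Basis. (?f' x v \<bullet> b) *\<^sub>R ?g' (f x) b))" for v
    using Suc.prems(1,2) Ck_on_SucD[OF Suc.prems(1)]
    by (intro Ck_on_sum[OF S] Ck_on_scaleR[OF S] Ck_on_inner[OF S] Ck_on_const
        Suc.IH[of "\<lambda>y. ?g' y b" for b]) auto
  then have "Ck_on k S (\<lambda>x. ?g' (f x) (?f' x v))" for v
    by (rule Ck_on_cong[OF S _, rotated]) (simp add: eq)
  then show ?case by (intro Ck_on_SucI[where f' = "\<lambda>x v. ?g' (f x) (?f' x v)"] S der)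
qed

text \<open>The derivative of 1/f is a polynomial in 1/f and the derivative of f, so each order of
  smoothness of 1/f yields the next.\<close>

lemma Ck_on_inverse:
  fixes f :: "'a::euclidean_space \<Rightarrow> real"
  assumes "open S" "Ck_on k S f" "\<And>x. x \<in> S \<Longrightarrow> f x \<noteq> 0"
  shows "Ck_on k S (\<lambda>x. inverse (f x))"
  using assms(2)
proof (induction k)
  case 0
  then show ?case using assms(3) by (auto intro: continuous_on_inverse)
next
  case (Suc k)
  have *: "Ck_on k S (\<lambda>x. inverse (f x))" using Suc Ck_on_SucD by blast
  show ?case
  proof (rule Ck_on_SucI[OF assms(1)])
    show "((\<lambda>x. inverse (f x)) has_derivative
        (\<lambda>v. - (inverse (f x) * frechet_derivative f (at x) v * inverse (f x)))) (at x)"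
      if "x \<in> S" for x
      by (rule Deriv.has_derivative_inverse[OF assms(3)[OF that] Ck_on_Suc_derivative[OF Suc.prems that]])
    show "Ck_on k S (\<lambda>x. - (inverse (f x) * frechet_derivative f (at x) v * inverse (f x)))" for v
      using Ck_on_mult[OF assms(1) Ck_on_const[of k S "-1"]
          Ck_on_mult[OF assms(1) Ck_on_mult[OF assms(1) * _] *]] Suc.prems
      by auto
  qed
qed

lemma smooth_on_subset: "smooth_on S f \<Longrightarrow> T \<subseteq> S \<Longrightarrow> smooth_on T f"
  using Ck_on_subset unfolding smooth_on_def by blast

lemma smooth_on_derivative: "smooth_on S f \<Longrightarrow> smooth_on S (\<lambda>x. frechet_derivative f (at x) v)"
  unfolding smooth_on_def by (metis Ck_on.simps(2))

lemma smooth_on_has_derivative: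
  "smooth_on S f \<Longrightarrow> x \<in> S \<Longrightarrow> (f has_derivative frechet_derivative f (at x)) (at x)"
  unfolding smooth_on_def using Ck_on_Suc_derivative[of 0] by blast

lemma smooth_on_continuous: "smooth_on S f \<Longrightarrow> continuous_on S f"
  unfolding smooth_on_def by (metis Ck_on.simps(1))

lemma smooth_on_cong: "open S \<Longrightarrow> (\<And>x. x \<in> S \<Longrightarrow> f x = g x) \<Longrightarrow> smooth_on S f \<Longrightarrow> smooth_on S g"
  using Ck_on_cong unfolding smooth_on_def by metis

section \<open>Cut-off functions on Euclidean spaces\<close>

text \<open>For P = 1 this is the classical flat function exp (-1/t), extended by 0. The polynomial
  factor makes the family closed under differentiation.\<close>

definition flat_fun :: "real poly \<Rightarrow> real \<Rightarrow> real" where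
  "flat_fun P t = (if t > 0 then poly P (1 / t) * exp (- (1 / t)) else 0)"

lemma poly_exp_tendsto_0: "((\<lambda>u::real. poly P u * exp (- u)) \<longlongrightarrow> 0) at_top"
proof -
  have "((\<lambda>u. (\<Sum>i\<le>degree P. coeff P i * (u ^ i / exp u))) \<longlongrightarrow> 0) at_top"
    by (intro tendsto_null_sum tendsto_mult_right_zero tendsto_power_div_exp_0)
  then show ?thesis
    by (simp add: poly_altdef exp_minus sum_distrib_right divide_inverse mult.assoc)
qed

lemma flat_fun_right_limit: "(flat_fun P \<longlongrightarrow> 0) (at_right 0)"
proof -
  have "((\<lambda>t::real. poly P (1 / t) * exp (- (1 / t))) \<longlongrightarrow> 0) (at_right 0)"
    using filterlim_compose[OF poly_exp_tendsto_0 filterlim_inverse_at_top_right, of P]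
    by (simp add: inverse_eq_divide)
  then show ?thesis
    by (rule Lim_transform_eventually)
      (auto simp: flat_fun_def intro!: eventually_at_rightI[of 0 1])
qed

lemma flat_fun_limit: "(flat_fun P \<longlongrightarrow> 0) (at 0)"
proof -
  have "(flat_fun P \<longlongrightarrow> 0) (at_left 0)"
    by (rule Lim_transform_eventually[of "\<lambda>_. 0"])
      (auto simp: flat_fun_def intro!: eventually_at_leftI[of "-1"])
  with flat_fun_right_limit show ?thesis using filterlim_split_at by blast
qed

text \<open>For t > 0 the derivative of P(1/t) exp (-1/t) is t^(-2) (P - P')(1/t) exp (-1/t); the
  polynomial \<open>[:0, 0, 1:]\<close> stands for the factor t^(-2).\<close>

lemma flat_fun_derivative:
  "(flat_fun P has_real_derivative flat_fun ([:0, 0, 1:] * (P - pderiv P)) t) (at t)"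
proof -
  consider "t > 0" | "t = 0" | "t < 0" by linarith
  then show ?thesis
  proof cases
    case 1
    have "((\<lambda>t. poly P (1 / t) * exp (- (1 / t))) has_real_derivative
        flat_fun ([:0, 0, 1:] * (P - pderiv P)) t) (at t)"
      using 1 by (auto intro!: derivative_eq_intros DERIV_chain2[OF poly_DERIV]
          simp: flat_fun_def field_simps)
    then show ?thesis
      by (rule has_field_derivative_transform_within_open[of _ _ _ "{0<..}"])
        (use 1 in \<open>auto simp: flat_fun_def\<close>)
  next
    case 2
    \<comment> \<open>The difference quotient of \<open>flat_fun P\<close> at 0 is the flat function
      with polynomial X P, and flat functions tend to 0 there.\<close>
    have "((\<lambda>h. flat_fun ([:0, 1:] * P) h) \<longlongrightarrow> 0) (at 0)" by (rule flat_fun_limit)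
    moreover have "flat_fun ([:0, 1:] * P) h = (flat_fun P (0 + h) - flat_fun P 0) / h" for h
      by (auto simp: flat_fun_def)
    ultimately show ?thesis using 2 by (simp add: has_field_derivative_iff) (simp add: flat_fun_def)
  next
    case 3
    have "((\<lambda>t. 0) has_real_derivative flat_fun ([:0, 0, 1:] * (P - pderiv P)) t) (at t)"
      using 3 by (auto simp: flat_fun_def)
    then show ?thesis
      by (rule has_field_derivative_transform_within_open[of _ _ _ "{..<0}"])
        (use 3 in \<open>auto simp: flat_fun_def\<close>)
  qed
qed

lemma Ck_on_flat_fun: "Ck_on k UNIV (flat_fun P)"
proof (induction k arbitrary: P)
  case 0
  show ?case
    using DERIV_isCont[OF flat_fun_derivative] by (simp add: continuous_on_eq_continuous_at)
next
  case (Suc k)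
  show ?case
    by (rule Ck_on_SucI[OF _ flat_fun_derivative[unfolded has_field_derivative_def]])
      (auto intro!: Ck_on_mult Suc Ck_on_const)
qed

text \<open>The quotient u / (u + w) works because u is positive exactly inside radius 2r and w
  exactly outside radius r: the denominator never vanishes, w = 0 gives the value 1 and u = 0 the
  value 0. Squared distances keep everything smooth at the centre.\<close>

lemma Euclidean_bump:
  fixes a :: "'a::euclidean_space"
  assumes "r > 0"
  obtains h :: "'a \<Rightarrow> real" where "smooth_on UNIV h"
    "\<And>x. dist x a \<le> r \<Longrightarrow> h x = 1" "\<And>x. dist x a \<ge> 2 * r \<Longrightarrow> h x = 0"
proof -
  define d where "d x = (x - a) \<bullet> (x - a)" for x
  define u where "u x = flat_fun 1 (4 * r\<^sup>2 - d x)" for x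
  define w where "w x = flat_fun 1 (d x - r\<^sup>2)" for x
  have d: "d x = (dist x a)\<^sup>2" for x
    by (simp add: d_def dist_norm power2_norm_eq_inner)
  have pos: "flat_fun 1 t \<ge> 0" "flat_fun 1 t > 0 \<longleftrightarrow> t > 0" for t
    by (auto simp: flat_fun_def)
  have r: "4 * r\<^sup>2 > r\<^sup>2" using assms by simp
  have nz: "u x + w x > 0" for x
  proof (cases "d x < 4 * r\<^sup>2")
    case True
    then show ?thesis using pos(2)[of "4 * r\<^sup>2 - d x"] pos(1)[of "d x - r\<^sup>2"]
      by (simp add: u_def w_def)
  next
    case False
    then show ?thesis using pos(2)[of "d x - r\<^sup>2"] pos(1)[of "4 * r\<^sup>2 - d x"] r
      by (simp add: u_def w_def)
  qed
  have lin: "Ck_on k UNIV (\<lambda>x. x - a)" for k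
    by (subst diff_conv_add_uminus)
      (intro Ck_on_add Ck_on_bounded_linear bounded_linear_ident Ck_on_const open_UNIV)
  have dC: "Ck_on k UNIV (\<lambda>x. c * d x + e)" for k c e
    unfolding d_def by (intro Ck_on_add Ck_on_mult Ck_on_inner lin Ck_on_const open_UNIV)
  have uC: "Ck_on k UNIV u" and wC: "Ck_on k UNIV w" for k
    using Ck_on_compose[OF _ _ dC[of k "-1" "4 * r\<^sup>2"] Ck_on_flat_fun[of k 1]]
      Ck_on_compose[OF _ _ dC[of k "1" "- r\<^sup>2"] Ck_on_flat_fun[of k 1]]
    by (simp_all add: u_def[abs_def] w_def[abs_def] algebra_simps)
  show ?thesis
  proof (rule that[of "\<lambda>x. u x * inverse (u x + w x)"])
    show "smooth_on UNIV (\<lambda>x. u x * inverse (u x + w x))"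
      unfolding smooth_on_def using nz
      by (intro allI Ck_on_mult Ck_on_inverse Ck_on_add uC wC open_UNIV) (metis less_irrefl)
    show "u x * inverse (u x + w x) = 1" if "dist x a \<le> r" for x
    proof -
      have "d x \<le> r\<^sup>2" using that by (simp add: d power_mono)
      then have "w x = 0" by (simp add: w_def flat_fun_def)
      then show ?thesis using nz[of x] by simp
    qed
    show "u x * inverse (u x + w x) = 0" if "dist x a \<ge> 2 * r" for x
    proof -
      have "d x \<ge> 4 * r\<^sup>2" using power_mono[OF that, of 2] assms by (simp add: d)
      then show ?thesis by (simp add: u_def flat_fun_def)
    qed
  qed
qed

section \<open>Hadamard's lemma\<close>

text \<open>Differentiation under the integral sign brings out a factor t, by the chain rule for x
  \<mapsto> a + t(x - a). The power \<open>t ^ j\<close> is there to absorb it, so that the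
  induction closes.\<close>

lemma Ck_on_radial_integral:
  fixes f :: "'a::euclidean_space \<Rightarrow> real"
  assumes B: "open B" "convex B" "a \<in> B" and f: "smooth_on B f"
  shows "Ck_on k B (\<lambda>x. integral {0..1} (\<lambda>t. t ^ j * f (a + t *\<^sub>R (x - a))))"
  using f
proof (induction k arbitrary: f j)
  have seg: "a + t *\<^sub>R (x - a) \<in> B" if "x \<in> B" "t \<in> {0..1}" for x t
    using convexD[OF B(2,3) that(1), of "1 - t" t] that(2) by (simp add: algebra_simps)
  have cont: "continuous_on (B \<times> {0..1}) (\<lambda>(x, t). t ^ j * g (a + t *\<^sub>R (x - a)))"
    if "continuous_on B g" for g :: "'a \<Rightarrow> real" and j
    unfolding split_def
    by (intro continuous_intros continuous_on_compose2[OF that]) (auto intro: seg)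
  {
    case 0
    show ?case
      using integral_continuous_on_param[of B 0 1 "\<lambda>x t. t ^ j * f (a + t *\<^sub>R (x - a))"]
        cont[OF smooth_on_continuous[OF 0]] by simp
  next
    case (Suc k)
    let ?f' = "\<lambda>x. frechet_derivative f (at x)"
    \<comment> \<open>The Leibniz rule asks for a continuous family of bounded linear maps. In
      finite dimension continuity can be checked for each fixed argument v.\<close>
    let ?D = "\<lambda>x t. Blinfun (\<lambda>v. t ^ Suc j * ?f' (a + t *\<^sub>R (x - a)) v)"
    have bl: "bounded_linear (\<lambda>v. t ^ Suc j * ?f' (a + t *\<^sub>R (x - a)) v)"
      if "x \<in> B" "t \<in> {0..1}" for x t
      using smooth_on_has_derivative[OF Suc.prems seg[OF that]]
      by (intro bounded_linear_const_mult has_derivative_bounded_linear)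
    have ap: "blinfun_apply (?D x t) v = t ^ Suc j * ?f' (a + t *\<^sub>R (x - a)) v"
      if "x \<in> B" "t \<in> {0..1}" for x t v
      by (simp only: bounded_linear_Blinfun_apply[OF bl[OF that]])
    have der: "((\<lambda>x. t ^ j * f (a + t *\<^sub>R (x - a))) has_derivative blinfun_apply (?D x t))
        (at x within B)" if "x \<in> B" "t \<in> cbox 0 1" for x t
    proof -
      have t: "t \<in> {0..1}" using that by simp
      have "((\<lambda>x. a + t *\<^sub>R (x - a)) has_derivative (\<lambda>v. t *\<^sub>R v)) (at x within B)"
        by (auto intro!: derivative_eq_intros)
      from has_derivative_compose[OF this smooth_on_has_derivative[OF Suc.prems seg[OF that(1) t]]]
      have "((\<lambda>x. t ^ j * f (a + t *\<^sub>R (x - a))) has_derivative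
          (\<lambda>v. t ^ j * ?f' (a + t *\<^sub>R (x - a)) (t *\<^sub>R v))) (at x within B)"
        by (intro has_derivative_mult_right)
      moreover have "linear (?f' (a + t *\<^sub>R (x - a)))"
        using smooth_on_has_derivative[OF Suc.prems seg[OF that(1) t]] has_derivative_linear by blast
      moreover have "blinfun_apply (?D x t) = (\<lambda>v. t ^ Suc j * ?f' (a + t *\<^sub>R (x - a)) v)"
        by (rule ext) (rule ap[OF that(1) t])
      ultimately show ?thesis
        by (simp add: linear_scale mult_ac)
    qed
    have contD: "continuous_on (B \<times> cbox 0 1) (\<lambda>(x, t). ?D x t)"
    proof (rule continuous_on_blinfun_componentwise)
      fix v :: 'a
      show "continuous_on (B \<times> cbox 0 1) (\<lambda>p. blinfun_apply (case p of (x, t) \<Rightarrow> ?D x t) v)"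
        by (rule continuous_on_eq[OF cont[of _ "Suc j", OF smooth_on_continuous[OF
                  smooth_on_derivative[OF Suc.prems, of v]], folded box_real(2)]])
          (auto simp: ap simp del: power_Suc)
    qed
    have int: "(\<lambda>t. t ^ j * f (a + t *\<^sub>R (x - a))) integrable_on cbox 0 1" if "x \<in> B" for x
      using seg that
      by (intro integrable_continuous continuous_intros
          continuous_on_compose2[OF smooth_on_continuous[OF Suc.prems]]) auto
    have Dint: "?D x integrable_on {0..1}" if "x \<in> B" for x
    proof -
      have "continuous_on (cbox 0 1) (\<lambda>t. (\<lambda>(x, t). ?D x t) (x, t))"
        by (rule continuous_on_compose2[OF contD]) (use that in \<open>auto intro!: continuous_intros\<close>)
      then show ?thesis using integrable_continuous[of 0 1 "?D x"] by simp
    qed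
    show ?case
    proof (rule Ck_on_SucI[OF B(1)])
      fix x assume x: "x \<in> B"
      show "((\<lambda>x. integral {0..1} (\<lambda>t. t ^ j * f (a + t *\<^sub>R (x - a)))) has_derivative
          blinfun_apply (integral {0..1} (?D x))) (at x)"
        using leibniz_rule[OF der int contD x B(2)] at_within_open[OF x B(1)] by simp
    next
      fix v
      show "Ck_on k B (\<lambda>x. blinfun_apply (integral {0..1} (?D x)) v)"
        by (rule Ck_on_cong[OF B(1) _ Suc.IH[OF smooth_on_derivative[OF Suc.prems, of v], of "Suc j"]])
          (auto simp: blinfun_apply_integral[OF Dint] ap simp del: power_Suc intro!: integral_cong)
    qed
  }
qed

text \<open>The coefficient \<open>g i\<close> is the mean of the i-th partial derivative over the
  segment from a to x, and the expansion is the fundamental theorem of calculus on that segment.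
  Convexity keeps the segment in \<open>B\<close>.\<close>

lemma Hadamard:
  fixes f :: "'a::euclidean_space \<Rightarrow> real"
  assumes B: "open B" "convex B" "a \<in> B" and f: "smooth_on B f"
  obtains g where "\<And>i. smooth_on B (g i)" "\<And>i. g i a = frechet_derivative f (at a) i"
    "\<And>x. x \<in> B \<Longrightarrow> f x = f a + (\<Sum>i\<in>Basis. ((x - a) \<bullet> i) * g i x)"
proof -
  let ?f' = "\<lambda>x. frechet_derivative f (at x)"
  define g where "g i x = integral {0..1} (\<lambda>t. ?f' (a + t *\<^sub>R (x - a)) i)" for i x
  have seg: "a + t *\<^sub>R (x - a) \<in> B" if "x \<in> B" "t \<in> {0..1}" for x t
    using convexD[OF B(2,3) that(1), of "1 - t" t] that(2) by (simp add: algebra_simps)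
  show ?thesis
  proof (rule that[of g])
    show "smooth_on B (g i)" for i
      unfolding smooth_on_def g_def
      using Ck_on_radial_integral[OF B smooth_on_derivative[OF f], of _ 0 i] by simp
    show "g i a = ?f' a i" for i by (simp add: g_def)
    fix x assume x: "x \<in> B"
    have der: "((\<lambda>t. f (a + t *\<^sub>R (x - a))) has_vector_derivative
        (\<Sum>i\<in>Basis. ((x - a) \<bullet> i) * ?f' (a + t *\<^sub>R (x - a)) i)) (at t within {0..1})"
      if t: "t \<in> {0..1}" for t
    proof -
      note fd = smooth_on_has_derivative[OF f seg[OF x t]]
      have lin: "linear (?f' (a + t *\<^sub>R (x - a)))"
        using fd has_derivative_linear by blast
      have "((\<lambda>t. a + t *\<^sub>R (x - a)) has_derivative (\<lambda>s. s *\<^sub>R (x - a))) (at t within {0..1})"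
        by (auto intro!: derivative_eq_intros)
      from has_derivative_compose[OF this fd]
      have "((\<lambda>t. f (a + t *\<^sub>R (x - a))) has_vector_derivative
          ?f' (a + t *\<^sub>R (x - a)) (x - a)) (at t within {0..1})"
        by (simp add: has_vector_derivative_def linear_scale[OF lin])
      also have "?f' (a + t *\<^sub>R (x - a)) (x - a) =
          ?f' (a + t *\<^sub>R (x - a)) (\<Sum>i\<in>Basis. ((x - a) \<bullet> i) *\<^sub>R i)"
        by (simp only: euclidean_representation)
      also have "\<dots> = (\<Sum>i\<in>Basis. ((x - a) \<bullet> i) * ?f' (a + t *\<^sub>R (x - a)) i)"
        by (simp only: linear_sum[OF lin] linear_scale[OF lin] real_scaleR_def)
      finally show ?thesis .
    qed
    have "((\<lambda>t. \<Sum>i\<in>Basis. ((x - a) \<bullet> i) * ?f' (a + t *\<^sub>R (x - a)) i) has_integral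
        f (a + 1 *\<^sub>R (x - a)) - f (a + 0 *\<^sub>R (x - a))) {0..1}"
      by (rule fundamental_theorem_of_calculus[OF _ der]) auto
    then have "f x - f a = integral {0..1} (\<lambda>t. \<Sum>i\<in>Basis. ((x - a) \<bullet> i) * ?f' (a + t *\<^sub>R (x - a)) i)"
      by (simp add: integral_unique)
    also have "\<dots> = (\<Sum>i\<in>Basis. ((x - a) \<bullet> i) * g i x)"
      unfolding g_def using seg x
      by (subst integral_sum)
        (auto intro!: integrable_continuous_real continuous_intros
          continuous_on_compose2[OF smooth_on_continuous[OF smooth_on_derivative[OF f]]])
    finally show "f x = f a + (\<Sum>i\<in>Basis. ((x - a) \<bullet> i) * g i x)" by simp
  qed
qed

section \<open>Smooth functions and tangent vectors on a manifold\<close>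

lemma sum_fun_apply: "(\<Sum>i\<in>I. F i) x = (\<Sum>i\<in>I. F i x)"
  for F :: "'i \<Rightarrow> 'b \<Rightarrow> 'c::comm_monoid_add"
  by (induction I rule: infinite_finite_induct) auto

locale smooth_manifold =
  fixes A :: "('m::t2_space, 'a::euclidean_space) atlas"
  assumes atlas: "smooth_atlas A"
begin

lemma chart_open: "(U, \<phi>) \<in> A \<Longrightarrow> open U"
  and chart_homeomorphism: "(U, \<phi>) \<in> A \<Longrightarrow> homeomorphism U (\<phi> ` U) \<phi> (inv_into U \<phi>)"
  and chart_image_open: "(U, \<phi>) \<in> A \<Longrightarrow> open (\<phi> ` U)"
  and chart_transition: "(U, \<phi>) \<in> A \<Longrightarrow> (V, \<psi>) \<in> A \<Longrightarrow>
    smooth_on (\<phi> ` (U \<inter> V)) (\<psi> \<circ> inv_into U \<phi>)"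
  using atlas unfolding smooth_atlas_def by blast+

lemma chart_at: obtains U \<phi> where "(U, \<phi>) \<in> A" "p \<in> U"
proof -
  have "p \<in> (\<Union>(U, \<phi>)\<in>A. U)" using atlas by (simp add: smooth_atlas_def)
  then show ?thesis using that by auto
qed

lemma chart_inv: "(U, \<phi>) \<in> A \<Longrightarrow> q \<in> U \<Longrightarrow> inv_into U \<phi> (\<phi> q) = q"
  using chart_homeomorphism homeomorphism_apply1 by blast

lemma chart_continuous: "(U, \<phi>) \<in> A \<Longrightarrow> continuous_on U \<phi>"
  and chart_inv_continuous: "(U, \<phi>) \<in> A \<Longrightarrow> continuous_on (\<phi> ` U) (inv_into U \<phi>)"
  using chart_homeomorphism unfolding homeomorphism_def by blast+

lemma chart_open_image:
  assumes "(U, \<phi>) \<in> A" "open V"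
  shows "open (\<phi> ` (U \<inter> V))"
proof -
  have "\<phi> ` (U \<inter> V) = \<phi> ` U \<inter> inv_into U \<phi> -` V"
    using chart_inv[OF assms(1)] by force
  then show ?thesis
    using continuous_open_preimage[OF chart_inv_continuous[OF assms(1)] chart_image_open[OF assms(1)]
        assms(2)] by simp
qed

lemma chart_open_preimage: "(U, \<phi>) \<in> A \<Longrightarrow> open B \<Longrightarrow> open (U \<inter> \<phi> -` B)"
  by (intro continuous_open_preimage chart_continuous chart_open)

lemma smooth_fun_onD: "smooth_fun_on A W f \<Longrightarrow> (U, \<phi>) \<in> A \<Longrightarrow> smooth_on (\<phi> ` (U \<inter> W)) (f \<circ> inv_into U \<phi>)"
  unfolding smooth_fun_on_def by blast

lemma smooth_fun_on_subset: "smooth_fun_on A W f \<Longrightarrow> V \<subseteq> W \<Longrightarrow> smooth_fun_on A V f"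
  unfolding smooth_fun_on_def by (blast intro: smooth_on_subset)

lemma smooth_fun_on_cong:
  assumes "open W" "\<And>q. q \<in> W \<Longrightarrow> f q = g q" "smooth_fun_on A W f"
  shows "smooth_fun_on A W g"
  unfolding smooth_fun_on_def
proof clarify
  fix U \<phi> assume c: "(U, \<phi>) \<in> A"
  show "smooth_on (\<phi> ` (U \<inter> W)) (g \<circ> inv_into U \<phi>)"
    by (rule smooth_on_cong[OF chart_open_image[OF c assms(1)] _ smooth_fun_onD[OF assms(3) c]])
      (auto simp: chart_inv[OF c] assms(2))
qed

lemma smooth_fun_on_local:
  assumes "\<And>q. q \<in> W \<Longrightarrow> \<exists>V. open V \<and> q \<in> V \<and> smooth_fun_on A V f"
  shows "smooth_fun_on A W f"
  unfolding smooth_fun_on_def smooth_on_def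
proof clarify
  fix U \<phi> k assume c: "(U, \<phi>) \<in> A"
  show "Ck_on k (\<phi> ` (U \<inter> W)) (f \<circ> inv_into U \<phi>)"
  proof (rule Ck_on_local, clarify)
    fix q assume q: "q \<in> U" "q \<in> W"
    then obtain V where V: "open V" "q \<in> V" "smooth_fun_on A V f" using assms by blast
    show "\<exists>T. open T \<and> \<phi> q \<in> T \<and> Ck_on k T (f \<circ> inv_into U \<phi>)"
      using chart_open_image[OF c V(1)] smooth_fun_onD[OF V(3) c] q V(2)
      unfolding smooth_on_def by blast
  qed
qed

lemma smooth_fun_on_const: "smooth_fun_on A W (\<lambda>q. c)"
  by (auto simp: smooth_fun_on_def smooth_on_def o_def Ck_on_const)

lemma smooth_fun_on_add:
  "open W \<Longrightarrow> smooth_fun_on A W f \<Longrightarrow> smooth_fun_on A W g \<Longrightarrow> smooth_fun_on A W (\<lambda>q. f q + g q)"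
  unfolding smooth_fun_on_def smooth_on_def o_def
  using Ck_on_add[OF chart_open_image] by fastforce

lemma smooth_fun_on_mult:
  "open W \<Longrightarrow> smooth_fun_on A W f \<Longrightarrow> smooth_fun_on A W g \<Longrightarrow> smooth_fun_on A W (\<lambda>q. f q * g q)"
  unfolding smooth_fun_on_def smooth_on_def o_def
  using Ck_on_mult[OF chart_open_image] by fastforce

lemma smooth_fun_on_sum:
  "open W \<Longrightarrow> (\<And>i. i \<in> I \<Longrightarrow> smooth_fun_on A W (f i)) \<Longrightarrow> smooth_fun_on A W (\<lambda>q. \<Sum>i\<in>I. f i q)"
  by (induction I rule: infinite_finite_induct)
    (auto intro: smooth_fun_on_const smooth_fun_on_add)

lemma smooth_fun_on_inverse:
  assumes "open W" "smooth_fun_on A W f" "\<And>q. q \<in> W \<Longrightarrow> f q \<noteq> 0"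
  shows "smooth_fun_on A W (\<lambda>q. inverse (f q))"
  unfolding smooth_fun_on_def smooth_on_def o_def
proof clarify
  fix U \<phi> k assume c: "(U, \<phi>) \<in> A"
  show "Ck_on k (\<phi> ` (U \<inter> W)) (\<lambda>x. inverse (f (inv_into U \<phi> x)))"
    using smooth_fun_onD[OF assms(2) c] assms(3)
    by (intro Ck_on_inverse chart_open_image[OF c assms(1)])
      (auto simp: smooth_on_def o_def chart_inv[OF c])
qed

text \<open>In another chart \<psi> the function is h after the coordinate change from \<psi> to
  \<phi>, which is smooth; so smoothness in one chart is enough.\<close>

lemma smooth_fun_on_chart:
  assumes c: "(U, \<phi>) \<in> A" and W: "open W" "W \<subseteq> U" and h: "smooth_on (\<phi> ` W) h"
  shows "smooth_fun_on A W (\<lambda>q. h (\<phi> q))"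
  unfolding smooth_fun_on_def smooth_on_def o_def
proof clarify
  fix V \<psi> k assume d: "(V, \<psi>) \<in> A"
  have "Ck_on k (\<psi> ` (V \<inter> W)) (\<lambda>x. \<phi> (inv_into V \<psi> x))"
    using smooth_on_subset[OF chart_transition[OF d c], of "\<psi> ` (V \<inter> W)"] W
    by (auto simp: smooth_on_def o_def)
  moreover have "open (\<phi> ` W)"
    using chart_open_image[OF c W(1)] W(2) by (simp add: Int_absorb1)
  moreover have "(\<lambda>x. \<phi> (inv_into V \<psi> x)) ` \<psi> ` (V \<inter> W) \<subseteq> \<phi> ` W"
    using chart_inv[OF d] by auto
  moreover have "Ck_on k (\<phi> ` W) h" using h by (simp add: smooth_on_def)
  ultimately show "Ck_on k (\<psi> ` (V \<inter> W)) (\<lambda>x. h (\<phi> (inv_into V \<psi> x)))"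
    using Ck_on_compose[OF chart_open_image[OF d W(1)]] by blast
qed

lemma smooth_funs_iff: "f \<in> smooth_funs A \<longleftrightarrow> smooth_fun_on A UNIV f"
  by (simp add: smooth_funs_def)

lemma smooth_funs_on: "f \<in> smooth_funs A \<Longrightarrow> smooth_fun_on A W f"
  using smooth_fun_on_subset smooth_funs_iff by blast

lemma smooth_funs_const: "(\<lambda>q. c) \<in> smooth_funs A"
  by (simp add: smooth_funs_iff smooth_fun_on_const)

lemma smooth_funs_add: "f \<in> smooth_funs A \<Longrightarrow> g \<in> smooth_funs A \<Longrightarrow> (\<lambda>q. f q + g q) \<in> smooth_funs A"
  by (simp add: smooth_funs_iff smooth_fun_on_add)

lemma smooth_funs_mult: "f \<in> smooth_funs A \<Longrightarrow> g \<in> smooth_funs A \<Longrightarrow> (\<lambda>q. f q * g q) \<in> smooth_funs A"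
  by (simp add: smooth_funs_iff smooth_fun_on_mult)

lemma smooth_funs_sum: "(\<And>i. i \<in> I \<Longrightarrow> f i \<in> smooth_funs A) \<Longrightarrow> (\<lambda>q. \<Sum>i\<in>I. f i q) \<in> smooth_funs A"
  by (simp add: smooth_funs_iff smooth_fun_on_sum)

lemma smooth_funs_diff:
  assumes "f \<in> smooth_funs A" "g \<in> smooth_funs A"
  shows "(\<lambda>q. f q - g q) \<in> smooth_funs A"
  using smooth_funs_add[OF assms(1) smooth_funs_mult[OF smooth_funs_const[of "-1"] assms(2)]] by simp

text \<open>The open sets V \<inter> W and - K cover \<open>V\<close>. On the first the function is
  a product of smooth functions, on the second it is zero.\<close>

lemma smooth_fun_on_extend_zero:
  assumes "open W" "open V" "smooth_fun_on A V \<rho>" "closed K" "K \<inter> V \<subseteq> W" "\<And>q. q \<notin> K \<Longrightarrow> \<rho> q = 0"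
    and g: "smooth_fun_on A (V \<inter> W) g"
  shows "smooth_fun_on A V (\<lambda>q. if q \<in> W then \<rho> q * g q else 0)"
proof (rule smooth_fun_on_local)
  fix q assume q: "q \<in> V"
  show "\<exists>N. open N \<and> q \<in> N \<and> smooth_fun_on A N (\<lambda>q. if q \<in> W then \<rho> q * g q else 0)"
  proof (cases "q \<in> W")
    case True
    have "smooth_fun_on A (V \<inter> W) (\<lambda>q. if q \<in> W then \<rho> q * g q else 0)"
      by (rule smooth_fun_on_cong[OF _ _ smooth_fun_on_mult[OF _ smooth_fun_on_subset[OF assms(3)] g]])
        (use assms in auto)
    then show ?thesis using True q assms(1,2) by (intro exI[of _ "V \<inter> W"]) auto
  next
    case False
    have "smooth_fun_on A (- K) (\<lambda>q. if q \<in> W then \<rho> q * g q else 0)"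
      by (rule smooth_fun_on_cong[OF _ _ smooth_fun_on_const[of _ 0]]) (use assms in auto)
    then show ?thesis using False q assms by (intro exI[of _ "- K"]) auto
  qed
qed

lemma smooth_funs_extend_zero:
  assumes "open W" "\<rho> \<in> smooth_funs A" "closed K" "K \<subseteq> W" "\<And>q. q \<notin> K \<Longrightarrow> \<rho> q = 0"
    and "smooth_fun_on A W g"
  shows "(\<lambda>q. if q \<in> W then \<rho> q * g q else 0) \<in> smooth_funs A"
  using smooth_fun_on_extend_zero[OF assms(1) open_UNIV _ assms(3), of \<rho> g] assms
  by (simp add: smooth_funs_iff)

text \<open>Two sets accompany the function: on the neighbourhood \<open>N\<close> it is 1, so that
  multiplication changes nothing there, and outside the closed set \<open>K\<close> it is 0, so that
  data on \<open>W\<close> extend by zero.\<close>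

lemma bump:
  assumes W: "open W" "p \<in> W"
  obtains \<rho> N K where "\<rho> \<in> smooth_funs A" "open N" "p \<in> N" "N \<subseteq> W" "closed K" "K \<subseteq> W"
    "\<And>q. q \<in> N \<Longrightarrow> \<rho> q = 1" "\<And>q. q \<notin> K \<Longrightarrow> \<rho> q = 0"
proof -
  obtain U \<phi> where c: "(U, \<phi>) \<in> A" "p \<in> U" by (rule chart_at)
  have "open (\<phi> ` (U \<inter> W))" "\<phi> p \<in> \<phi> ` (U \<inter> W)"
    using chart_open_image[OF c(1) W(1)] c(2) W(2) by auto
  then obtain s where s: "s > 0" "cball (\<phi> p) s \<subseteq> \<phi> ` (U \<inter> W)"
    using open_contains_cball by blast
  define r where "r = s / 2"
  have r: "r > 0" "cball (\<phi> p) (2 * r) \<subseteq> \<phi> ` (U \<inter> W)" using s by (auto simp: r_def)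
  obtain h where h: "smooth_on UNIV h" "\<And>x. dist x (\<phi> p) \<le> r \<Longrightarrow> h x = 1"
      "\<And>x. dist x (\<phi> p) \<ge> 2 * r \<Longrightarrow> h x = (0::real)"
    using Euclidean_bump[OF r(1)] by metis
  define \<rho> where "\<rho> q = (if q \<in> U then h (\<phi> q) else 0)" for q
  define N where "N = U \<inter> \<phi> -` ball (\<phi> p) r"
  define K where "K = inv_into U \<phi> ` cball (\<phi> p) (2 * r)"
  \<comment> \<open>Here the Hausdorff property enters: the compact set \<open>K\<close> is closed
    in the whole manifold, so \<rho> vanishes on an open set around each point outside the
    chart.\<close>
  have K: "closed K"
    unfolding K_def using r(2)
    by (intro compact_imp_closed compact_continuous_image compact_cball
        continuous_on_subset[OF chart_inv_continuous[OF c(1)]]) auto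
  have KW: "K \<subseteq> U \<inter> W"
  proof
    fix q assume "q \<in> K"
    then obtain x where x: "x \<in> cball (\<phi> p) (2 * r)" "q = inv_into U \<phi> x" by (auto simp: K_def)
    with r(2) obtain q' where "q' \<in> U \<inter> W" "x = \<phi> q'" by blast
    then show "q \<in> U \<inter> W" using x(2) chart_inv[OF c(1)] by simp
  qed
  have zero: "\<rho> q = 0" if "q \<notin> K" for q
  proof (cases "q \<in> U")
    case True
    have "\<phi> q \<notin> cball (\<phi> p) (2 * r)"
      using that chart_inv[OF c(1) True] unfolding K_def by (metis imageI)
    then show ?thesis using h(3)[of "\<phi> q"] by (simp add: \<rho>_def dist_commute)
  qed (simp add: \<rho>_def)
  have N1: "\<rho> q = 1" if "q \<in> N" for q
    using that h(2)[of "\<phi> q"] by (auto simp: N_def \<rho>_def dist_commute)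
  have "\<rho> \<in> smooth_funs A"
    unfolding smooth_funs_iff
  proof (rule smooth_fun_on_local)
    fix q
    show "\<exists>V. open V \<and> q \<in> V \<and> smooth_fun_on A V \<rho>"
    proof (cases "q \<in> U")
      case True
      have "smooth_fun_on A U \<rho>"
        by (rule smooth_fun_on_cong[OF chart_open[OF c(1)] _ smooth_fun_on_chart[OF c(1)
                chart_open[OF c(1)] subset_refl smooth_on_subset[OF h(1)]]]) (auto simp: \<rho>_def)
      then show ?thesis using True chart_open[OF c(1)] by blast
    next
      case False
      have "smooth_fun_on A (- K) \<rho>"
        by (rule smooth_fun_on_cong[OF _ _ smooth_fun_on_const[of _ 0]]) (use K zero in auto)
      then show ?thesis using False K KW by (intro exI[of _ "- K"]) auto
    qed
  qed
  moreover have "N \<subseteq> K" using N1 zero by (metis subsetI zero_neq_one)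
  moreover have "p \<in> N" "open N"
    using c r(1) chart_open_preimage[OF c(1) open_ball] by (auto simp: N_def)
  ultimately show ?thesis using that[of \<rho> N K] K KW zero N1 by blast
qed

text \<open>The inverse of g exists only where g does not vanish; cut off inside that region it
  becomes a global function, as required for multiplying sections.\<close>

lemma smooth_inverse_near:
  assumes "g \<in> smooth_funs A" "g p \<noteq> 0"
  obtains h N where "h \<in> smooth_funs A" "open N" "p \<in> N" "\<And>q. q \<in> N \<Longrightarrow> g q \<noteq> 0 \<and> h q = inverse (g q)"
proof -
  obtain U \<phi> where c: "(U, \<phi>) \<in> A" "p \<in> U" by (rule chart_at)
  define W where "W = {q \<in> U. g q \<noteq> 0}"
  have "W = U \<inter> \<phi> -` (\<phi> ` U \<inter> (g \<circ> inv_into U \<phi>) -` (- {0}))"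
    using chart_inv[OF c(1)] by (force simp: W_def)
  moreover have "open (\<phi> ` U \<inter> (g \<circ> inv_into U \<phi>) -` (- {0}))"
    using smooth_on_continuous[OF smooth_fun_onD[OF smooth_funs_on[OF assms(1), of UNIV] c(1)]]
    by (intro continuous_open_preimage chart_image_open[OF c(1)]) auto
  ultimately have W: "open W" using chart_open_preimage[OF c(1)] by metis
  have pW: "p \<in> W" using c assms by (simp add: W_def)
  obtain \<rho> N K where b: "\<rho> \<in> smooth_funs A" "open N" "p \<in> N" "N \<subseteq> W" "closed K" "K \<subseteq> W"
    "\<And>q. q \<in> N \<Longrightarrow> \<rho> q = 1" "\<And>q. q \<notin> K \<Longrightarrow> \<rho> q = 0" by (rule bump[OF W pW]) metis
  show ?thesis
  proof (rule that[of "\<lambda>q. if q \<in> W then \<rho> q * inverse (g q) else 0" N])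
    show "(\<lambda>q. if q \<in> W then \<rho> q * inverse (g q) else 0) \<in> smooth_funs A"
      using b W smooth_funs_on[OF assms(1)]
      by (intro smooth_funs_extend_zero[of W \<rho> K] smooth_fun_on_inverse) (auto simp: W_def)
  qed (use b in \<open>auto simp: W_def\<close>)
qed

section \<open>Tangent vectors as derivations, and coordinate vectors\<close>

lemma tangent_add: "u \<in> tangent_space A p \<Longrightarrow> f \<in> smooth_funs A \<Longrightarrow> g \<in> smooth_funs A \<Longrightarrow>
    u (\<lambda>q. f q + g q) = u f + u g"
  and tangent_cmult: "u \<in> tangent_space A p \<Longrightarrow> f \<in> smooth_funs A \<Longrightarrow> u (\<lambda>q. c * f q) = c * u f"
  and tangent_mult: "u \<in> tangent_space A p \<Longrightarrow> f \<in> smooth_funs A \<Longrightarrow> g \<in> smooth_funs A \<Longrightarrow>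
    u (\<lambda>q. f q * g q) = u f * g p + f p * u g"
  and tangent_nonsmooth: "u \<in> tangent_space A p \<Longrightarrow> f \<notin> smooth_funs A \<Longrightarrow> u f = 0"
  by (auto simp: tangent_space_def)

text \<open>The product rule for 1 * 1 gives u(1) = 2 u(1).\<close>

lemma tangent_const:
  assumes "u \<in> tangent_space A p"
  shows "u (\<lambda>q. c) = 0"
  using tangent_mult[OF assms smooth_funs_const[of 1] smooth_funs_const[of 1]]
    tangent_cmult[OF assms smooth_funs_const[of 1], of c] by simp

lemma tangent_diff:
  assumes "u \<in> tangent_space A p" "f \<in> smooth_funs A" "g \<in> smooth_funs A"
  shows "u (\<lambda>q. f q - g q) = u f - u g"
  using tangent_add[OF assms(1,2) smooth_funs_mult[OF smooth_funs_const[of "-1"] assms(3)]]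
    tangent_cmult[OF assms(1,3), of "-1"] by simp

lemma tangent_sum:
  assumes "u \<in> tangent_space A p" "\<And>i. i \<in> I \<Longrightarrow> f i \<in> smooth_funs A"
  shows "u (\<lambda>q. \<Sum>i\<in>I. f i q) = (\<Sum>i\<in>I. u (f i))"
  using assms(2)
  by (induction I rule: infinite_finite_induct)
    (simp_all add: tangent_const[OF assms(1)] tangent_add[OF assms(1)] smooth_funs_sum)

lemma subspace_tangent_space: "subspace (tangent_space A p)"
  unfolding subspace_def tangent_space_def by (auto simp: algebra_simps)

text \<open>The partial derivative at q in direction v in the chart. The value 0 on non-smooth
  functions is the convention that \<open>tangent_space\<close> imposes on derivations.\<close>

definition coordinate_vector :: "'m set \<Rightarrow> ('m \<Rightarrow> 'a) \<Rightarrow> 'a \<Rightarrow> 'm \<Rightarrow> 'm tangent" where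
  "coordinate_vector U \<phi> v q f =
     (if f \<in> smooth_funs A then frechet_derivative (f \<circ> inv_into U \<phi>) (at (\<phi> q)) v else 0)"

lemma chart_has_derivative:
  assumes "(U, \<phi>) \<in> A" "q \<in> U" "f \<in> smooth_funs A"
  shows "((f \<circ> inv_into U \<phi>) has_derivative (\<lambda>v. coordinate_vector U \<phi> v q f)) (at (\<phi> q))"
  using smooth_on_has_derivative[OF smooth_fun_onD[OF smooth_funs_on[OF assms(3), of UNIV] assms(1)],
      of "\<phi> q"] assms
  by (simp add: coordinate_vector_def)

lemma coordinate_vector_eqI:
  assumes "f \<in> smooth_funs A" "((f \<circ> inv_into U \<phi>) has_derivative f') (at (\<phi> q))"
  shows "coordinate_vector U \<phi> v q f = f' v"
  using frechet_derivative_at[OF assms(2)] assms(1) by (simp add: coordinate_vector_def)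

lemma coordinate_vector_tangent:
  assumes c: "(U, \<phi>) \<in> A" "q \<in> U"
  shows "coordinate_vector U \<phi> v q \<in> tangent_space A q"
proof -
  note d = chart_has_derivative[OF c]
  have "coordinate_vector U \<phi> v q (\<lambda>x. f x + g x) =
      coordinate_vector U \<phi> v q f + coordinate_vector U \<phi> v q g"
    if "f \<in> smooth_funs A" "g \<in> smooth_funs A" for f g
    using coordinate_vector_eqI[OF smooth_funs_add[OF that], where U = U and \<phi> = \<phi>, unfolded o_def,
        OF has_derivative_add[OF d[OF that(1), unfolded o_def] d[OF that(2), unfolded o_def]]] .
  moreover have "coordinate_vector U \<phi> v q (\<lambda>x. c * f x) = c * coordinate_vector U \<phi> v q f"
    if "f \<in> smooth_funs A" for f c
    using coordinate_vector_eqI[OF smooth_funs_mult[OF smooth_funs_const that], where U = U and \<phi> = \<phi>, unfolded o_def,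
        OF has_derivative_mult_right[OF d[OF that, unfolded o_def]]] .
  moreover have "coordinate_vector U \<phi> v q (\<lambda>x. f x * g x) =
      coordinate_vector U \<phi> v q f * g q + f q * coordinate_vector U \<phi> v q g"
    if "f \<in> smooth_funs A" "g \<in> smooth_funs A" for f g
    using coordinate_vector_eqI[OF smooth_funs_mult[OF that], where U = U and \<phi> = \<phi>, unfolded o_def,
        OF has_derivative_mult[OF d[OF that(1), unfolded o_def] d[OF that(2), unfolded o_def]], of v]
      chart_inv[OF c] by simp
  ultimately show ?thesis
    by (auto simp: tangent_space_def coordinate_vector_def)
qed

text \<open>Near q, Hadamard's lemma writes f as f(q) plus a sum of y_i g_i, where y_i is the i-th
  coordinate shifted to vanish at q. A derivation kills the constant, and because y_i vanishes at q
  it sees each product only as u(y_i) g_i(q), where g_i(q) is the partial derivative. The functions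
  \<open>x i\<close> are global stand-ins for the coordinates.\<close>

lemma tangent_vector_expansion:
  assumes c: "(U, \<phi>) \<in> A" "q \<in> U" and u: "u \<in> tangent_space A q"
    and N: "open N" "q \<in> N" and x: "\<And>i. i \<in> Basis \<Longrightarrow> x i \<in> smooth_funs A"
      "\<And>i z. i \<in> Basis \<Longrightarrow> z \<in> N \<inter> U \<Longrightarrow> x i z = \<phi> z \<bullet> i"
    and f: "f \<in> smooth_funs A"
  shows "u f = (\<Sum>i\<in>Basis. u (x i) * coordinate_vector U \<phi> i q f)"
proof -
  let ?F = "f \<circ> inv_into U \<phi>"
  have "open (\<phi> ` (U \<inter> N))" "\<phi> q \<in> \<phi> ` (U \<inter> N)"
    using chart_open_image[OF c(1) N(1)] c(2) N(2) by auto
  then obtain s where s: "s > 0" "ball (\<phi> q) s \<subseteq> \<phi> ` (U \<inter> N)"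
    using open_contains_ball by blast
  let ?B = "ball (\<phi> q) s"
  have "smooth_on ?B ?F"
    by (rule smooth_on_subset[OF smooth_fun_onD[OF smooth_funs_on[OF f, of UNIV] c(1)]]) (use s in auto)
  then obtain g where g: "\<And>i. smooth_on ?B (g i)" "\<And>i. g i (\<phi> q) = frechet_derivative ?F (at (\<phi> q)) i"
      "\<And>y. y \<in> ?B \<Longrightarrow> ?F y = ?F (\<phi> q) + (\<Sum>i\<in>Basis. ((y - \<phi> q) \<bullet> i) * g i y)"
    by (rule Hadamard[rotated 3]) (use s(1) in auto)
  define W where "W = U \<inter> \<phi> -` ?B"
  have W: "open W" "q \<in> W" "W \<subseteq> U"
    using chart_open_preimage[OF c(1) open_ball] c(2) s(1) by (auto simp: W_def)
  have WN: "W \<subseteq> N"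
  proof
    fix z assume "z \<in> W"
    then have z: "z \<in> U" "\<phi> z \<in> ?B" by (auto simp: W_def)
    then obtain z' where "z' \<in> U \<inter> N" "\<phi> z' = \<phi> z" using s(2) by (metis imageE subsetD)
    then show "z \<in> N" using chart_inv[OF c(1)] z(1) by (metis IntD1 IntD2)
  qed
  obtain \<rho> M K where b: "\<rho> \<in> smooth_funs A" "open M" "q \<in> M" "M \<subseteq> W" "closed K" "K \<subseteq> W"
    "\<And>z. z \<in> M \<Longrightarrow> \<rho> z = 1" "\<And>z. z \<notin> K \<Longrightarrow> \<rho> z = 0" by (rule bump[OF W(1,2)]) metis
  define G where "G i z = (if z \<in> W then \<rho> z * g i (\<phi> z) else 0)" for i z
  have G: "G i \<in> smooth_funs A" for i
    unfolding G_def
    by (rule smooth_funs_extend_zero[OF W(1) b(1,5,6,8) smooth_fun_on_chart[OF c(1) W(1,3)]])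
      (auto intro: smooth_on_subset[OF g(1)] simp: W_def)
  define y where "y i z = x i z - \<phi> q \<bullet> i" for i z
  have y: "y i \<in> smooth_funs A" if "i \<in> Basis" for i
    unfolding y_def using smooth_funs_diff[OF x(1)[OF that] smooth_funs_const] .
  \<comment> \<open>Multiplied by \<rho> twice (one factor sits in \<open>G\<close>), the local
    expansion becomes an identity of global smooth functions, on which u is defined. When u is
    applied, the terms with u(\<rho>^2) occur on both sides and cancel.\<close>
  have id: "\<rho> z * \<rho> z * f z = f q * (\<rho> z * \<rho> z) + (\<Sum>i\<in>Basis. \<rho> z * y i z * G i z)" for z
  proof (cases "z \<in> W")
    case True
    then have "f z = f q + (\<Sum>i\<in>Basis. y i z * g i (\<phi> z))"
      using g(3)[of "\<phi> z"] chart_inv[OF c(1)] c(2) x(2)[of _ z] W WN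
      by (auto simp: W_def y_def inner_diff_left)
    then show ?thesis using True
      by (simp add: G_def algebra_simps sum_distrib_left)
  next
    case False
    then show ?thesis using b(6,8) by (auto simp: G_def)
  qed
  have \<rho>q: "\<rho> q = 1" using b by simp
  note tm = tangent_mult[OF u]
  have "u (\<lambda>z. \<rho> z * \<rho> z * f z) = u (\<lambda>z. \<rho> z * \<rho> z) * f q + u f"
    using tm[OF smooth_funs_mult[OF b(1) b(1)] f] \<rho>q by simp
  moreover have "u (\<lambda>z. f q * (\<rho> z * \<rho> z) + (\<Sum>i\<in>Basis. \<rho> z * y i z * G i z)) =
      f q * u (\<lambda>z. \<rho> z * \<rho> z) + (\<Sum>i\<in>Basis. u (\<lambda>z. \<rho> z * y i z * G i z))"
    by (simp add: tangent_add[OF u] tangent_sum[OF u] tangent_cmult[OF u] smooth_funs_sum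
        smooth_funs_mult smooth_funs_const b(1) y G)
  moreover have "u (\<lambda>z. \<rho> z * y i z * G i z) = u (x i) * coordinate_vector U \<phi> i q f"
    if i: "i \<in> Basis" for i
  proof -
    have y0: "y i q = 0" using x(2)[OF i] c(2) N(2) by (simp add: y_def)
    have "u (\<lambda>z. \<rho> z * y i z * G i z) = u (\<lambda>z. \<rho> z * y i z) * G i q"
      using tm[OF smooth_funs_mult[OF b(1) y[OF i]] G] y0 by simp
    also have "u (\<lambda>z. \<rho> z * y i z) = u (y i)"
      using tm[OF b(1) y[OF i]] y0 \<rho>q by simp
    also have "u (y i) = u (x i)"
      unfolding y_def[abs_def]
      by (simp add: tangent_diff[OF u x(1)[OF i] smooth_funs_const] tangent_const[OF u])
    also have "G i q = coordinate_vector U \<phi> i q f"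
      using W(2) \<rho>q g(2) f by (simp add: G_def coordinate_vector_def)
    finally show ?thesis .
  qed
  ultimately show ?thesis unfolding id by simp
qed

text \<open>Coordinates and coordinate vectors of a chart, cut off by the same bump function, become
  global functions and global fields. On \<open>N\<close>, where the bump function is 1, they remain
  dual to each other and the fields span.\<close>

lemma local_coordinates:
  fixes p :: 'm
  obtains N and E :: "'a \<Rightarrow> 'm \<Rightarrow> 'm tangent" and x where "open N" "p \<in> N"
    "\<And>i. i \<in> Basis \<Longrightarrow> E i \<in> vector_fields A" "\<And>i. i \<in> Basis \<Longrightarrow> x i \<in> smooth_funs A"
    "\<And>q i j. q \<in> N \<Longrightarrow> i \<in> Basis \<Longrightarrow> j \<in> Basis \<Longrightarrow> E i q (x j) = of_bool (i = j)"
    "\<And>q u. q \<in> N \<Longrightarrow> u \<in> tangent_space A q \<Longrightarrow> u = (\<Sum>i\<in>Basis. u (x i) *\<^sub>R E i q)"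
proof -
  obtain U \<phi> where c: "(U, \<phi>) \<in> A" "p \<in> U" by (rule chart_at)
  have U: "open U" by (rule chart_open[OF c(1)])
  obtain \<rho> N K where b: "\<rho> \<in> smooth_funs A" "open N" "p \<in> N" "N \<subseteq> U" "closed K" "K \<subseteq> U"
    "\<And>q. q \<in> N \<Longrightarrow> \<rho> q = 1" "\<And>q. q \<notin> K \<Longrightarrow> \<rho> q = 0" by (rule bump[OF U c(2)]) metis
  define x where "x i q = (if q \<in> U then \<rho> q * (\<phi> q \<bullet> i) else 0)" for i q
  define E where "E i q = (if q \<in> U then \<rho> q *\<^sub>R coordinate_vector U \<phi> i q else 0)" for i q
  have x: "x i \<in> smooth_funs A" for i
  proof -
    have "smooth_on (\<phi> ` U) (\<lambda>y. y \<bullet> i)"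
      unfolding smooth_on_def
      by (auto intro!: Ck_on_bounded_linear chart_image_open[OF c(1)] bounded_linear_inner_left)
    then show ?thesis
      unfolding x_def using smooth_funs_extend_zero[OF U b(1,5,6,8) smooth_fun_on_chart[OF c(1) U subset_refl]]
      by simp
  qed
  have xN: "x i z = \<phi> z \<bullet> i" if "z \<in> N" for i z
    using that b(4,7) by (auto simp: x_def)
  have EN: "E i q = coordinate_vector U \<phi> i q" if "q \<in> N" for i q
    using that b(4,7) by (auto simp: E_def)
  have sm: "(\<lambda>q. E i q f) \<in> smooth_funs A" if f: "f \<in> smooth_funs A" for i f
  proof -
    have "smooth_fun_on A U (\<lambda>q. frechet_derivative (f \<circ> inv_into U \<phi>) (at (\<phi> q)) i)"
      using smooth_on_derivative[OF smooth_fun_onD[OF smooth_funs_on[OF f, of UNIV] c(1)], of i]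
      by (intro smooth_fun_on_chart[OF c(1) U subset_refl]) (simp only: Int_UNIV_right)
    from smooth_funs_extend_zero[OF U b(1,5,6,8) this]
    have "(\<lambda>q. if q \<in> U then \<rho> q * frechet_derivative (f \<circ> inv_into U \<phi>) (at (\<phi> q)) i else 0)
      \<in> smooth_funs A" .
    moreover have "(\<lambda>q. if q \<in> U then \<rho> q * frechet_derivative (f \<circ> inv_into U \<phi>) (at (\<phi> q)) i else 0)
        = (\<lambda>q. E i q f)"
      using f by (auto simp: E_def coordinate_vector_def)
    ultimately show ?thesis by simp
  qed
  have tan: "E i q \<in> tangent_space A q" for i q
    using coordinate_vector_tangent[OF c(1)] subspace_tangent_space[of q]
    by (auto simp: E_def intro: subspace_scale subspace_0)
  show ?thesis
  proof (rule that[of N E x])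
    show "E i \<in> vector_fields A" for i using tan sm by (simp add: vector_fields_def)
  next
    fix q and i j :: 'a assume q: "q \<in> N" and ij: "i \<in> Basis" "j \<in> Basis"
    have "((\<lambda>y. y \<bullet> j) has_derivative (\<lambda>v. v \<bullet> j)) (at (\<phi> q))"
      by (auto intro!: derivative_eq_intros)
    then have "((x j \<circ> inv_into U \<phi>) has_derivative (\<lambda>v. v \<bullet> j)) (at (\<phi> q))"
      by (rule has_derivative_transform_within_open[OF _ chart_open_image[OF c(1) b(2)]])
        (use q b(4) in \<open>auto simp: chart_inv[OF c(1)] xN\<close>)
    from coordinate_vector_eqI[OF x this] show "E i q (x j) = of_bool (i = j)"
      using q ij by (simp add: EN inner_Basis)
  next
    fix q u assume q: "q \<in> N" and u: "u \<in> tangent_space A q"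
    show "u = (\<Sum>i\<in>Basis. u (x i) *\<^sub>R E i q)"
    proof
      fix f
      have *: "(\<Sum>i\<in>Basis. u (x i) *\<^sub>R E i q) f = (\<Sum>i\<in>Basis. u (x i) * E i q f)"
        by (simp add: sum_fun_apply)
      show "u f = (\<Sum>i\<in>Basis. u (x i) *\<^sub>R E i q) f"
      proof (cases "f \<in> smooth_funs A")
        case True
        then show ?thesis
          unfolding * unfolding EN[OF q]
          using q b(4) by (intro tangent_vector_expansion[OF c(1) _ u b(2) q x _ True] xN) auto
      next
        case False
        then show ?thesis
          unfolding * unfolding EN[OF q] using tangent_nonsmooth[OF u] by (simp add: coordinate_vector_def)
      qed
    qed
  qed (use b x in auto)
qed

end

section \<open>Sections of vector bundles\<close>

lemma indexed_basis_expand: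
  assumes "indexed_basis r V e" "x \<in> V"
  obtains c where "x = (\<Sum>i<r. c i *\<^sub>R e i)"
proof -
  have "x \<in> span (e ` {..<r})" using assms by (simp add: indexed_basis_def)
  then obtain u where "x = (\<Sum>v\<in>e ` {..<r}. u v *\<^sub>R v)" by (auto simp: span_finite)
  then have "x = (\<Sum>i<r. u (e i) *\<^sub>R e i)"
    using assms(1) by (simp add: indexed_basis_def sum.reindex)
  then show ?thesis by (rule that)
qed

lemma indexed_basis_zero_coeff:
  assumes e: "indexed_basis r V e" and "(\<Sum>i<r. c i *\<^sub>R e i) = 0" "i < r"
  shows "c i = 0"
proof -
  have inj: "inj_on e {..<r}" using e by (simp add: indexed_basis_def)
  let ?u = "\<lambda>v. c (inv_into {..<r} e v)"
  have "(\<Sum>v\<in>e ` {..<r}. ?u v *\<^sub>R v) = 0"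
    using assms(2) by (simp add: sum.reindex[OF inj] inv_into_f_f[OF inj])
  then have "?u (e i) = 0"
    using independentD[of "e ` {..<r}" "e ` {..<r}" ?u "e i"] e assms(3)
    by (auto simp: indexed_basis_def)
  then show ?thesis using assms(3) by (simp add: inv_into_f_f[OF inj])
qed

lemma indexed_basis_coeff_unique:
  assumes "indexed_basis r V e" "(\<Sum>i<r. c i *\<^sub>R e i) = (\<Sum>i<r. d i *\<^sub>R e i)" "i < r"
  shows "c i = d i"
  using indexed_basis_zero_coeff[OF assms(1) _ assms(3), of "\<lambda>i. c i - d i"] assms(2)
  by (simp add: scaleR_left_diff_distrib sum_subtractf)

lemma indexed_basis_subspace: "indexed_basis r V e \<Longrightarrow> subspace V"
  unfolding indexed_basis_def by (metis subspace_span)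

lemma indexed_basis_in: "indexed_basis r V e \<Longrightarrow> i < r \<Longrightarrow> e i \<in> V"
  unfolding indexed_basis_def by (metis imageI lessThan_iff span_base)

section \<open>Global vector fields and the Lie bracket\<close>

context smooth_manifold
begin

lemma vector_fields_tangent: "X \<in> vector_fields A \<Longrightarrow> X p \<in> tangent_space A p"
  and vector_fields_smooth: "X \<in> vector_fields A \<Longrightarrow> f \<in> smooth_funs A \<Longrightarrow> (\<lambda>p. X p f) \<in> smooth_funs A"
  by (auto simp: vector_fields_def)

lemma vector_fields_add: "X \<in> vector_fields A \<Longrightarrow> Y \<in> vector_fields A \<Longrightarrow> X + Y \<in> vector_fields A"
  unfolding vector_fields_def
  by (auto intro: smooth_funs_add subspace_add[OF subspace_tangent_space])

lemma vector_fields_scale: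
  "f \<in> smooth_funs A \<Longrightarrow> X \<in> vector_fields A \<Longrightarrow> (\<lambda>p. f p *\<^sub>R X p) \<in> vector_fields A"
  unfolding vector_fields_def
  by (auto intro: smooth_funs_mult subspace_scale[OF subspace_tangent_space])

lemma vector_fields_zero: "0 \<in> vector_fields A"
  unfolding vector_fields_def
  by (auto intro: smooth_funs_const subspace_0[OF subspace_tangent_space])

lemma vector_fields_sum: "(\<And>i. i \<in> I \<Longrightarrow> X i \<in> vector_fields A) \<Longrightarrow> (\<Sum>i\<in>I. X i) \<in> vector_fields A"
  by (induction I rule: infinite_finite_induct) (auto intro: vector_fields_zero vector_fields_add)

text \<open>Freezing the coefficients of u with respect to the cut-off coordinate fields gives a
  global field. Statements about tangent vectors can thus be tested on fields.\<close>

lemma vector_field_extend: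
  assumes "u \<in> tangent_space A p"
  obtains X where "X \<in> vector_fields A" "X p = u"
proof -
  obtain N and E :: "'a \<Rightarrow> 'm \<Rightarrow> 'm tangent" and x where l: "p \<in> N"
    "\<And>i. i \<in> Basis \<Longrightarrow> E i \<in> vector_fields A"
    "\<And>q u. q \<in> N \<Longrightarrow> u \<in> tangent_space A q \<Longrightarrow> u = (\<Sum>i\<in>Basis. u (x i) *\<^sub>R E i q)"
    by (rule local_coordinates[of p]) (rule that)
  show ?thesis
  proof (rule that[of "\<Sum>i\<in>Basis. (\<lambda>q. u (x i) *\<^sub>R E i q)"])
    show "(\<Sum>i\<in>Basis. (\<lambda>q. u (x i) *\<^sub>R E i q)) \<in> vector_fields A"
      using l(2) by (intro vector_fields_sum vector_fields_scale smooth_funs_const)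
    show "(\<Sum>i\<in>Basis. (\<lambda>q. u (x i) *\<^sub>R E i q)) p = u"
      using l(3)[OF l(1) assms] by (simp add: sum_fun_apply)
  qed
qed

text \<open>Near p a field is a combination of fixed fields with smooth coefficients, and these
  vanish at p if the field does.\<close>

lemma vector_field_tensorial:
  fixes T :: "('m \<Rightarrow> 'm tangent) \<Rightarrow> 'm \<Rightarrow> 'v::real_vector"
  assumes add: "\<And>X Y. X \<in> vector_fields A \<Longrightarrow> Y \<in> vector_fields A \<Longrightarrow> T (X + Y) = T X + T Y"
    and scale: "\<And>f X. f \<in> smooth_funs A \<Longrightarrow> X \<in> vector_fields A \<Longrightarrow>
      T (\<lambda>p. f p *\<^sub>R X p) = (\<lambda>p. f p *\<^sub>R T X p)"
    and X: "X \<in> vector_fields A" and Y: "Y \<in> vector_fields A" and eq: "X p = Y p"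
  shows "T X p = T Y p"
proof -
  have T0: "T 0 = 0"
    using add[OF vector_fields_zero vector_fields_zero] by simp
  have sum: "T (\<Sum>i\<in>I. Z i) = (\<Sum>i\<in>I. T (Z i))" if "\<And>i. i \<in> I \<Longrightarrow> Z i \<in> vector_fields A"
    for I :: "'a set" and Z
    using that by (induction I rule: infinite_finite_induct) (auto simp: T0 add vector_fields_sum)
  have zero: "T Z p = 0" if Z: "Z \<in> vector_fields A" and Zp: "Z p = 0" for Z
  proof -
    obtain N and E :: "'a \<Rightarrow> 'm \<Rightarrow> 'm tangent" and x where l: "open N" "p \<in> N"
      "\<And>i. i \<in> Basis \<Longrightarrow> E i \<in> vector_fields A" "\<And>i. i \<in> Basis \<Longrightarrow> x i \<in> smooth_funs A"
      "\<And>q u. q \<in> N \<Longrightarrow> u \<in> tangent_space A q \<Longrightarrow> u = (\<Sum>i\<in>Basis. u (x i) *\<^sub>R E i q)"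
      by (rule local_coordinates[of p]) (rule that)
    obtain \<rho> M K where b: "\<rho> \<in> smooth_funs A" "p \<in> M" "K \<subseteq> N"
      "\<And>q. q \<in> M \<Longrightarrow> \<rho> q = 1" "\<And>q. q \<notin> K \<Longrightarrow> \<rho> q = 0" by (rule bump[OF l(1,2)]) (rule that)
    have cf: "(\<lambda>q. \<rho> q * Z q (x i)) \<in> smooth_funs A" if "i \<in> Basis" for i
      using that by (intro smooth_funs_mult b vector_fields_smooth[OF Z] l)
    \<comment> \<open>On \<open>N\<close> this is the coordinate expansion, and elsewhere both sides
      vanish. The coefficients are now global functions, so that \<open>T\<close> passes through
      them; at p they vanish along with Z, while \<rho> is 1.\<close>
    have "(\<lambda>q. \<rho> q *\<^sub>R Z q) = (\<Sum>i\<in>Basis. (\<lambda>q. (\<rho> q * Z q (x i)) *\<^sub>R E i q))"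
    proof
      fix q
      show "\<rho> q *\<^sub>R Z q = (\<Sum>i\<in>Basis. (\<lambda>q. (\<rho> q * Z q (x i)) *\<^sub>R E i q)) q"
      proof (cases "q \<in> N")
        case True
        show ?thesis
          by (subst l(5)[OF True vector_fields_tangent[OF Z]])
            (simp add: sum_fun_apply scaleR_sum_right del: scaleR_fun_apply)
      next
        case False
        then have "\<rho> q = 0" using b(3,5) by blast
        then show ?thesis by (simp add: sum_fun_apply)
      qed
    qed
    then have "(\<lambda>q. \<rho> q *\<^sub>R T Z q) = T (\<Sum>i\<in>Basis. (\<lambda>q. (\<rho> q * Z q (x i)) *\<^sub>R E i q))"
      using scale[OF b(1) Z] by simp
    also have "\<dots> = (\<Sum>i\<in>Basis. (\<lambda>q. (\<rho> q * Z q (x i)) *\<^sub>R T (E i) q))"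
      by (subst sum) (auto intro: vector_fields_scale[OF cf l(3)] sum.cong scale[OF cf l(3)])
    finally have "\<rho> p *\<^sub>R T Z p = (\<Sum>i\<in>Basis. (\<lambda>q. (\<rho> q * Z q (x i)) *\<^sub>R T (E i) q)) p"
      by (rule fun_cong)
    then show ?thesis using b(2,4) Zp by (simp add: sum_fun_apply)
  qed
  let ?Y = "\<lambda>q. (-1) *\<^sub>R Y q"
  have Y': "?Y \<in> vector_fields A" by (rule vector_fields_scale[OF smooth_funs_const Y])
  have "T (X + ?Y) p = 0"
    using eq by (intro zero vector_fields_add X Y') simp
  moreover have "T (X + ?Y) = T X + (\<lambda>q. (-1) *\<^sub>R T Y q)"
    by (simp only: add[OF X Y'] scale[OF smooth_funs_const Y])
  ultimately show ?thesis by simp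
qed

lemma vector_field_eqI:
  assumes "X \<in> vector_fields A" "Y \<in> vector_fields A"
    and eq: "\<And>p f. f \<in> smooth_funs A \<Longrightarrow> X p f = Y p f"
  shows "X = Y"
proof (intro ext)
  fix p f
  show "X p f = Y p f"
    using eq[of f p] assms(1,2)[THEN vector_fields_tangent, THEN tangent_nonsmooth, of f p]
    by (cases "f \<in> smooth_funs A") auto
qed

text \<open>Applied to a product fg, the composition of X and Y produces the mixed terms Xf Yg + Yf
  Xg. These are symmetric in X and Y and drop out of the commutator, which leaves the product
  rule.\<close>

lemma lie_bracket_vector_field:
  assumes X: "X \<in> vector_fields A" and Y: "Y \<in> vector_fields A"
  shows "lie_bracket X Y \<in> vector_fields A"
proof -
  note s = vector_fields_smooth[OF X] vector_fields_smooth[OF Y]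
  note t = vector_fields_tangent[OF X] vector_fields_tangent[OF Y]
  note add = t[THEN tangent_add] and cmult = t[THEN tangent_cmult] and mult = t[THEN tangent_mult]
  have "lie_bracket X Y p \<in> tangent_space A p" for p
    unfolding tangent_space_def lie_bracket_def
    by (auto simp: add cmult mult s smooth_funs_add smooth_funs_mult algebra_simps
        t[THEN tangent_nonsmooth] t[THEN tangent_const])
  then show ?thesis
    unfolding vector_fields_def using s by (auto simp: lie_bracket_def intro: smooth_funs_diff)
qed

end

section \<open>Global sections, local frames and tensoriality\<close>

locale smooth_bundle = smooth_manifold A
  for A :: "('m::t2_space, 'a::euclidean_space) atlas" +
  fixes r :: nat and E :: "'m \<Rightarrow> 'v::real_vector set" and F :: "('m, 'v) frames"
  assumes vb: "vector_bundle A r E F"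
begin

abbreviation "secs \<equiv> sections A r E F"

lemma frame_open: "(U, s) \<in> F \<Longrightarrow> open U"
  and frame_basis: "(U, s) \<in> F \<Longrightarrow> p \<in> U \<Longrightarrow> indexed_basis r (E p) (\<lambda>i. s i p)"
  using vb[unfolded vector_bundle_def, THEN conjunct2, THEN conjunct1] by auto

lemma frame_transition:
  assumes "(U, s) \<in> F" "(U', s') \<in> F" "j < r"
  shows "smooth_in_frame A r (U \<inter> U') s (s' j)"
proof -
  have "\<forall>x\<in>F. case x of (U', s') \<Rightarrow> \<forall>j<r. smooth_in_frame A r (U \<inter> U') s (s' j)"
    using vb[unfolded vector_bundle_def, THEN conjunct2, THEN conjunct2, THEN bspec, OF assms(1)] by simp
  from bspec[OF this assms(2)] show ?thesis using assms(3) by simp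
qed

lemma frame_at: obtains U s where "(U, s) \<in> F" "p \<in> U"
proof -
  have "p \<in> (\<Union>(U, s)\<in>F. U)" using vb by (simp add: vector_bundle_def)
  then show ?thesis using that by auto
qed

lemma subspace_fibre: "subspace (E p)"
  by (rule frame_at[of p]) (blast intro: indexed_basis_subspace frame_basis)

lemma section_in: "\<xi> \<in> secs \<Longrightarrow> \<xi> p \<in> E p"
  by (simp add: sections_def)

lemma section_coeffs:
  assumes "\<xi> \<in> secs" "(U, s) \<in> F"
  obtains c where "\<And>i. i < r \<Longrightarrow> smooth_fun_on A U (c i)" "\<And>q. q \<in> U \<Longrightarrow> \<xi> q = (\<Sum>i<r. c i q *\<^sub>R s i q)"
proof -
  have "smooth_in_frame A r U s \<xi>" using assms by (auto simp: sections_def)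
  then show ?thesis using that unfolding smooth_in_frame_def by metis
qed

lemma sectionsI:
  assumes "\<And>p. \<xi> p \<in> E p"
    "\<And>U s. (U, s) \<in> F \<Longrightarrow> \<exists>c. (\<forall>i<r. smooth_fun_on A U (c i)) \<and> (\<forall>q\<in>U. \<xi> q = (\<Sum>i<r. c i q *\<^sub>R s i q))"
  shows "\<xi> \<in> secs"
  using assms by (auto simp: sections_def smooth_in_frame_def)

lemma section_add:
  assumes "\<xi> \<in> secs" "\<eta> \<in> secs"
  shows "\<xi> + \<eta> \<in> secs"
proof (rule sectionsI)
  show "(\<xi> + \<eta>) p \<in> E p" for p
    using assms subspace_add[OF subspace_fibre] by (simp add: section_in)
  fix U s assume U: "(U, s) \<in> F"
  obtain c where "\<And>i. i < r \<Longrightarrow> smooth_fun_on A U (c i)" "\<And>q. q \<in> U \<Longrightarrow> \<xi> q = (\<Sum>i<r. c i q *\<^sub>R s i q)"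
    by (rule section_coeffs[OF assms(1) U]) (rule that)
  moreover obtain d where "\<And>i. i < r \<Longrightarrow> smooth_fun_on A U (d i)"
      "\<And>q. q \<in> U \<Longrightarrow> \<eta> q = (\<Sum>i<r. d i q *\<^sub>R s i q)"
    by (rule section_coeffs[OF assms(2) U]) (rule that)
  ultimately show "\<exists>c. (\<forall>i<r. smooth_fun_on A U (c i)) \<and> (\<forall>q\<in>U. (\<xi> + \<eta>) q = (\<Sum>i<r. c i q *\<^sub>R s i q))"
    by (intro exI[of _ "\<lambda>i q. c i q + d i q"])
      (auto simp: scaleR_add_left sum.distrib intro: smooth_fun_on_add frame_open[OF U])
qed

lemma section_scale:
  assumes f: "f \<in> smooth_funs A" and "\<xi> \<in> secs"
  shows "(\<lambda>p. f p *\<^sub>R \<xi> p) \<in> secs"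
proof (rule sectionsI)
  show "f p *\<^sub>R \<xi> p \<in> E p" for p
    using assms subspace_scale[OF subspace_fibre] by (simp add: section_in)
  fix U s assume U: "(U, s) \<in> F"
  obtain c where "\<And>i. i < r \<Longrightarrow> smooth_fun_on A U (c i)" "\<And>q. q \<in> U \<Longrightarrow> \<xi> q = (\<Sum>i<r. c i q *\<^sub>R s i q)"
    by (rule section_coeffs[OF assms(2) U]) (rule that)
  then show "\<exists>c. (\<forall>i<r. smooth_fun_on A U (c i)) \<and> (\<forall>q\<in>U. f q *\<^sub>R \<xi> q = (\<Sum>i<r. c i q *\<^sub>R s i q))"
    by (intro exI[of _ "\<lambda>i q. f q * c i q"])
      (auto simp: scaleR_sum_right intro: smooth_fun_on_mult frame_open[OF U] smooth_funs_on[OF f])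
qed

lemma section_zero: "0 \<in> secs"
proof (rule sectionsI)
  show "0 p \<in> E p" for p using subspace_0[OF subspace_fibre] by simp
qed (auto intro!: exI[of _ "\<lambda>i q. 0"] smooth_fun_on_const)

lemma section_sum: "(\<And>i. i \<in> I \<Longrightarrow> \<xi> i \<in> secs) \<Longrightarrow> (\<Sum>i\<in>I. \<xi> i) \<in> secs"
  by (induction I rule: infinite_finite_induct) (auto intro: section_zero section_add)

lemma section_diff:
  assumes "\<xi> \<in> secs" "\<eta> \<in> secs"
  shows "(\<lambda>p. \<xi> p - \<eta> p) \<in> secs"
  using section_add[OF assms(1) section_scale[OF smooth_funs_const[of "-1"] assms(2)]]
  by (simp add: plus_fun_def)

text \<open>Coefficients in a frame are unique, so near each point they are those of a smooth
  section; smoothness of functions is local. This serves sections that have a smooth formula only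
  near each point.\<close>

lemma section_local:
  assumes "\<And>p. \<exists>N \<eta>. open N \<and> p \<in> N \<and> \<eta> \<in> secs \<and> (\<forall>q\<in>N. \<xi> q = \<eta> q)"
  shows "\<xi> \<in> secs"
proof (rule sectionsI)
  show in_fibre: "\<xi> p \<in> E p" for p using assms[of p] section_in by metis
  fix U s assume U: "(U, s) \<in> F"
  have "\<forall>q\<in>U. \<exists>c. \<xi> q = (\<Sum>i<r. c i *\<^sub>R s i q)"
    using indexed_basis_expand[OF frame_basis[OF U] in_fibre] by metis
  then obtain c where c: "\<And>q. q \<in> U \<Longrightarrow> \<xi> q = (\<Sum>i<r. c q i *\<^sub>R s i q)"
    unfolding bchoice_iff by blast
  have "smooth_fun_on A U (\<lambda>q. c q i)" if i: "i < r" for i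
  proof (rule smooth_fun_on_local)
    fix p assume p: "p \<in> U"
    obtain N \<eta> where N: "open N" "p \<in> N" "\<eta> \<in> secs" "\<And>q. q \<in> N \<Longrightarrow> \<xi> q = \<eta> q"
      using assms[of p] by metis
    obtain d where d: "\<And>i. i < r \<Longrightarrow> smooth_fun_on A U (d i)" "\<And>q. q \<in> U \<Longrightarrow> \<eta> q = (\<Sum>i<r. d i q *\<^sub>R s i q)"
      by (rule section_coeffs[OF N(3) U]) (rule that)
    have "d i q = c q i" if "q \<in> U \<inter> N" for q
      using indexed_basis_coeff_unique[OF frame_basis[OF U] _ i, of q "\<lambda>i. d i q" "c q"]
        c[of q] d(2)[of q] N(4)[of q] that by auto
    then have "smooth_fun_on A (U \<inter> N) (\<lambda>q. c q i)"
      by (intro smooth_fun_on_cong[OF _ _ smooth_fun_on_subset[OF d(1)[OF i]]])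
        (use N(1) frame_open[OF U] in auto)
    then show "\<exists>V. open V \<and> p \<in> V \<and> smooth_fun_on A V (\<lambda>q. c q i)"
      using p N(1,2) frame_open[OF U] by (intro exI[of _ "U \<inter> N"]) auto
  qed
  then show "\<exists>c. (\<forall>i<r. smooth_fun_on A U (c i)) \<and> (\<forall>q\<in>U. \<xi> q = (\<Sum>i<r. c i q *\<^sub>R s i q))"
    using c by (intro exI[of _ "\<lambda>i q. c q i"]) auto
qed

text \<open>As with coordinates, a frame over an open set is cut off to global sections. The
  coefficients of a global section are cut off by the same function, so they too are global, at the
  price that the expansion holds on the smaller set \<open>N\<close>.\<close>

lemma local_frame:
  obtains N \<sigma> where "open N" "p \<in> N" "\<And>i. i < r \<Longrightarrow> \<sigma> i \<in> secs"
    "\<And>q. q \<in> N \<Longrightarrow> indexed_basis r (E q) (\<lambda>i. \<sigma> i q)"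
    "\<And>\<xi>. \<xi> \<in> secs \<Longrightarrow> \<exists>c. (\<forall>i<r. c i \<in> smooth_funs A) \<and>
      (\<forall>q\<in>N. \<xi> q = (\<Sum>i<r. c i q *\<^sub>R \<sigma> i q))"
proof -
  obtain U s where U: "(U, s) \<in> F" "p \<in> U" by (rule frame_at)
  note oU = frame_open[OF U(1)]
  obtain \<rho> N K where b: "\<rho> \<in> smooth_funs A" "open N" "p \<in> N" "N \<subseteq> U" "closed K" "K \<subseteq> U"
    "\<And>q. q \<in> N \<Longrightarrow> \<rho> q = 1" "\<And>q. q \<notin> K \<Longrightarrow> \<rho> q = 0" by (rule bump[OF oU U(2)]) (rule that)
  define \<sigma> where "\<sigma> i q = (if q \<in> U then \<rho> q *\<^sub>R s i q else 0)" for i q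
  have \<sigma>N: "\<sigma> i q = s i q" if "q \<in> N" for i q using that b(4,7) by (auto simp: \<sigma>_def)
  show ?thesis
  proof (rule that[of N \<sigma>])
    fix i assume i: "i < r"
    show "\<sigma> i \<in> secs"
    proof (rule sectionsI)
      show "\<sigma> i q \<in> E q" for q
        using subspace_scale[OF subspace_fibre indexed_basis_in[OF frame_basis[OF U(1)] i]]
          subspace_0[OF subspace_fibre] by (auto simp: \<sigma>_def)
      fix U' s' assume U': "(U', s') \<in> F"
      \<comment> \<open>Smoothness of a section is demanded in every frame of \<open>F\<close>. The
        transition coefficients give it on the overlap, and \<rho> extends them by zero over
        U'.\<close>
      obtain a where a: "\<And>j. j < r \<Longrightarrow> smooth_fun_on A (U' \<inter> U) (a j)"
        "\<And>q. q \<in> U' \<inter> U \<Longrightarrow> s i q = (\<Sum>j<r. a j q *\<^sub>R s' j q)"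
        using frame_transition[OF U' U(1) i] unfolding smooth_in_frame_def by blast
      let ?c = "\<lambda>j q. if q \<in> U then \<rho> q * a j q else 0"
      have "smooth_fun_on A U' (?c j)" if "j < r" for j
        using smooth_fun_on_extend_zero[OF oU frame_open[OF U'] smooth_funs_on[OF b(1)] b(5) _ b(8) a(1)[OF that]]
          b(6) by blast
      moreover have "\<sigma> i q = (\<Sum>j<r. ?c j q *\<^sub>R s' j q)" if "q \<in> U'" for q
        using a(2)[of q] that by (simp add: \<sigma>_def scaleR_sum_right)
      ultimately show "\<exists>c. (\<forall>i<r. smooth_fun_on A U' (c i)) \<and> (\<forall>q\<in>U'. \<sigma> i q = (\<Sum>i<r. c i q *\<^sub>R s' i q))"
        by (intro exI[of _ ?c]) blast
    qed
  next
    show "indexed_basis r (E q) (\<lambda>i. \<sigma> i q)" if "q \<in> N" for q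
      using frame_basis[OF U(1)] that b(4) by (auto simp: \<sigma>N)
  next
    fix \<xi> assume \<xi>: "\<xi> \<in> secs"
    obtain c where c: "\<And>i. i < r \<Longrightarrow> smooth_fun_on A U (c i)"
      "\<And>q. q \<in> U \<Longrightarrow> \<xi> q = (\<Sum>i<r. c i q *\<^sub>R s i q)"
      by (rule section_coeffs[OF \<xi> U(1)]) (rule that)
    let ?c = "\<lambda>i q. if q \<in> U then \<rho> q * c i q else 0"
    have "?c i \<in> smooth_funs A" if "i < r" for i
      by (rule smooth_funs_extend_zero[OF oU b(1,5,6,8) c(1)[OF that]])
    moreover have "\<xi> q = (\<Sum>i<r. ?c i q *\<^sub>R \<sigma> i q)" if "q \<in> N" for q
      using c(2)[of q] that b(4,7) by (auto simp: \<sigma>N)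
    ultimately show "\<exists>c. (\<forall>i<r. c i \<in> smooth_funs A) \<and> (\<forall>q\<in>N. \<xi> q = (\<Sum>i<r. c i q *\<^sub>R \<sigma> i q))"
      by (intro exI[of _ ?c]) blast
  qed (use b in auto)
qed

lemma section_extend:
  assumes "x \<in> E p"
  obtains \<xi> where "\<xi> \<in> secs" "\<xi> p = x"
proof -
  obtain N \<sigma> where l: "p \<in> N" "\<And>i. i < r \<Longrightarrow> \<sigma> i \<in> secs"
    "\<And>q. q \<in> N \<Longrightarrow> indexed_basis r (E q) (\<lambda>i. \<sigma> i q)"
    by (rule local_frame[of p]) (rule that)
  obtain c where c: "x = (\<Sum>i<r. c i *\<^sub>R \<sigma> i p)"
    by (rule indexed_basis_expand[OF l(3)[OF l(1)] assms])
  show ?thesis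
  proof (rule that[of "\<Sum>i<r. (\<lambda>q. c i *\<^sub>R \<sigma> i q)"])
    show "(\<Sum>i<r. (\<lambda>q. c i *\<^sub>R \<sigma> i q)) \<in> secs"
      using l(2) by (intro section_sum section_scale smooth_funs_const) auto
  qed (simp add: c sum_fun_apply)
qed

text \<open>The argument for fields carries over with a local frame in place of the coordinate
  fields: a section that vanishes at p has coefficients vanishing at p, by independence of the
  frame, and \<open>T\<close> moves past the cut-off coefficients.\<close>

lemma section_tensorial:
  fixes T :: "('m \<Rightarrow> 'v) \<Rightarrow> 'm \<Rightarrow> 'w::real_vector"
  assumes add: "\<And>\<xi> \<eta>. \<xi> \<in> secs \<Longrightarrow> \<eta> \<in> secs \<Longrightarrow> T (\<xi> + \<eta>) = T \<xi> + T \<eta>"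
    and scale: "\<And>f \<xi>. f \<in> smooth_funs A \<Longrightarrow> \<xi> \<in> secs \<Longrightarrow>
      T (\<lambda>p. f p *\<^sub>R \<xi> p) = (\<lambda>p. f p *\<^sub>R T \<xi> p)"
    and X: "\<xi> \<in> secs" and Y: "\<eta> \<in> secs" and eq: "\<xi> p = \<eta> p"
  shows "T \<xi> p = T \<eta> p"
proof -
  have T0: "T 0 = 0"
    using add[OF section_zero section_zero] by simp
  have sum: "T (\<Sum>i\<in>I. Z i) = (\<Sum>i\<in>I. T (Z i))" if "\<And>i. i \<in> I \<Longrightarrow> Z i \<in> secs"
    for I :: "nat set" and Z
    using that by (induction I rule: infinite_finite_induct) (auto simp: T0 add section_sum)
  have zero: "T Z p = 0" if Z: "Z \<in> secs" and Zp: "Z p = 0" for Z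
  proof -
    obtain N \<sigma> where l: "open N" "p \<in> N" "\<And>i. i < r \<Longrightarrow> \<sigma> i \<in> secs"
      "\<And>q. q \<in> N \<Longrightarrow> indexed_basis r (E q) (\<lambda>i. \<sigma> i q)"
      "\<And>\<xi>. \<xi> \<in> secs \<Longrightarrow> \<exists>c. (\<forall>i<r. c i \<in> smooth_funs A) \<and>
        (\<forall>q\<in>N. \<xi> q = (\<Sum>i<r. c i q *\<^sub>R \<sigma> i q))"
      by (rule local_frame[of p]) (rule that)
    from l(5)[OF Z] obtain c where c: "\<And>i. i < r \<Longrightarrow> c i \<in> smooth_funs A"
      "\<And>q. q \<in> N \<Longrightarrow> Z q = (\<Sum>i<r. c i q *\<^sub>R \<sigma> i q)" by blast
    have c0: "c i p = 0" if "i < r" for i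
      using indexed_basis_zero_coeff[OF l(4)[OF l(2)] _ that, of "\<lambda>i. c i p"] c(2)[OF l(2)] Zp by simp
    obtain \<rho> M K where b: "\<rho> \<in> smooth_funs A" "p \<in> M" "K \<subseteq> N"
      "\<And>q. q \<in> M \<Longrightarrow> \<rho> q = 1" "\<And>q. q \<notin> K \<Longrightarrow> \<rho> q = 0" by (rule bump[OF l(1,2)]) (rule that)
    have cf: "(\<lambda>q. \<rho> q * c i q) \<in> smooth_funs A" if "i < r" for i
      using that by (intro smooth_funs_mult b c)
    have "(\<lambda>q. \<rho> q *\<^sub>R Z q) = (\<Sum>i<r. (\<lambda>q. (\<rho> q * c i q) *\<^sub>R \<sigma> i q))"
    proof
      fix q
      show "\<rho> q *\<^sub>R Z q = (\<Sum>i<r. (\<lambda>q. (\<rho> q * c i q) *\<^sub>R \<sigma> i q)) q"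
        using c(2)[of q] b(3,5) subsetD[OF b(3), of q]
        by (cases "q \<in> N"; cases "q \<in> K") (auto simp: sum_fun_apply scaleR_sum_right)
    qed
    then have "(\<lambda>q. \<rho> q *\<^sub>R T Z q) = T (\<Sum>i<r. (\<lambda>q. (\<rho> q * c i q) *\<^sub>R \<sigma> i q))"
      using scale[OF b(1) Z] by simp
    also have "\<dots> = (\<Sum>i<r. (\<lambda>q. (\<rho> q * c i q) *\<^sub>R T (\<sigma> i) q))"
      by (subst sum) (auto intro: section_scale[OF cf l(3)] sum.cong scale[OF cf l(3)])
    finally have "\<rho> p *\<^sub>R T Z p = (\<Sum>i<r. (\<lambda>q. (\<rho> q * c i q) *\<^sub>R T (\<sigma> i) q)) p"
      by (rule fun_cong)
    then show ?thesis using b(2,4) c0 by (simp add: sum_fun_apply)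
  qed
  let ?Y = "\<lambda>q. (-1) *\<^sub>R \<eta> q"
  have Y': "?Y \<in> secs" by (rule section_scale[OF smooth_funs_const Y])
  have "T (\<xi> + ?Y) p = 0"
    using eq by (intro zero section_add X Y') simp
  moreover have "T (\<xi> + ?Y) = T \<xi> + (\<lambda>q. (-1) *\<^sub>R T \<eta> q)"
    by (simp only: add[OF X Y'] scale[OF smooth_funs_const Y])
  ultimately show ?thesis by simp
qed

end

section \<open>Curvature\<close>

locale bundle_connection = smooth_bundle A r E F
  for A :: "('m::t2_space, 'a::euclidean_space) atlas" and r
    and E :: "'m \<Rightarrow> 'v::real_vector set" and F :: "('m, 'v) frames" +
  fixes D :: "('m \<Rightarrow> 'm tangent) \<Rightarrow> ('m \<Rightarrow> 'v) \<Rightarrow> 'm \<Rightarrow> 'v"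
  assumes conn: "connection A r E F D"
begin

abbreviation "vfs \<equiv> vector_fields A"

lemma D_section: "X \<in> vfs \<Longrightarrow> \<xi> \<in> secs \<Longrightarrow> D X \<xi> \<in> secs"
  and D_add_left: "X \<in> vfs \<Longrightarrow> Y \<in> vfs \<Longrightarrow> \<xi> \<in> secs \<Longrightarrow> D (X + Y) \<xi> = D X \<xi> + D Y \<xi>"
  and D_scale_left: "f \<in> smooth_funs A \<Longrightarrow> X \<in> vfs \<Longrightarrow> \<xi> \<in> secs \<Longrightarrow>
    D (\<lambda>p. f p *\<^sub>R X p) \<xi> = (\<lambda>p. f p *\<^sub>R D X \<xi> p)"
  and D_add_right: "X \<in> vfs \<Longrightarrow> \<xi> \<in> secs \<Longrightarrow> \<eta> \<in> secs \<Longrightarrow> D X (\<xi> + \<eta>) = D X \<xi> + D X \<eta>"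
  and D_Leibniz: "f \<in> smooth_funs A \<Longrightarrow> X \<in> vfs \<Longrightarrow> \<xi> \<in> secs \<Longrightarrow>
    D X (\<lambda>p. f p *\<^sub>R \<xi> p) = (\<lambda>p. X p f *\<^sub>R \<xi> p) + (\<lambda>p. f p *\<^sub>R D X \<xi> p)"
  using conn unfolding connection_def plus_fun_def by blast+

definition curv :: "('m \<Rightarrow> 'm tangent) \<Rightarrow> ('m \<Rightarrow> 'm tangent) \<Rightarrow> ('m \<Rightarrow> 'v) \<Rightarrow> 'm \<Rightarrow> 'v" where
  "curv X Y \<xi> = (\<lambda>p. D X (D Y \<xi>) p - D Y (D X \<xi>) p - D (lie_bracket X Y) \<xi> p)"

lemma curv_section: "X \<in> vfs \<Longrightarrow> Y \<in> vfs \<Longrightarrow> \<xi> \<in> secs \<Longrightarrow> curv X Y \<xi> \<in> secs"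
  unfolding curv_def by (intro section_diff D_section lie_bracket_vector_field)

lemma curv_add_section:
  "X \<in> vfs \<Longrightarrow> Y \<in> vfs \<Longrightarrow> \<xi> \<in> secs \<Longrightarrow> \<eta> \<in> secs \<Longrightarrow> curv X Y (\<xi> + \<eta>) = curv X Y \<xi> + curv X Y \<eta>"
  unfolding curv_def by (simp add: fun_eq_iff D_add_right D_section lie_bracket_vector_field)

text \<open>The second-order terms XYf - YXf cancel against [X, Y]f from the bracket, and the mixed
  terms with one derivative on f and one on \<xi> are symmetric in X and Y.\<close>

lemma curv_scale_section:
  assumes X: "X \<in> vfs" and Y: "Y \<in> vfs" and \<xi>: "\<xi> \<in> secs" and f: "f \<in> smooth_funs A"
  shows "curv X Y (\<lambda>p. f p *\<^sub>R \<xi> p) = (\<lambda>p. f p *\<^sub>R curv X Y \<xi> p)"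
proof -
  have 2: "D X (D Y (\<lambda>p. f p *\<^sub>R \<xi> p)) = (\<lambda>p. X p (\<lambda>q. Y q f) *\<^sub>R \<xi> p) + (\<lambda>p. Y p f *\<^sub>R D X \<xi> p)
      + ((\<lambda>p. X p f *\<^sub>R D Y \<xi> p) + (\<lambda>p. f p *\<^sub>R D X (D Y \<xi>) p))"
    if "X \<in> vfs" "Y \<in> vfs" for X Y
    using that \<xi> f
    by (simp only: D_Leibniz D_add_right section_scale vector_fields_smooth D_section)
  show ?thesis
    unfolding curv_def 2[OF X Y] 2[OF Y X]
      D_Leibniz[OF f lie_bracket_vector_field[OF X Y] \<xi>]
    by (rule ext) (simp add: lie_bracket_def algebra_simps)
qed

lemma lie_bracket_add:
  assumes "X \<in> vfs" "X' \<in> vfs" "Y \<in> vfs"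
  shows "lie_bracket (X + X') Y = lie_bracket X Y + lie_bracket X' Y"
proof (rule vector_field_eqI)
  show "lie_bracket (X + X') Y p f = (lie_bracket X Y + lie_bracket X' Y) p f"
    if f: "f \<in> smooth_funs A" for p f
    using tangent_add[OF vector_fields_tangent[OF assms(3)] vector_fields_smooth[OF assms(1) f]
        vector_fields_smooth[OF assms(2) f]]
    by (simp add: lie_bracket_def)
qed (intro lie_bracket_vector_field vector_fields_add assms)+

lemma lie_bracket_scale:
  assumes "X \<in> vfs" "Y \<in> vfs" "g \<in> smooth_funs A"
  shows "lie_bracket (\<lambda>p. g p *\<^sub>R X p) Y =
    (\<lambda>p. g p *\<^sub>R lie_bracket X Y p) + (\<lambda>p. (- 1 * Y p g) *\<^sub>R X p)"
proof (rule vector_field_eqI)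
  show "lie_bracket (\<lambda>p. g p *\<^sub>R X p) Y p f =
      ((\<lambda>p. g p *\<^sub>R lie_bracket X Y p) + (\<lambda>p. (- 1 * Y p g) *\<^sub>R X p)) p f"
    if f: "f \<in> smooth_funs A" for p f
    using tangent_mult[OF vector_fields_tangent[OF assms(2)] assms(3) vector_fields_smooth[OF assms(1) f]]
    by (simp add: lie_bracket_def algebra_simps)
qed (intro lie_bracket_vector_field vector_fields_add vector_fields_scale assms
    smooth_funs_mult[OF smooth_funs_const vector_fields_smooth])+

lemma lie_bracket_swap: "lie_bracket Y X = (\<lambda>p. (- 1) *\<^sub>R lie_bracket X Y p)"
  by (simp add: lie_bracket_def fun_eq_iff)

lemma curv_swap:
  assumes "X \<in> vfs" "Y \<in> vfs" "\<xi> \<in> secs"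
  shows "curv Y X \<xi> = (\<lambda>p. (- 1) *\<^sub>R curv X Y \<xi> p)"
  using D_scale_left[OF smooth_funs_const lie_bracket_vector_field[OF assms(1,2)] assms(3), of "- 1"]
  unfolding curv_def lie_bracket_swap[of Y X] by (simp add: fun_eq_iff)

lemma curv_add_left:
  assumes "X \<in> vfs" "X' \<in> vfs" "Y \<in> vfs" "\<xi> \<in> secs"
  shows "curv (X + X') Y \<xi> = curv X Y \<xi> + curv X' Y \<xi>"
  unfolding curv_def lie_bracket_add[OF assms(1-3)] using assms
  by (simp add: fun_eq_iff D_add_left D_add_right D_section lie_bracket_vector_field)

text \<open>Differentiating g along Y produces (Yg) times the derivative of \<xi> along X, and the
  bracket [gX, Y] = g[X, Y] - (Yg)X produces the same term with the opposite effect.\<close>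

lemma curv_scale_left:
  assumes X: "X \<in> vfs" and Y: "Y \<in> vfs" and \<xi>: "\<xi> \<in> secs" and g: "g \<in> smooth_funs A"
  shows "curv (\<lambda>p. g p *\<^sub>R X p) Y \<xi> = (\<lambda>p. g p *\<^sub>R curv X Y \<xi> p)"
proof -
  have Yg: "(\<lambda>p. - 1 * Y p g) \<in> smooth_funs A"
    by (intro smooth_funs_mult smooth_funs_const vector_fields_smooth[OF Y g])
  have "D (lie_bracket (\<lambda>p. g p *\<^sub>R X p) Y) \<xi> =
      (\<lambda>p. g p *\<^sub>R D (lie_bracket X Y) \<xi> p) + (\<lambda>p. (- 1 * Y p g) *\<^sub>R D X \<xi> p)"
    unfolding lie_bracket_scale[OF X Y g]
    by (simp only: D_add_left D_scale_left vector_fields_scale lie_bracket_vector_field X Y \<xi> g Yg)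
  moreover have "D Y (D (\<lambda>p. g p *\<^sub>R X p) \<xi>) =
      (\<lambda>p. Y p g *\<^sub>R D X \<xi> p) + (\<lambda>p. g p *\<^sub>R D Y (D X \<xi>) p)"
    by (simp only: D_scale_left D_Leibniz D_section X Y \<xi> g)
  moreover have "D (\<lambda>p. g p *\<^sub>R X p) (D Y \<xi>) = (\<lambda>p. g p *\<^sub>R D X (D Y \<xi>) p)"
    by (simp only: D_scale_left D_section X Y \<xi> g)
  ultimately show ?thesis
    unfolding curv_def by (simp add: fun_eq_iff algebra_simps)
qed

lemma curv_add_right:
  assumes "X \<in> vfs" "Y \<in> vfs" "Y' \<in> vfs" "\<xi> \<in> secs"
  shows "curv X (Y + Y') \<xi> = curv X Y \<xi> + curv X Y' \<xi>"
  using curv_add_left[OF assms(2,3,1,4)] assms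
  by (simp add: curv_swap[of _ X] vector_fields_add fun_eq_iff)

lemma curv_scale_right:
  assumes "X \<in> vfs" "Y \<in> vfs" "\<xi> \<in> secs" "g \<in> smooth_funs A"
  shows "curv X (\<lambda>p. g p *\<^sub>R Y p) \<xi> = (\<lambda>p. g p *\<^sub>R curv X Y \<xi> p)"
  using curv_scale_left[OF assms(2,1,3,4)] assms
  by (simp add: curv_swap[of _ X] vector_fields_scale fun_eq_iff)

text \<open>The three arguments are exchanged one after the other, each by tensoriality in its own
  slot.\<close>

lemma curv_pointwise:
  assumes "X \<in> vfs" "X' \<in> vfs" "Y \<in> vfs" "Y' \<in> vfs" "\<xi> \<in> secs" "\<xi>' \<in> secs"
    and "X p = X' p" "Y p = Y' p" "\<xi> p = \<xi>' p"
  shows "curv X Y \<xi> p = curv X' Y' \<xi>' p"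
proof -
  have "curv X Y \<xi> p = curv X' Y \<xi> p"
    by (rule vector_field_tensorial[of "\<lambda>X. curv X Y \<xi>"])
      (use assms in \<open>simp_all add: curv_add_left curv_scale_left\<close>)
  also have "\<dots> = curv X' Y' \<xi> p"
    by (rule vector_field_tensorial[of "\<lambda>Y. curv X' Y \<xi>"])
      (use assms in \<open>simp_all add: curv_add_right curv_scale_right\<close>)
  also have "\<dots> = curv X' Y' \<xi>' p"
    by (rule section_tensorial[of "curv X' Y'"])
      (use assms in \<open>simp_all add: curv_add_section curv_scale_section\<close>)
  finally show ?thesis .
qed

text \<open>The vectors are extended to fields and a section in an arbitrary way; by
  \<open>curv_pointwise\<close> the result does not depend on the extensions, so the choice is
  harmless. The value 0 elsewhere follows the conventions for forms and endomorphisms.\<close>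

definition curv_form :: "('m, 'v \<Rightarrow> 'v) form" where
  "curv_form p vs x = (if length vs = 2 \<and> set vs \<subseteq> tangent_space A p \<and> x \<in> E p
     then (SOME y. \<exists>X\<in>vfs. \<exists>Y\<in>vfs. \<exists>\<xi>\<in>secs. X p = vs ! 0 \<and> Y p = vs ! 1 \<and> \<xi> p = x \<and> y = curv X Y \<xi> p)
     else 0)"

lemma curv_form_eq:
  assumes "X \<in> vfs" "Y \<in> vfs" "\<xi> \<in> secs"
  shows "curv_form p [X p, Y p] (\<xi> p) = curv X Y \<xi> p"
proof -
  let ?P = "\<lambda>y. \<exists>X'\<in>vfs. \<exists>Y'\<in>vfs. \<exists>\<xi>'\<in>secs.
    X' p = X p \<and> Y' p = Y p \<and> \<xi>' p = \<xi> p \<and> y = curv X' Y' \<xi>' p"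
  have "(SOME y. ?P y) = curv X Y \<xi> p"
  proof (rule some_equality)
    show "?P (curv X Y \<xi> p)" using assms by blast
    show "y = curv X Y \<xi> p" if "?P y" for y
      using that curv_pointwise[OF _ assms(1) _ assms(2) _ assms(3)] by blast
  qed
  then show ?thesis
    using assms by (simp add: curv_form_def vector_fields_tangent section_in)
qed

lemma tangent_pair_cases:
  assumes "length vs = 2" "set vs \<subseteq> tangent_space A p"
  obtains X Y where "X \<in> vfs" "Y \<in> vfs" "vs = [X p, Y p]"
proof -
  obtain u v where vs: "vs = [u, v]" using assms(1) by (auto simp: length_Suc_conv numeral_2_eq_2)
  then have uv: "u \<in> tangent_space A p" "v \<in> tangent_space A p" using assms(2) by auto
  obtain X where "X \<in> vfs" "X p = u" by (rule vector_field_extend[OF uv(1)])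
  moreover obtain Y where "Y \<in> vfs" "Y p = v" by (rule vector_field_extend[OF uv(2)])
  ultimately show ?thesis using that vs by blast
qed

lemma curv_form_endo: "curv_form p vs \<in> endos (E p)"
proof (cases "length vs = 2 \<and> set vs \<subseteq> tangent_space A p")
  case True
  then obtain X Y where X: "X \<in> vfs" and Y: "Y \<in> vfs" and vs: "vs = [X p, Y p]"
    by (auto elim: tangent_pair_cases)
  note eq = curv_form_eq[OF X Y, of _ p]
  have ext: "\<exists>\<xi>\<in>secs. x = \<xi> p" if "x \<in> E p" for x
    using section_extend[OF that] by metis
  show ?thesis
    unfolding endos_def vs
  proof (intro CollectI conjI ballI allI impI)
    fix x assume "x \<in> E p"
    then obtain \<xi> where \<xi>: "\<xi> \<in> secs" "x = \<xi> p" using ext by blast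
    show "curv_form p [X p, Y p] x \<in> E p"
      using section_in[OF curv_section[OF X Y \<xi>(1)]] by (simp add: \<xi>(2) eq[OF \<xi>(1)])
    show "curv_form p [X p, Y p] (c *\<^sub>R x) = c *\<^sub>R curv_form p [X p, Y p] x" for c
      using eq[OF section_scale[OF smooth_funs_const \<xi>(1)], of c]
        curv_scale_section[OF X Y \<xi>(1) smooth_funs_const, of c] by (simp add: \<xi>(2) eq[OF \<xi>(1)])
    fix y assume "y \<in> E p"
    then obtain \<eta> where \<eta>: "\<eta> \<in> secs" "y = \<eta> p" using ext by blast
    show "curv_form p [X p, Y p] (x + y) = curv_form p [X p, Y p] x + curv_form p [X p, Y p] y"
      using eq[OF section_add[OF \<xi>(1) \<eta>(1)]] curv_add_section[OF X Y \<xi>(1) \<eta>(1)]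
      by (simp add: \<xi>(2) \<eta>(2) eq[OF \<xi>(1)] eq[OF \<eta>(1)])
  qed (simp add: curv_form_def)
next
  case False
  then have "curv_form p vs = 0" by (auto simp: curv_form_def fun_eq_iff)
  then show ?thesis using subspace_0[OF subspace_fibre] by (simp add: endos_def)
qed

lemma curv_form_eqI:
  assumes "\<And>\<xi>. \<xi> \<in> secs \<Longrightarrow> f (\<xi> p) = g (\<xi> p)" "\<And>x. x \<notin> E p \<Longrightarrow> f x = g x"
  shows "f = g"
proof
  fix x show "f x = g x"
    using assms section_extend[of x p] by (cases "x \<in> E p") metis+
qed

lemma curv_form_alternating: "alternating_on 2 (tangent_space A p) (endos (E p)) (curv_form p)"
  unfolding alternating_on_def
proof (intro conjI allI impI)
  fix vs assume "\<not> (length vs = 2 \<and> set vs \<subseteq> tangent_space A p)"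
  then show "curv_form p vs = 0" by (auto simp: curv_form_def fun_eq_iff)
next
  fix vs u v and i :: nat and c :: real
  assume *: "length vs = 2 \<and> set vs \<subseteq> tangent_space A p \<and> i < 2 \<and>
    u \<in> tangent_space A p \<and> v \<in> tangent_space A p"
  then obtain X Y where X: "X \<in> vfs" and Y: "Y \<in> vfs" and vs: "vs = [X p, Y p]"
    by (auto elim: tangent_pair_cases)
  obtain Z where Z: "Z \<in> vfs" "Z p = u" using * by (auto elim: vector_field_extend)
  obtain W where W: "W \<in> vfs" "W p = v" using * by (auto elim: vector_field_extend)
  let ?S = "(\<lambda>p. c *\<^sub>R Z p) + W"
  have cZ: "(\<lambda>p. c *\<^sub>R Z p) \<in> vfs" by (rule vector_fields_scale[OF smooth_funs_const Z(1)])
  have S: "?S \<in> vfs" by (rule vector_fields_add[OF cZ W(1)])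
  have Sp: "?S p = c *\<^sub>R u + v" by (simp add: Z(2) W(2))
  have "i = 0 \<or> i = 1" using * by auto
  then show "curv_form p (vs[i := c *\<^sub>R u + v]) = c *\<^sub>R curv_form p (vs[i := u]) + curv_form p (vs[i := v])"
  proof
    assume i: "i = 0"
    show ?thesis
    proof (rule curv_form_eqI[of _ p])
      fix \<xi> assume \<xi>: "\<xi> \<in> secs"
      show "curv_form p (vs[i := c *\<^sub>R u + v]) (\<xi> p) =
          (c *\<^sub>R curv_form p (vs[i := u]) + curv_form p (vs[i := v])) (\<xi> p)"
        using curv_form_eq[OF S Y \<xi>, of p] curv_form_eq[OF Z(1) Y \<xi>, of p] curv_form_eq[OF W(1) Y \<xi>, of p]
          curv_add_left[OF cZ W(1) Y \<xi>] curv_scale_left[OF Z(1) Y \<xi> smooth_funs_const, of c]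
        unfolding Sp Z(2) W(2) by (simp add: vs i)
    qed (auto simp: curv_form_def)
  next
    assume i: "i = 1"
    show ?thesis
    proof (rule curv_form_eqI[of _ p])
      fix \<xi> assume \<xi>: "\<xi> \<in> secs"
      show "curv_form p (vs[i := c *\<^sub>R u + v]) (\<xi> p) =
          (c *\<^sub>R curv_form p (vs[i := u]) + curv_form p (vs[i := v])) (\<xi> p)"
        using curv_form_eq[OF X S \<xi>, of p] curv_form_eq[OF X Z(1) \<xi>, of p] curv_form_eq[OF X W(1) \<xi>, of p]
          curv_add_right[OF X cZ W(1) \<xi>] curv_scale_right[OF X Z(1) \<xi> smooth_funs_const, of c]
        unfolding Sp Z(2) W(2) by (simp add: vs i)
    qed (auto simp: curv_form_def)
  qed
next
  fix vs and i j :: nat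
  assume *: "length vs = 2 \<and> set vs \<subseteq> tangent_space A p \<and> i < j \<and> j < 2 \<and> vs ! i = vs ! j"
  then obtain X Y where X: "X \<in> vfs" and Y: "Y \<in> vfs" and vs: "vs = [X p, Y p]"
    by (auto elim: tangent_pair_cases)
  have ij: "i = 0" "j = 1" using * by auto
  have XY: "X p = Y p" using * by (simp add: vs ij)
  show "curv_form p vs = 0"
  proof (rule curv_form_eqI[of _ p])
    fix \<xi> assume \<xi>: "\<xi> \<in> secs"
    have "curv X X \<xi> p = - curv X X \<xi> p"
      using fun_cong[OF curv_swap[OF X X \<xi>], of p] by simp
    then have "2 *\<^sub>R curv X X \<xi> p = 0" unfolding scaleR_2 by (metis add.right_inverse)
    then show "curv_form p vs (\<xi> p) = 0 (\<xi> p)"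
      using curv_form_eq[OF X X \<xi>, of p] by (simp add: vs XY)
  qed (auto simp: curv_form_def)
qed (rule curv_form_endo)

lemma curv_form_in: "curv_form \<in> endo_forms A r E F 2"
  unfolding endo_forms_def
proof (intro CollectI conjI allI impI ballI)
  fix Xs \<xi> assume Xs: "length Xs = 2 \<and> set Xs \<subseteq> vfs" and \<xi>: "\<xi> \<in> secs"
  then obtain X Y where X: "Xs = [X, Y]" "X \<in> vfs" "Y \<in> vfs"
    by (auto simp: length_Suc_conv numeral_2_eq_2)
  show "(\<lambda>p. curv_form p (map (\<lambda>X. X p) Xs) (\<xi> p)) \<in> secs"
    using curv_section[OF X(2,3) \<xi>] by (simp add: X curv_form_eq[OF X(2,3) \<xi>])
qed (rule curv_form_alternating)

text \<open>\<open>curvature\<close> is a definite description. \<open>curv_form\<close> satisfies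
  it; any other solution agrees with \<open>curv_form\<close> on vectors because these extend to
  fields and sections, and off the domain because both are zero there by convention.\<close>

lemma curvature_in: "curvature A r E F D \<in> endo_forms A r E F 2"
proof -
  let ?P = "\<lambda>R. R \<in> endo_forms A r E F 2 \<and> (\<forall>X\<in>vfs. \<forall>Y\<in>vfs. \<forall>\<xi>\<in>secs. \<forall>p.
    R p [X p, Y p] (\<xi> p) = D X (D Y \<xi>) p - D Y (D X \<xi>) p - D (lie_bracket X Y) \<xi> p)"
  have "curvature A r E F D = curv_form"
    unfolding curvature_def
  proof (rule the_equality)
    show "?P curv_form" using curv_form_in curv_form_eq by (simp add: curv_def)
    fix R assume R: "?P R"
    then have alt: "alternating_on 2 (tangent_space A p) (endos (E p)) (R p)" for p
      by (simp add: endo_forms_def)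
    show "R = curv_form"
    proof (intro ext)
      fix p vs x
      show "R p vs x = curv_form p vs x"
      proof (cases "length vs = 2 \<and> set vs \<subseteq> tangent_space A p")
        case False
        then have "R p vs = 0" using alt[of p] unfolding alternating_on_def by metis
        with False show ?thesis by (auto simp: curv_form_def)
      next
        case True
        then obtain X Y where X: "X \<in> vfs" and Y: "Y \<in> vfs" and vs: "vs = [X p, Y p]"
          by (auto elim: tangent_pair_cases)
        show ?thesis
        proof (cases "x \<in> E p")
          case True
          then obtain \<xi> where "\<xi> \<in> secs" "\<xi> p = x" by (rule section_extend)
          then show ?thesis using R X Y curv_form_eq[OF X Y, of \<xi> p] by (auto simp: vs curv_def)
        next
          case False
          have "R p vs \<in> endos (E p)" using alt[of p] True unfolding alternating_on_def by metis
          with False show ?thesis by (simp add: curv_form_def endos_def)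
        qed
      qed
    qed
  qed
  then show ?thesis using curv_form_in by simp
qed

end

section \<open>Symplectic bases\<close>

lemma indexed_basis_unique_length:
  assumes "indexed_basis r V e" "indexed_basis r' V e'"
  shows "r = r'"
proof -
  have "card (e ` {..<r}) = r" "card (e' ` {..<r'}) = r'"
    using assms by (auto simp: indexed_basis_def card_image)
  moreover have "card (e ` {..<r}) \<le> card (e' ` {..<r'})" "card (e' ` {..<r'}) \<le> card (e ` {..<r})"
    using independent_span_bound[of "e' ` {..<r'}" "e ` {..<r}"]
      independent_span_bound[of "e ` {..<r}" "e' ` {..<r'}"] assms
    by (auto simp: indexed_basis_def intro: span_base)
  ultimately show ?thesis by simp
qed

lemma indexed_basisI:
  assumes "\<And>c i. (\<Sum>i<r. c i *\<^sub>R e i) = 0 \<Longrightarrow> i < r \<Longrightarrow> c i = (0::real)"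
    and sp: "span (e ` {..<r}) = V"
  shows "indexed_basis r V e"
proof -
  have inj: "inj_on e {..<r}"
  proof
    fix i j assume ij: "i \<in> {..<r}" "j \<in> {..<r}" and eq: "e i = e j"
    show "i = j"
    proof (rule ccontr)
      assume "i \<noteq> j"
      \<comment> \<open>A repetition in the family would give a relation with coefficients 1 at i
        and -1 at j.\<close>
      have "(\<Sum>k<r. (of_bool (k = i) - of_bool (k = j)) *\<^sub>R e k) = 0"
        using ij eq by (simp add: scaleR_left_diff_distrib sum_subtractf of_bool_def if_distrib[of "\<lambda>c. c *\<^sub>R _"]
            cong: if_cong)
      from assms(1)[OF this, of i] show False using ij \<open>i \<noteq> j\<close> by simp
    qed
  qed
  moreover have "independent (e ` {..<r})"
  proof
    assume "dependent (e ` {..<r})"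
    then obtain u v where u: "v \<in> e ` {..<r}" "u v \<noteq> 0" "(\<Sum>v\<in>e ` {..<r}. u v *\<^sub>R v) = 0"
      by (subst (asm) dependent_finite) auto
    then have "(\<Sum>i<r. u (e i) *\<^sub>R e i) = 0" by (simp add: sum.reindex[OF inj])
    from assms(1)[OF this] u show False by auto
  qed
  ultimately show ?thesis using sp by (simp add: indexed_basis_def)
qed

lemma sum_lessThan_add: "(\<Sum>i<n + k. f i) = (\<Sum>i<n. f i) + (\<Sum>i<k. f (n + i))"
  for f :: "nat \<Rightarrow> 'a::comm_monoid_add"
  by (induction k) (simp_all add: add.assoc)

text \<open>Stated relative to a subspace of an ambient vector space, so as to serve both for
  tangent spaces inside a space of functionals and for the fibres of the bundle.\<close>

locale symplectic_space =
  fixes V :: "'v::real_vector set" and B :: "'v \<Rightarrow> 'v \<Rightarrow> real"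
  assumes subspace: "subspace V"
    and add_left: "x \<in> V \<Longrightarrow> y \<in> V \<Longrightarrow> z \<in> V \<Longrightarrow> B (x + y) z = B x z + B y z"
    and scale_left: "x \<in> V \<Longrightarrow> y \<in> V \<Longrightarrow> B (c *\<^sub>R x) y = c * B x y"
    and skew: "x \<in> V \<Longrightarrow> y \<in> V \<Longrightarrow> B x y = - B y x"
    and nondegenerate: "x \<in> V \<Longrightarrow> (\<And>y. y \<in> V \<Longrightarrow> B x y = 0) \<Longrightarrow> x = 0"
begin

lemma add_right: "x \<in> V \<Longrightarrow> y \<in> V \<Longrightarrow> z \<in> V \<Longrightarrow> B z (x + y) = B z x + B z y"
  using add_left[of x y z] skew subspace_add[OF subspace, of x y] by (metis minus_add_distrib)

lemma scale_right: "x \<in> V \<Longrightarrow> y \<in> V \<Longrightarrow> B y (c *\<^sub>R x) = c * B y x"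
  using scale_left[of x y c] skew[of y "c *\<^sub>R x"] skew[of y x] subspace_scale[OF subspace, of x c] by simp

lemma diff_left:
  assumes "x \<in> V" "y \<in> V" "z \<in> V"
  shows "B (x - y) z = B x z - B y z"
  using add_left[OF assms(1) subspace_scale[OF subspace assms(2)] assms(3), of "- 1"]
    scale_left[OF assms(2,3), of "- 1"] by simp

lemma self_zero: "x \<in> V \<Longrightarrow> B x x = 0"
  using skew[of x x] by simp

lemma zero_left: "x \<in> V \<Longrightarrow> B 0 x = 0"
  using scale_left[of x x 0] by simp

lemma sum_left:
  assumes "\<And>i. i \<in> I \<Longrightarrow> x i \<in> V" "y \<in> V"
  shows "B (\<Sum>i\<in>I. c i *\<^sub>R x i) y = (\<Sum>i\<in>I. c i * B (x i) y)"
  using assms(1)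
proof (induction I rule: infinite_finite_induct)
  case (insert i I)
  have "(\<Sum>i\<in>I. c i *\<^sub>R x i) \<in> V"
    using insert by (intro subspace_sum[OF subspace] subspace_scale[OF subspace]) auto
  then show ?case
    using insert assms(2) by (simp add: add_left scale_left subspace_scale[OF subspace])
qed (simp_all add: zero_left assms(2))

lemma sum_right:
  assumes "\<And>i. i \<in> I \<Longrightarrow> x i \<in> V" "y \<in> V"
  shows "B y (\<Sum>i\<in>I. c i *\<^sub>R x i) = (\<Sum>i\<in>I. c i * B y (x i))"
proof -
  have "(\<Sum>i\<in>I. c i *\<^sub>R x i) \<in> V"
    using assms by (intro subspace_sum[OF subspace] subspace_scale[OF subspace]) auto
  then have "B y (\<Sum>i\<in>I. c i *\<^sub>R x i) = - (\<Sum>i\<in>I. c i * B (x i) y)"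
    using sum_left[OF assms] skew[OF assms(2)] by simp
  also have "\<dots> = (\<Sum>i\<in>I. c i * B y (x i))"
    unfolding sum_negf[symmetric]
    by (rule sum.cong[OF refl]) (simp add: skew[OF assms(2) assms(1)])
  finally show ?thesis .
qed

text \<open>Linear independence is automatic: pairing a relation with the partner of a basis vector
  isolates the coefficient of that vector up to sign.\<close>

lemma symplectic_basisI:
  assumes e: "\<And>i. i < 2 * n \<Longrightarrow> e i \<in> V" and sp: "V \<subseteq> span (e ` {..<2 * n})"
    and rel: "\<And>i j. i < n \<Longrightarrow> j < n \<Longrightarrow> B (e i) (e j) = 0 \<and> B (e (n + i)) (e (n + j)) = 0 \<and>
      B (e i) (e (n + j)) = of_bool (i = j)"
  shows "symplectic_basis n V B e"
proof -
  have "indexed_basis (2 * n) V e"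
  proof (rule indexed_basisI)
    show "span (e ` {..<2 * n}) = V"
      using e by (intro equalityI sp span_minimal subspace) auto
    fix c i assume 0: "(\<Sum>i<2 * n. c i *\<^sub>R e i) = 0" and i: "i < 2 * n"
    have s: "(\<Sum>i<n. c i * B (e i) (e k)) + (\<Sum>i<n. c (n + i) * B (e (n + i)) (e k)) = 0"
      if "k < 2 * n" for k
      using sum_left[of "{..<2 * n}" e "e k" c] e[OF that] e 0 zero_left
      by (simp add: mult_2 sum_lessThan_add)
    show "c i = 0"
    proof (cases "i < n")
      case True
      then show ?thesis using s[of "n + i"] rel by simp
    next
      case False
      then obtain j where j: "i = n + j" "j < n"
        using i by (metis add_diff_inverse_nat mult_2 nat_add_left_cancel_less)
      have "B (e (n + k)) (e j) = - of_bool (k = j)" if "k < n" for k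
        using skew[OF e e, of "n + k" j] rel[OF j(2) that] that j(2) by auto
      moreover have "(\<Sum>i<n. c (n + i) * of_bool (i = j)) = c (n + j)"
        using j(2) by (simp add: of_bool_def if_distrib cong: if_cong)
      ultimately show ?thesis using s[of j] rel j by (simp add: sum_negf)
    qed
  qed
  then show ?thesis using rel by (simp add: symplectic_basis_def)
qed

end

text \<open>For x with coefficients d, pairing with e_i gives - d_(n+i) and pairing with e_(n+i)
  gives d_i. The map J moves these numbers back to the vectors they belong to, with a sign - in both
  halves.\<close>

lemma (in symplectic_space) frame_J_expansion:
  assumes e: "symplectic_basis n V B e" and x: "x \<in> V"
  shows "(\<Sum>i<2 * n. B x (e i) *\<^sub>R frame_J n e i) = - x"
proof -
  have eb: "indexed_basis (2 * n) V e" and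
    rel: "\<And>i j. i < n \<Longrightarrow> j < n \<Longrightarrow> B (e i) (e j) = 0 \<and> B (e (n + i)) (e (n + j)) = 0 \<and>
      B (e i) (e (n + j)) = of_bool (i = j)"
    using e by (auto simp: symplectic_basis_def)
  note eV = indexed_basis_in[OF eb]
  obtain d where d: "x = (\<Sum>i<2 * n. d i *\<^sub>R e i)" by (rule indexed_basis_expand[OF eb x])
  have B: "B x (e k) = (\<Sum>i<n. d i * B (e i) (e k)) + (\<Sum>i<n. d (n + i) * B (e (n + i)) (e k))"
    if "k < 2 * n" for k
    using sum_left[of "{..<2 * n}" e "e k" d] eV that d by (simp add: mult_2 sum_lessThan_add)
  have lo: "B x (e i) = - d (n + i)" if i: "i < n" for i
  proof -
    have "B (e (n + j)) (e i) = - of_bool (j = i)" if "j < n" for j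
      using skew[OF eV eV, of "n + j" i] rel[OF i that] i that by auto
    moreover have "(\<Sum>j<n. d (n + j) * of_bool (j = i)) = d (n + i)"
      using i by (simp add: of_bool_def if_distrib cong: if_cong)
    ultimately show ?thesis using B[of i] rel i by (simp add: sum_negf)
  qed
  have hi: "B x (e (n + i)) = d i" if i: "i < n" for i
  proof -
    have "(\<Sum>j<n. d j * of_bool (j = i)) = d i"
      using i by (simp add: of_bool_def if_distrib cong: if_cong)
    then show ?thesis using B[of "n + i"] rel i by simp
  qed
  have "(\<Sum>i<2 * n. B x (e i) *\<^sub>R frame_J n e i) =
      (\<Sum>i<n. - (d (n + i) *\<^sub>R e (n + i))) + (\<Sum>i<n. - (d i *\<^sub>R e i))"
    by (simp add: mult_2 sum_lessThan_add lo hi frame_J_def)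
  also have "\<dots> = - x"
    by (simp add: d mult_2 sum_lessThan_add sum_negf)
  finally show ?thesis .
qed

text \<open>Symplectic Gram-Schmidt: a hyperbolic pair x, y is split off, and induction is applied
  to its orthogonal complement \<open>W\<close>. Since the ambient space may be
  infinite-dimensional, the induction runs over a bound on the size of independent sets; it drops
  for \<open>W\<close> because x can be added to any independent subset of \<open>W\<close>.\<close>

lemma symplectic_basis_exists_bounded:
  assumes "symplectic_space V B" "\<And>S. S \<subseteq> V \<Longrightarrow> independent S \<Longrightarrow> finite S \<and> card S \<le> N"
  shows "\<exists>n e. symplectic_basis n V B e"
  using assms
proof (induction N arbitrary: V)
  have trivial: "\<exists>n e. symplectic_basis n V B e" if "symplectic_space V B" "V \<subseteq> {0}" for V
    using that symplectic_space.symplectic_basisI[OF that(1), of 0 "\<lambda>_. 0"] by (intro exI) auto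
  case 0
  have "x = 0" if "x \<in> V" for x using 0(2)[of "{x}"] that by auto
  then show ?case using trivial[OF 0(1)] by blast
next
  case (Suc N)
  interpret symplectic_space V B by fact
  show ?case
  proof (cases "V \<subseteq> {0}")
    case True
    then show ?thesis
      using symplectic_basisI[of 0 "\<lambda>_. 0"] by (intro exI[of _ 0] exI[of _ "\<lambda>_. 0"]) auto
  next
    case False
    then obtain x where x: "x \<in> V" "x \<noteq> 0" by blast
    then obtain y' where y': "y' \<in> V" "B x y' \<noteq> 0" using nondegenerate by blast
    define y where "y = (1 / B x y') *\<^sub>R y'"
    have y: "y \<in> V" "B x y = 1" "B y x = - 1"
      using y' x(1) skew[of y x] by (auto simp: y_def subspace_scale[OF subspace] scale_right)
    define W where "W = {w \<in> V. B w x = 0 \<and> B w y = 0}"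
    have WV: "w \<in> V" "B w x = 0" "B w y = 0" if "w \<in> W" for w using that by (auto simp: W_def)
    have xW: "x \<notin> W" using y by (auto simp: W_def)
    \<comment> \<open>The projection to the complement of the hyperbolic plane. The two signs differ
      because B x y = 1 while B y x = - 1.\<close>
    have split: "v - B v y *\<^sub>R x + B v x *\<^sub>R y \<in> W" if v: "v \<in> V" for v
    proof -
      have "v - B v y *\<^sub>R x \<in> V" "B v x *\<^sub>R y \<in> V" "B v y *\<^sub>R x \<in> V"
        using v x y by (auto intro!: subspace_diff[OF subspace] subspace_scale[OF subspace])
      then show ?thesis
        unfolding W_def using v x y
        by (auto simp: add_left diff_left scale_left self_zero subspace_add[OF subspace])
    qed
    have subW: "subspace W"
      unfolding W_def subspace_def using subspace x(1) y(1)
      by (auto simp: add_left scale_left zero_left subspace_add subspace_scale subspace_0)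
    interpret W: symplectic_space W B
    proof (unfold_locales)
      fix w assume w: "w \<in> W" and 0: "\<And>w'. w' \<in> W \<Longrightarrow> B w w' = 0"
      show "w = 0"
      proof (rule nondegenerate)
        fix v assume v: "v \<in> V"
        let ?w' = "v - B v y *\<^sub>R x + B v x *\<^sub>R y"
        have "v = ?w' + (B v y *\<^sub>R x + (- B v x) *\<^sub>R y)" by simp
        also have "B w \<dots> = B w ?w' + (B v y * B w x + (- B v x) * B w y)"
          using WV(1)[OF w] WV(1)[OF split[OF v]] x(1) y(1)
          by (simp only: add_right scale_right subspace_add[OF subspace] subspace_scale[OF subspace])
        finally show "B w v = 0" using 0[OF split[OF v]] WV[OF w] by simp
      qed (rule WV(1)[OF w])
    qed (use subW WV in \<open>auto intro: add_left scale_left skew\<close>)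
    have "finite S \<and> card S \<le> N" if S: "S \<subseteq> W" "independent S" for S
    proof -
      have "span S \<subseteq> W" by (rule span_minimal[OF S(1) subW])
      then have nin: "x \<notin> span S" using xW by blast
      then have "independent (insert x S)" using S(2) by (simp add: independent_insertI)
      moreover have "insert x S \<subseteq> V" using S(1) WV(1) x(1) by blast
      ultimately have "finite (insert x S) \<and> card (insert x S) \<le> Suc N" by (intro Suc.prems(2))
      moreover have "x \<notin> S" using nin span_base by blast
      ultimately show ?thesis by auto
    qed
    from Suc.IH[OF W.symplectic_space_axioms this]
    obtain n e where e: "symplectic_basis n W B e" by blast
    then have eb: "indexed_basis (2 * n) W e" and
      rel: "\<And>i j. i < n \<Longrightarrow> j < n \<Longrightarrow> B (e i) (e j) = 0 \<and> B (e (n + i)) (e (n + j)) = 0 \<and>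
        B (e i) (e (n + j)) = of_bool (i = j)"
      by (auto simp: symplectic_basis_def)
    have eW: "e i \<in> W" if "i < 2 * n" for i using indexed_basis_in[OF eb that] .
    have ex: "B (e i) x = 0" "B (e i) y = 0" "B x (e i) = 0" "B y (e i) = 0" if "i < 2 * n" for i
      using WV[OF eW[OF that]] skew[of x "e i"] skew[of y "e i"] x(1) y(1) by auto
    \<comment> \<open>The new order is e_0, ..., e_(n-1), x, e_n, ..., e_(2n-1), y. Partners now lie
      n + 1 places apart, so the second half of e moves up by one.\<close>
    define g where "g i = (if i < n then e i else if i = n then x else if i < 2 * n + 1 then e (i - 1) else y)" for i
    have "symplectic_basis (Suc n) V B g"
    proof (rule symplectic_basisI)
      show "g i \<in> V" if "i < 2 * Suc n" for i
        using eW WV(1) x y that by (auto simp: g_def)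
    next
      have gl: "g i = e i" "g (Suc n + i) = e (n + i)" if "i < n" for i
        using that by (auto simp: g_def)
      have gn: "g n = x" "g (Suc n + n) = y" by (auto simp: g_def)
      fix i j assume "i < Suc n" "j < Suc n"
      then consider "i < n" "j < n" | "i < n" "j = n" | "i = n" "j < n" | "i = n" "j = n"
        by (auto simp: less_Suc_eq)
      then show "B (g i) (g j) = 0 \<and> B (g (Suc n + i)) (g (Suc n + j)) = 0 \<and>
          B (g i) (g (Suc n + j)) = of_bool (i = j)"
      proof cases
        case 1
        then show ?thesis using rel[of i j] by (simp only: gl)
      next
        case 2
        then show ?thesis using ex[of i] ex[of "n + i"] by (simp only: gl gn) simp
      next
        case 3
        then show ?thesis using ex[of j] ex[of "n + j"] by (simp only: gl gn) simp
      next
        case 4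
        then show ?thesis using self_zero[OF x(1)] self_zero[OF y(1)] y(2) by (simp only: gn) simp
      qed
    next
      show "V \<subseteq> span (g ` {..<2 * Suc n})"
      proof
        fix v assume v: "v \<in> V"
        let ?S = "g ` {..<2 * Suc n}"
        have gx: "x \<in> ?S" "y \<in> ?S"
          by (auto simp: g_def intro!: image_eqI[of _ _ n] image_eqI[of _ _ "2 * n + 1"])
        have "e i \<in> ?S" if "i < 2 * n" for i
          using that by (cases "i < n")
            (auto simp: g_def intro!: image_eqI[of _ _ i] image_eqI[of _ _ "Suc i"])
        then have "span (e ` {..<2 * n}) \<subseteq> span ?S" by (intro span_mono) auto
        then have "v - B v y *\<^sub>R x + B v x *\<^sub>R y \<in> span ?S"
          using split[OF v] eb by (auto simp: indexed_basis_def)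
        moreover have "B v y *\<^sub>R x - B v x *\<^sub>R y \<in> span ?S"
          by (intro span_diff span_scale span_base gx)
        ultimately have "(v - B v y *\<^sub>R x + B v x *\<^sub>R y) + (B v y *\<^sub>R x - B v x *\<^sub>R y) \<in> span ?S"
          by (rule span_add)
        then show "v \<in> span ?S" by simp
      qed
    qed
    then show ?thesis by blast
  qed
qed

text \<open>The given basis bounds the independent sets, and since all bases have the same length it
  also fixes the length of the symplectic one.\<close>

lemma symplectic_basis_exists:
  assumes "symplectic_space V B" and e: "indexed_basis (2 * n) V e"
  shows "\<exists>e. symplectic_basis n V B e"
proof -
  have "finite S \<and> card S \<le> card (e ` {..<2 * n})" if "S \<subseteq> V" "independent S" for S
    using independent_span_bound[of "e ` {..<2 * n}" S] that e by (simp add: indexed_basis_def)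
  then obtain k e' where k: "symplectic_basis k V B e'"
    using symplectic_basis_exists_bounded[OF assms(1)] by blast
  then have "indexed_basis (2 * k) V e'" by (simp add: symplectic_basis_def)
  from indexed_basis_unique_length[OF this e] have "k = n" by simp
  then show ?thesis using k by auto
qed

section \<open>Alternating forms in dimension four\<close>

definition alt2 :: "'t::real_vector set \<Rightarrow> 'w::real_vector set \<Rightarrow> ('t \<Rightarrow> 't \<Rightarrow> 'w) \<Rightarrow> bool" where
  "alt2 V W P \<longleftrightarrow> (\<forall>u\<in>V. \<forall>v\<in>V. P u v \<in> W \<and> P v u = - P u v) \<and>
     (\<forall>c. \<forall>u\<in>V. \<forall>v\<in>V. \<forall>w\<in>V. P (c *\<^sub>R u + v) w = c *\<^sub>R P u w + P v w)"

text \<open>Signs under the three adjacent transpositions and linearity in the first slot suffice: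
  every slot can be moved to the front.\<close>

definition alt4 :: "'t::real_vector set \<Rightarrow> ('t \<Rightarrow> 't \<Rightarrow> 't \<Rightarrow> 't \<Rightarrow> 'w::real_vector) \<Rightarrow> bool" where
  "alt4 V G \<longleftrightarrow>
     (\<forall>x\<in>V. \<forall>y\<in>V. \<forall>z\<in>V. \<forall>w\<in>V. G y x z w = - G x y z w \<and> G x z y w = - G x y z w \<and> G x y w z = - G x y z w) \<and>
     (\<forall>c. \<forall>u\<in>V. \<forall>v\<in>V. \<forall>y\<in>V. \<forall>z\<in>V. \<forall>w\<in>V. G (c *\<^sub>R u + v) y z w = c *\<^sub>R G u y z w + G v y z w)"

lemma linear_eq_zero_on_basis:
  fixes h :: "'t::real_vector \<Rightarrow> 'w::real_vector"
  assumes e: "indexed_basis r V e" and lin: "\<And>c u v. u \<in> V \<Longrightarrow> v \<in> V \<Longrightarrow> h (c *\<^sub>R u + v) = c *\<^sub>R h u + h v"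
    and z: "\<And>i. i < r \<Longrightarrow> h (e i) = 0" and x: "x \<in> V"
  shows "h x = 0"
proof -
  note V = indexed_basis_subspace[OF e]
  have h0: "h 0 = 0" using lin[OF subspace_0[OF V] subspace_0[OF V], of 1] by simp
  have "h (\<Sum>i\<in>I. c i *\<^sub>R e i) = 0" if "I \<subseteq> {..<r}" for c I
    using that
  proof (induction I rule: infinite_finite_induct)
    case (insert i I)
    have "(\<Sum>i\<in>I. c i *\<^sub>R e i) \<in> V" "e i \<in> V"
      using insert.prems indexed_basis_in[OF e]
      by (auto intro!: subspace_sum[OF V] subspace_scale[OF V])
    then show ?case using insert by (simp add: lin z)
  qed (simp_all add: h0)
  then show ?thesis using indexed_basis_expand[OF e x] by (metis subset_refl)
qed

lemma alt2_eq_on_basis: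
  assumes e: "indexed_basis r V e" and P: "alt2 V W P" and Q: "alt2 V W' Q"
    and eq: "\<And>i j. i < j \<Longrightarrow> j < r \<Longrightarrow> P (e i) (e j) = Q (e i) (e j)" and uv: "u \<in> V" "v \<in> V"
  shows "P u v = Q u v"
proof -
  note eV = indexed_basis_in[OF e] and V = indexed_basis_subspace[OF e]
  have P2: "P v u = - P u v" "Q v u = - Q u v" if "u \<in> V" "v \<in> V" for u v
    using P Q that unfolding alt2_def by blast+
  have lin: "P (c *\<^sub>R u + v) w = c *\<^sub>R P u w + P v w" "Q (c *\<^sub>R u + v) w = c *\<^sub>R Q u w + Q v w"
    if "u \<in> V" "v \<in> V" "w \<in> V" for c u v w
    using P Q that unfolding alt2_def by blast+
  have self: "P u u = 0" "Q u u = 0" if "u \<in> V" for u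
  proof -
    have "2 *\<^sub>R P u u = 0" "2 *\<^sub>R Q u u = 0"
      unfolding scaleR_2 using P2[OF that that] by (metis add.right_inverse)+
    then show "P u u = 0" "Q u u = 0" by simp_all
  qed
  have ee: "P (e i) (e j) = Q (e i) (e j)" if ij: "i < r" "j < r" for i j
  proof -
    consider "i < j" | "i = j" | "j < i" by linarith
    then show ?thesis
      using eq[of i j] eq[of j i] ij self[OF eV, of i] P2[OF eV eV, of j i] by cases auto
  qed
  have "P u (e j) - Q u (e j) = 0" if "u \<in> V" "j < r" for u j
    by (rule linear_eq_zero_on_basis[OF e _ _ that(1), of "\<lambda>u. P u (e j) - Q u (e j)"])
      (simp_all add: lin eV that ee scaleR_diff_right)
  then have "P (e j) u - Q (e j) u = 0" if "u \<in> V" "j < r" for u j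
    using P2[OF that(1) eV[OF that(2)]] that by simp
  then have "P v u - Q v u = 0"
    by (intro linear_eq_zero_on_basis[OF e _ _ uv(2), of "\<lambda>v. P v u - Q v u"])
      (simp_all add: lin uv scaleR_diff_right)
  then show ?thesis using P2[OF uv] by simp
qed

lemma alt4_linear:
  "alt4 V G \<Longrightarrow> u \<in> V \<Longrightarrow> v \<in> V \<Longrightarrow> y \<in> V \<Longrightarrow> z \<in> V \<Longrightarrow> w \<in> V \<Longrightarrow>
    G (c *\<^sub>R u + v) y z w = c *\<^sub>R G u y z w + G v y z w"
  unfolding alt4_def by blast

lemma alt4_swap:
  assumes "alt4 V G" "x \<in> V" "y \<in> V" "z \<in> V" "w \<in> V"
  shows "G y x z w = - G x y z w" "G x z y w = - G x y z w" "G x y w z = - G x y z w"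
  using assms unfolding alt4_def by blast+

text \<open>Alternating 4-forms on a 4-dimensional space are determined by one value. Applied to a
  difference, this turns an identity of 4-forms into one evaluation on a convenient basis.\<close>

lemma alt4_zero:
  assumes e: "indexed_basis 4 V e" and G: "alt4 V G" and z: "G (e 0) (e 1) (e 2) (e 3) = 0"
    and V: "x \<in> V" "y \<in> V" "z \<in> V" "w \<in> V"
  shows "G x y z w = 0"
proof -
  note eV = indexed_basis_in[OF e]
  have s: "G y x z w = - G x y z w" "G x z y w = - G x y z w" "G x y w z = - G x y z w"
    if "x \<in> V" "y \<in> V" "z \<in> V" "w \<in> V" for x y z w
    using G that unfolding alt4_def by blast+
  have lin: "G (c *\<^sub>R u + v) y z w = c *\<^sub>R G u y z w + G v y z w"
    if "u \<in> V" "v \<in> V" "y \<in> V" "z \<in> V" "w \<in> V" for c u v y z w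
    using alt4_linear[OF G that] .
  have self: "a = 0" if "a = - a" for a :: 'b
  proof -
    have "2 *\<^sub>R a = 0" unfolding scaleR_2 using that by (metis add.right_inverse)
    then show ?thesis by simp
  qed
  \<comment> \<open>Reducing the indices mod 4 makes the swap rules valid for all natural numbers,
    so that they rewrite without side conditions on membership.\<close>
  define g where "g i j k l = G (e (i mod 4)) (e (j mod 4)) (e (k mod 4)) (e (l mod 4))" for i j k l
  have em: "e (i mod 4) \<in> V" for i using eV by simp
  have swap: "g j i k l = - g i j k l" "g i k j l = - g i j k l" "g i j l k = - g i j k l" for i j k l
    unfolding g_def by (fact s[OF em em em em])+
  \<comment> \<open>Restricted to pairs in the wrong order, the swaps become a terminating sorting
    procedure on the indices.\<close>
  have sort: "j < i \<Longrightarrow> g i j k l = - g j i k l" "k < j \<Longrightarrow> g i j k l = - g i k j l"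
    "l < k \<Longrightarrow> g i j k l = - g i j l k" for i j k l
    by (rule swap)+
  have g0: "g i i k l = 0" "g i k k l = 0" "g i k l l = 0" for i k l
    using swap(1)[of i i k l] swap(2)[of i k k l] swap(3)[of i k l l] self by blast+
  have z': "g 0 1 2 3 = 0" using z by (simp add: g_def)
  have "g i j k l = 0" if "i < 4" "j < 4" "k < 4" "l < 4" for i j k l
  proof -
    have less: "n = 0 \<or> n = 1 \<or> n = 2 \<or> n = 3" if "n < 4" for n :: nat using that by auto
    show ?thesis
      using less[OF that(1)] less[OF that(2)] less[OF that(3)] less[OF that(4)]
      by (elim disjE; hypsubst) (simp_all only: sort g0 z' minus_zero rel_simps zero_less_one zero_less_numeral)
  qed
  then have 1: "G (e i) (e j) (e k) (e l) = 0" if "i < 4" "j < 4" "k < 4" "l < 4" for i j k l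
    using that by (fastforce simp: g_def)
  \<comment> \<open>Basis vectors are replaced by arbitrary ones slot by slot. Each time the slot to
    be freed stands in front, where linearity is available, and the vectors already freed are
    swapped behind it.\<close>
  have 2: "G x (e j) (e k) (e l) = 0" if "x \<in> V" "j < 4" "k < 4" "l < 4" for x j k l
    by (rule linear_eq_zero_on_basis[OF e _ _ that(1), of "\<lambda>x. G x (e j) (e k) (e l)"])
      (simp_all add: lin eV that 1)
  have 3: "G y x (e k) (e l) = 0" if "x \<in> V" "y \<in> V" "k < 4" "l < 4" for x y k l
    by (rule linear_eq_zero_on_basis[OF e _ _ that(2), of "\<lambda>y. G y x (e k) (e l)"])
      (use s(1)[OF that(1) eV eV eV] in \<open>simp_all add: lin eV that 2\<close>)
  have 4: "G z x y (e l) = 0" if "x \<in> V" "y \<in> V" "z \<in> V" "l < 4" for x y z l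
    by (rule linear_eq_zero_on_basis[OF e _ _ that(3), of "\<lambda>z. G z x y (e l)"])
      (use s(1)[OF that(1) eV that(2) eV] s(2)[OF that(1,2) eV eV] in \<open>simp_all add: lin eV that 3\<close>)
  have "G w x y z = 0"
    by (rule linear_eq_zero_on_basis[OF e _ _ V(4), of "\<lambda>w. G w x y z"])
      (use s(1)[OF V(1) eV V(2,3)] s(2)[OF V(1,2) eV V(3)] s(3)[OF V(1-3) eV] in \<open>simp_all add: lin eV V 4\<close>)
  then show ?thesis using s(1)[OF V(1,4,2,3)] s(2)[OF V(1,2,4,3)] s(3)[OF V] by simp
qed

lemma alt4_diff:
  assumes "alt4 V G" "alt4 V H"
  shows "alt4 V (\<lambda>x y z w. G x y z w - H x y z w)"
  unfolding alt4_def
proof (intro conjI ballI allI)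
  fix x y z w assume v: "x \<in> V" "y \<in> V" "z \<in> V" "w \<in> V"
  note s = alt4_swap[OF assms(1) v] alt4_swap[OF assms(2) v]
  show "G y x z w - H y x z w = - (G x y z w - H x y z w)"
    "G x z y w - H x z y w = - (G x y z w - H x y z w)"
    "G x y w z - H x y w z = - (G x y z w - H x y z w)"
    unfolding s by simp_all
qed (simp add: alt4_linear[OF assms(1)] alt4_linear[OF assms(2)] scaleR_diff_right)

lemma alt4_scale:
  fixes g :: "'t::real_vector \<Rightarrow> 't \<Rightarrow> 't \<Rightarrow> 't \<Rightarrow> real"
  assumes "alt4 V g"
  shows "alt4 V (\<lambda>x y z w. g x y z w *\<^sub>R a)"
  unfolding alt4_def
proof (intro conjI ballI allI)
  fix x y z w assume v: "x \<in> V" "y \<in> V" "z \<in> V" "w \<in> V"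
  note s = alt4_swap[OF assms(1) v]
  show "g y x z w *\<^sub>R a = - (g x y z w *\<^sub>R a)" "g x z y w *\<^sub>R a = - (g x y z w *\<^sub>R a)"
    "g x y w z *\<^sub>R a = - (g x y z w *\<^sub>R a)"
    unfolding s by simp_all
qed (simp add: alt4_linear[OF assms(1)] scaleR_add_left)

text \<open>The six (2,2)-shuffles with their signs. The map m combines the values: the product of
  reals, the scaling of an endomorphism by a real, or the pairing of two endomorphisms.\<close>

definition wedge22 :: "('a \<Rightarrow> 'b \<Rightarrow> 'c::real_vector) \<Rightarrow> ('t \<Rightarrow> 't \<Rightarrow> 'a) \<Rightarrow> ('t \<Rightarrow> 't \<Rightarrow> 'b) \<Rightarrow>
    't \<Rightarrow> 't \<Rightarrow> 't \<Rightarrow> 't \<Rightarrow> 'c" where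
  "wedge22 m P Q x y z w = m (P x y) (Q z w) - m (P x z) (Q y w) + m (P x w) (Q y z) +
     m (P y z) (Q x w) - m (P y w) (Q x z) + m (P z w) (Q x y)"

definition bilinear_on :: "'a::real_vector set \<Rightarrow> 'b::real_vector set \<Rightarrow> ('a \<Rightarrow> 'b \<Rightarrow> 'c::real_vector) \<Rightarrow> bool" where
  "bilinear_on K L m \<longleftrightarrow> subspace K \<and> subspace L \<and>
     (\<forall>c. \<forall>x\<in>K. \<forall>y\<in>K. \<forall>z\<in>L. m (c *\<^sub>R x + y) z = c *\<^sub>R m x z + m y z) \<and>
     (\<forall>c. \<forall>x\<in>K. \<forall>y\<in>L. \<forall>z\<in>L. m x (c *\<^sub>R y + z) = c *\<^sub>R m x y + m x z)"

lemma bilinear_on_minus: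
  assumes "bilinear_on K L m" "x \<in> K" "y \<in> L"
  shows "m (- x) y = - m x y" "m x (- y) = - m x y"
proof -
  have z: "m 0 y = 0" "m x 0 = 0"
    using assms unfolding bilinear_on_def
    by (metis add_cancel_right_right scaleR_one add.right_neutral subspace_0)+
  have "m ((- 1) *\<^sub>R x + 0) y = (- 1) *\<^sub>R m x y + m 0 y" "m x ((- 1) *\<^sub>R y + 0) = (- 1) *\<^sub>R m x y + m x 0"
    using assms subspace_0 unfolding bilinear_on_def by blast+
  then show "m (- x) y = - m x y" "m x (- y) = - m x y" using z by simp_all
qed

text \<open>Under an adjacent transposition of the arguments each of the six terms becomes the
  negative of itself or of another term.\<close>

lemma alt4_wedge22:
  assumes P: "alt2 V K P" and Q: "alt2 V L Q" and m: "bilinear_on K L m"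
  shows "alt4 V (wedge22 m P Q)"
proof -
  have P1: "P x y \<in> K" "Q x y \<in> L" if "x \<in> V" "y \<in> V" for x y
    using P Q that unfolding alt2_def by blast+
  have P2: "P y x = - P x y" "Q y x = - Q x y" if "x \<in> V" "y \<in> V" for x y
    using P Q that unfolding alt2_def by blast+
  have lin: "P (c *\<^sub>R u + v) w = c *\<^sub>R P u w + P v w" "Q (c *\<^sub>R u + v) w = c *\<^sub>R Q u w + Q v w"
    if "u \<in> V" "v \<in> V" "w \<in> V" for c u v w
    using P Q that unfolding alt2_def by blast+
  have ml: "m (c *\<^sub>R x + y) z = c *\<^sub>R m x z + m y z" if "x \<in> K" "y \<in> K" "z \<in> L" for c x y z
    using m that by (simp add: bilinear_on_def)
  have mr: "m x (c *\<^sub>R y + z) = c *\<^sub>R m x y + m x z" if "x \<in> K" "y \<in> L" "z \<in> L" for c x y z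
    using m that by (simp add: bilinear_on_def)
  note neg = bilinear_on_minus[OF m]
  show ?thesis
    unfolding alt4_def
  proof (intro conjI ballI allI)
    fix x y z w assume v: "x \<in> V" "y \<in> V" "z \<in> V" "w \<in> V"
    show "wedge22 m P Q y x z w = - wedge22 m P Q x y z w"
      unfolding wedge22_def using v by (simp add: P2[of x y] neg P1)
    show "wedge22 m P Q x z y w = - wedge22 m P Q x y z w"
      unfolding wedge22_def using v by (simp add: P2[of y z] neg P1)
    show "wedge22 m P Q x y w z = - wedge22 m P Q x y z w"
      unfolding wedge22_def using v by (simp add: P2[of z w] neg P1)
  next
    fix c u v y z w assume v: "u \<in> V" "v \<in> V" "y \<in> V" "z \<in> V" "w \<in> V"
    show "wedge22 m P Q (c *\<^sub>R u + v) y z w = c *\<^sub>R wedge22 m P Q u y z w + wedge22 m P Q v y z w"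
      unfolding wedge22_def using v by (simp add: lin ml mr P1) (simp add: algebra_simps)
  qed
qed

text \<open>Skewness comes from polarisation: the form vanishes on the repeated vector u + v, and
  bilinearity leaves the two mixed terms.\<close>

lemma alternating_on_pair:
  assumes "alternating_on 2 V W a" and V: "subspace V"
  shows "alt2 V W (\<lambda>u v. a [u, v])"
proof -
  have val: "a [u, v] \<in> W" if "u \<in> V" "v \<in> V" for u v
    using assms(1) that unfolding alternating_on_def by simp
  have lin1: "a [c *\<^sub>R u + v, w] = c *\<^sub>R a [u, w] + a [v, w]" if "u \<in> V" "v \<in> V" "w \<in> V" for c u v w
    using assms(1)[unfolded alternating_on_def, THEN conjunct2, THEN conjunct2, THEN conjunct1,
        rule_format, of "[u, w]" 0 u v c] that by simp
  have lin2: "a [w, c *\<^sub>R u + v] = c *\<^sub>R a [w, u] + a [w, v]" if "u \<in> V" "v \<in> V" "w \<in> V" for c u v w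
    using assms(1)[unfolded alternating_on_def, THEN conjunct2, THEN conjunct2, THEN conjunct1,
        rule_format, of "[w, u]" 1 u v c] that by simp
  have self: "a [u, u] = 0" if "u \<in> V" for u
    using assms(1)[unfolded alternating_on_def, THEN conjunct2, THEN conjunct2, THEN conjunct2,
        rule_format, of "[u, u]" 0 1] that by simp
  have "a [v, u] = - a [u, v]" if "u \<in> V" "v \<in> V" for u v
  proof -
    have "u + v \<in> V" using V that subspace_add by blast
    then have "a [u, v] + a [v, u] = 0"
      using lin1[of u v "u + v" 1] lin2[of u v u 1] lin2[of u v v 1] self that by simp
    then show ?thesis by (simp add: eq_neg_iff_add_eq_0 add.commute)
  qed
  then show ?thesis using val lin1 unfolding alt2_def by blast
qed

lemma alternating_on_invalid: "alternating_on k V W a \<Longrightarrow> \<not> (length vs = k \<and> set vs \<subseteq> V) \<Longrightarrow> a vs = 0"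
  unfolding alternating_on_def by blast

lemma alternating_on_linear:
  assumes "alternating_on k V W a" "length vs = k \<and> set vs \<subseteq> V \<and> i < k \<and> u \<in> V \<and> v \<in> V"
  shows "a (vs[i := c *\<^sub>R u + v]) = c *\<^sub>R a (vs[i := u]) + a (vs[i := v])"
  using assms(1)[unfolded alternating_on_def, THEN conjunct2, THEN conjunct2, THEN conjunct1] assms(2)
  by blast

lemma alternating_on_repeat:
  assumes "alternating_on k V W a" "length vs = k \<and> set vs \<subseteq> V \<and> i < j \<and> j < k \<and> vs ! i = vs ! j"
  shows "a vs = 0"
  using assms(1)[unfolded alternating_on_def, THEN conjunct2, THEN conjunct2, THEN conjunct2] assms(2)
  by blast

lemma alternating_on_swap:
  assumes "alternating_on 2 V W a" "subspace V"
  shows "a [v, u] = - a [u, v]"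
proof (cases "u \<in> V \<and> v \<in> V")
  case True
  then show ?thesis using alternating_on_pair[OF assms] unfolding alt2_def by blast
next
  case False
  then have "a [u, v] = 0" "a [v, u] = 0" by (auto intro!: alternating_on_invalid[OF assms(1)])
  then show ?thesis by simp
qed

lemma alternating_on_lincomb:
  assumes W: "subspace W" and a: "alternating_on k V W a" and a': "alternating_on k V W a'"
  shows "alternating_on k V W (\<lambda>vs. s *\<^sub>R a vs + a' vs)"
  unfolding alternating_on_def
proof (intro conjI allI impI)
  fix vs assume "length vs = k \<and> set vs \<subseteq> V"
  then have "a vs \<in> W" "a' vs \<in> W"
    using a[unfolded alternating_on_def, THEN conjunct1] a'[unfolded alternating_on_def, THEN conjunct1]
    by blast+
  then show "s *\<^sub>R a vs + a' vs \<in> W" by (intro subspace_add[OF W] subspace_scale[OF W])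
next
  fix vs assume vs: "\<not> (length vs = k \<and> set vs \<subseteq> V)"
  show "s *\<^sub>R a vs + a' vs = 0"
    unfolding alternating_on_invalid[OF a vs] alternating_on_invalid[OF a' vs] by simp
next
  fix vs u v and i :: nat and c :: real
  assume vs: "length vs = k \<and> set vs \<subseteq> V \<and> i < k \<and> u \<in> V \<and> v \<in> V"
  show "s *\<^sub>R a (vs[i := c *\<^sub>R u + v]) + a' (vs[i := c *\<^sub>R u + v]) =
      c *\<^sub>R (s *\<^sub>R a (vs[i := u]) + a' (vs[i := u])) + (s *\<^sub>R a (vs[i := v]) + a' (vs[i := v]))"
    unfolding alternating_on_linear[OF a vs] alternating_on_linear[OF a' vs] by (simp add: algebra_simps)
next
  fix vs and i j :: nat assume vs: "length vs = k \<and> set vs \<subseteq> V \<and> i < j \<and> j < k \<and> vs ! i = vs ! j"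
  show "s *\<^sub>R a vs + a' vs = 0"
    unfolding alternating_on_repeat[OF a vs] alternating_on_repeat[OF a' vs] by simp
qed

lemma alternating_on_minus:
  assumes "alternating_on 2 V W a" "subspace V" "u \<in> V" "v \<in> V"
  shows "a [- u, v] = - a [u, v]" "a [u, - v] = - a [u, v]"
proof -
  \<comment> \<open>The linearity clause treats c u + v as one expression; -u is brought into this
    shape as (-2) u + u.\<close>
  have lin: "a [(- 2) *\<^sub>R u + u, v] = (- 2) *\<^sub>R a [u, v] + a [u, v]" if "u \<in> V" "v \<in> V" for u v
    using alternating_on_pair[OF assms(1,2)] that unfolding alt2_def by blast
  have neg: "(- 2) *\<^sub>R x + x = - x" for x :: "'c::real_vector"
    using scaleR_add_left[of "- 2" 1 x] by simp
  show "a [- u, v] = - a [u, v]" using lin[OF assms(3,4)] unfolding neg .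
  show "a [u, - v] = - a [u, v]"
    using lin[OF assms(4,3)] alternating_on_swap[OF assms(1,2)] unfolding neg by metis
qed

section \<open>Antisymmetrisation sums in degrees two and four\<close>

lemma sum_permutes_2:
  "(\<Sum>\<sigma> | \<sigma> permutes {..<2::nat}. of_int (sign \<sigma>) * f (\<sigma> 0) (\<sigma> 1)) = (f 0 1 - f 1 0 :: real)"
proof -
  have S: "{..<2::nat} = insert 0 {1}" by auto
  show ?thesis
    unfolding S
    by (subst sum_over_permutations_insert)
      (auto simp: permutes_sing sign_swap_id sign_compose permutation_swap_id sign_id)
qed

lemma sum_permutes_4:
  "(\<Sum>\<sigma> | \<sigma> permutes {..<4::nat}. of_int (sign \<sigma>) * f (\<sigma> 0) (\<sigma> 1) (\<sigma> 2) (\<sigma> 3)) =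
    (f 0 1 2 3 - f 0 1 3 2 - f 0 2 1 3 + f 0 2 3 1 + f 0 3 1 2 - f 0 3 2 1
   - f 1 0 2 3 + f 1 0 3 2 + f 1 2 0 3 - f 1 2 3 0 - f 1 3 0 2 + f 1 3 2 0
   + f 2 0 1 3 - f 2 0 3 1 - f 2 1 0 3 + f 2 1 3 0 + f 2 3 0 1 - f 2 3 1 0
   - f 3 0 1 2 + f 3 0 2 1 + f 3 1 0 2 - f 3 1 2 0 - f 3 2 0 1 + f 3 2 1 0 :: real)"
proof -
  have S: "{..<4::nat} = insert 0 (insert 1 (insert 2 {3}))" by auto
  have f: "finite (insert 1 (insert 2 {3::nat}))" "0 \<notin> insert 1 (insert 2 {3::nat})"
    "finite (insert 2 {3::nat})" "1 \<notin> insert 2 {3::nat}" "finite {3::nat}" "2 \<notin> {3::nat}" by auto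
  show ?thesis
    unfolding S sum_over_permutations_insert[OF f(1,2)] sum_over_permutations_insert[OF f(3,4)]
      sum_over_permutations_insert[OF f(5,6)] permutes_sing
    by (simp add: sign_swap_id permutation_swap_id permutation_compose sign_compose sign_id)
qed

text \<open>The 24 permutations fall into six classes of four, which differ by swaps within the two
  pairs. Skewness makes the signed terms of a class equal, and the division by 2! 2! leaves one term
  for each shuffle.\<close>

lemma wedge_with_2_2:
  assumes len: "length vs = 4"
    and anti: "\<And>i j k l. i < 4 \<Longrightarrow> j < 4 \<Longrightarrow> k < 4 \<Longrightarrow> l < 4 \<Longrightarrow>
      B p (\<alpha> p [vs ! j, vs ! i]) (\<beta> p [vs ! k, vs ! l]) = - B p (\<alpha> p [vs ! i, vs ! j]) (\<beta> p [vs ! k, vs ! l]) \<and>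
      B p (\<alpha> p [vs ! i, vs ! j]) (\<beta> p [vs ! l, vs ! k]) = - B p (\<alpha> p [vs ! i, vs ! j]) (\<beta> p [vs ! k, vs ! l])"
  shows "wedge_with B 2 2 \<alpha> \<beta> p vs =
    wedge22 (B p) (\<lambda>u v. \<alpha> p [u, v]) (\<lambda>u v. \<beta> p [u, v]) (vs ! 0) (vs ! 1) (vs ! 2) (vs ! 3)"
proof -
  define f where "f i j k l = B p (\<alpha> p [vs ! i, vs ! j]) (\<beta> p [vs ! k, vs ! l])" for i j k l
  have 1: "f j i k l = - f i j k l" if "i < j" "j < 4" "k < 4" "l < 4" for i j k l
    using anti[of i j k l] that by (simp add: f_def)
  have 2: "f i j l k = - f i j k l" if "k < l" "i < 4" "j < 4" "l < 4" for i j k l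
    using anti[of i j k l] that by (simp add: f_def)
  have upt: "[0..<2] = [0, 1::nat]" "[2..<2 + 2] = [2, 3::nat]"
    by (simp_all add: upt_rec)
  have "wedge_with B 2 2 \<alpha> \<beta> p vs =
      (\<Sum>\<sigma> | \<sigma> permutes {..<4::nat}. of_int (sign \<sigma>) * f (\<sigma> 0) (\<sigma> 1) (\<sigma> 2) (\<sigma> 3)) / 4"
    unfolding wedge_with_def upt using len by (simp add: f_def fact_numeral)
  also have "\<dots> = f 0 1 2 3 - f 0 2 1 3 + f 0 3 1 2 + f 1 2 0 3 - f 1 3 0 2 + f 2 3 0 1"
    unfolding sum_permutes_4 by (simp add: 1 2)
  finally show ?thesis by (simp add: f_def wedge22_def)
qed

lemma increasing_pairs_4:
  "{js. length js = 2 \<and> sorted_wrt (<) js \<and> set js \<subseteq> {..<4::nat}} =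
    {[0, 1], [0, 2], [0, 3], [1, 2], [1, 3], [2, 3]}" (is "?L = ?R")
proof
  show "?L \<subseteq> ?R"
  proof
    fix js assume "js \<in> ?L"
    then obtain i j where "js = [i, j]" "i < j" "j < 4"
      by (auto simp: length_Suc_conv numeral_2_eq_2)
    moreover from this have "j = 1 \<or> j = 2 \<or> j = 3" by auto
    ultimately show "js \<in> ?R" by (auto simp: less_Suc_eq numeral_2_eq_2 numeral_3_eq_3)
  qed
qed auto

section \<open>The symplectic Hodge operator in dimension four\<close>

lemma subspace_endos:
  assumes "subspace V"
  shows "subspace (endos V)"
  using assms unfolding subspace_def endos_def by (auto simp: algebra_simps)

context smooth_manifold
begin

text \<open>Natural numbers replace \<open>Basis\<close> as index set, to match
  \<open>indexed_basis\<close>. Evaluating a relation on the dual coordinate functions shows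
  independence, which settles the dimension of the tangent spaces.\<close>

lemma local_coordinate_basis:
  fixes p :: 'm
  obtains N and X :: "nat \<Rightarrow> 'm \<Rightarrow> 'm tangent" and x where "open N" "p \<in> N"
    "\<And>i. i < DIM('a) \<Longrightarrow> X i \<in> vector_fields A" "\<And>i. i < DIM('a) \<Longrightarrow> x i \<in> smooth_funs A"
    "\<And>q i j. q \<in> N \<Longrightarrow> i < DIM('a) \<Longrightarrow> j < DIM('a) \<Longrightarrow> X i q (x j) = of_bool (i = j)"
    "\<And>q. q \<in> N \<Longrightarrow> indexed_basis DIM('a) (tangent_space A q) (\<lambda>i. X i q)"
proof -
  obtain N and E :: "'a \<Rightarrow> 'm \<Rightarrow> 'm tangent" and x where l: "open N" "p \<in> N"
    "\<And>i. i \<in> Basis \<Longrightarrow> E i \<in> vector_fields A" "\<And>i. i \<in> Basis \<Longrightarrow> x i \<in> smooth_funs A"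
    "\<And>q i j. q \<in> N \<Longrightarrow> i \<in> Basis \<Longrightarrow> j \<in> Basis \<Longrightarrow> E i q (x j) = of_bool (i = j)"
    "\<And>q u. q \<in> N \<Longrightarrow> u \<in> tangent_space A q \<Longrightarrow> u = (\<Sum>i\<in>Basis. u (x i) *\<^sub>R E i q)"
    by (rule local_coordinates[of p]) (rule that)
  obtain h where h: "bij_betw h {..<DIM('a)} (Basis :: 'a set)"
    using ex_bij_betw_nat_finite[OF finite_Basis] by (metis atLeast0LessThan)
  have hB: "h i \<in> Basis" if "i < DIM('a)" for i using h that by (auto simp: bij_betw_def)
  have hinj: "h i = h j \<longleftrightarrow> i = j" if "i < DIM('a)" "j < DIM('a)" for i j
    using h that by (auto simp: bij_betw_def inj_on_def)
  show ?thesis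
  proof (rule that[of N "\<lambda>i. E (h i)" "\<lambda>i. x (h i)"])
    fix q assume q: "q \<in> N"
    show "indexed_basis DIM('a) (tangent_space A q) (\<lambda>i. E (h i) q)"
    proof (rule indexed_basisI)
      fix c i assume 0: "(\<Sum>i<DIM('a). c i *\<^sub>R E (h i) q) = 0" and i: "i < DIM('a)"
      have "(\<Sum>j<DIM('a). c j * E (h j) q (x (h i))) = 0"
        using fun_cong[OF 0, of "x (h i)"] by (simp add: sum_fun_apply)
      also have "(\<Sum>j<DIM('a). c j * E (h j) q (x (h i))) = (\<Sum>j<DIM('a). c j * of_bool (j = i))"
        using i by (intro sum.cong) (auto simp: l(5)[OF q hB hB] hinj)
      also have "\<dots> = c i" using i by (simp add: of_bool_def if_distrib cong: if_cong)
      finally show "c i = 0" .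
    next
      show "span ((\<lambda>i. E (h i) q) ` {..<DIM('a)}) = tangent_space A q"
      proof
        show "span ((\<lambda>i. E (h i) q) ` {..<DIM('a)}) \<subseteq> tangent_space A q"
          by (rule span_minimal[OF _ subspace_tangent_space])
            (auto intro: vector_fields_tangent l(3) hB)
        show "tangent_space A q \<subseteq> span ((\<lambda>i. E (h i) q) ` {..<DIM('a)})"
        proof
          fix u assume u: "u \<in> tangent_space A q"
          have "u = (\<Sum>i<DIM('a). u (x (h i)) *\<^sub>R E (h i) q)"
            using l(6)[OF q u] sum.reindex_bij_betw[OF h, of "\<lambda>i. u (x i) *\<^sub>R E i q"] by simp
          also have "\<dots> \<in> span ((\<lambda>i. E (h i) q) ` {..<DIM('a)})"
            by (intro span_sum span_scale span_base) auto
          finally show "u \<in> span ((\<lambda>i. E (h i) q) ` {..<DIM('a)})" .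
        qed
      qed
    qed
  qed (use l hB hinj in auto)
qed

end

section \<open>The bundle over a four-dimensional base and its chosen frames\<close>

locale symplectic_bundle_4 = smooth_bundle A "2 * m" E F
  for A :: "('m::t2_space, 'a::euclidean_space) atlas" and m
    and E :: "'m \<Rightarrow> 'v::real_vector set" and F :: "('m, 'v) frames" +
  fixes \<omega> :: "('m, real) form" and b :: "'m \<Rightarrow> 'v \<Rightarrow> 'v \<Rightarrow> real"
  assumes dim: "DIM('a) = 4"
    and omega: "almost_symplectic_form A \<omega>"
    and symp: "almost_symplectic_bundle A (2 * m) E F b"
begin

abbreviation "T \<equiv> tangent_space A"
abbreviation "\<Omega>2 \<equiv> endo_forms A (2 * m) E F 2"
abbreviation "frm \<equiv> tangent_frame A \<omega>"
abbreviation "bfrm \<equiv> bundle_frame m E b"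
abbreviation "pair \<equiv> endo_pairing m E b"

lemma half_dim: "half_dim A = 2"
  by (simp add: half_dim_def dim)

lemma omega_alternating: "alternating_on 2 (T p) UNIV (\<omega> p)"
  and omega_smooth: "X \<in> vector_fields A \<Longrightarrow> Y \<in> vector_fields A \<Longrightarrow> (\<lambda>p. \<omega> p [X p, Y p]) \<in> smooth_funs A"
proof -
  have w: "\<omega> \<in> real_forms A 2" using omega by (simp add: almost_symplectic_form_def)
  then show "alternating_on 2 (T p) UNIV (\<omega> p)" by (simp add: real_forms_def)
  assume "X \<in> vector_fields A" "Y \<in> vector_fields A"
  then show "(\<lambda>p. \<omega> p [X p, Y p]) \<in> smooth_funs A"
    using w[unfolded real_forms_def, THEN CollectD, THEN conjunct2, THEN spec, of "[X, Y]"] by simp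
qed

lemma omega_alt2: "alt2 (T p) UNIV (\<lambda>u v. \<omega> p [u, v])"
  by (rule alternating_on_pair[OF omega_alternating subspace_tangent_space])

lemma tangent_symplectic: "symplectic_space (T p) (\<lambda>u v. \<omega> p [u, v])"
proof
  have lin: "\<omega> p [c *\<^sub>R u + v, w] = c * \<omega> p [u, w] + \<omega> p [v, w]"
    if "u \<in> T p" "v \<in> T p" "w \<in> T p" for c u v w
    using omega_alt2[of p] that unfolding alt2_def real_scaleR_def by blast
  note 0 = subspace_0[OF subspace_tangent_space]
  show "subspace (T p)" by (rule subspace_tangent_space)
  show "\<omega> p [x, y] = - \<omega> p [y, x]" if "x \<in> T p" "y \<in> T p" for x y
    using omega_alt2[of p] that unfolding alt2_def by blast
  show "\<omega> p [x + y, z] = \<omega> p [x, z] + \<omega> p [y, z]" if "x \<in> T p" "y \<in> T p" "z \<in> T p" for x y z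
    using lin[OF that, of 1] by simp
  show "\<omega> p [c *\<^sub>R x, y] = c * \<omega> p [x, y]" if "x \<in> T p" "y \<in> T p" for x y c
    using lin[OF that(1) 0 that(2), of c] lin[OF 0 0 that(2), of 1] by simp
  show "x = 0" if "x \<in> T p" "\<And>y. y \<in> T p \<Longrightarrow> \<omega> p [x, y] = 0" for x
    using omega that unfolding almost_symplectic_form_def by blast
qed

lemma fibre_symplectic: "symplectic_space (E p) (b p)"
proof
  note s = symp[unfolded almost_symplectic_bundle_def]
  show "b p (x + y) z = b p x z + b p y z" if "x \<in> E p" "y \<in> E p" "z \<in> E p" for x y z
    using s[THEN conjunct1] that by blast
  show "b p (c *\<^sub>R x) y = c * b p x y" if "x \<in> E p" "y \<in> E p" for x y c
    using s[THEN conjunct2, THEN conjunct1] that by blast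
  show "b p x y = - b p y x" if "x \<in> E p" "y \<in> E p" for x y
    using s[THEN conjunct2, THEN conjunct2, THEN conjunct1] that by blast
  show "x = 0" if "x \<in> E p" "\<And>y. y \<in> E p \<Longrightarrow> b p x y = 0" for x
    using s[THEN conjunct2, THEN conjunct2, THEN conjunct2, THEN conjunct1] that by blast
qed (rule subspace_fibre)

lemma b_smooth: "\<xi> \<in> secs \<Longrightarrow> \<eta> \<in> secs \<Longrightarrow> (\<lambda>p. b p (\<xi> p) (\<eta> p)) \<in> smooth_funs A"
  using symp unfolding almost_symplectic_bundle_def by blast

text \<open>This justifies the choice in \<open>tangent_frame\<close>: the coordinate fields show
  that the tangent space has dimension 4, and its symplectic form then has a symplectic
  basis.\<close>

lemma frm_basis: "symplectic_basis 2 (T p) (\<lambda>u v. \<omega> p [u, v]) (frm p)"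
proof -
  obtain N and X :: "nat \<Rightarrow> 'm \<Rightarrow> 'm tangent" where "p \<in> N"
    "\<And>q. q \<in> N \<Longrightarrow> indexed_basis DIM('a) (T q) (\<lambda>i. X i q)"
    by (rule local_coordinate_basis[of p]) (rule that)
  then have "indexed_basis (2 * 2) (T p) (\<lambda>i. X i p)" by (simp add: dim)
  from symplectic_basis_exists[OF tangent_symplectic this] show ?thesis
    unfolding tangent_frame_def half_dim by (rule someI_ex)
qed

lemma bfrm_basis: "symplectic_basis m (E p) (b p) (bfrm p)"
proof -
  obtain U s where "(U, s) \<in> F" "p \<in> U" by (rule frame_at)
  from symplectic_basis_exists[OF fibre_symplectic frame_basis[OF this]] show ?thesis
    unfolding bundle_frame_def by (rule someI_ex)
qed

lemma frm_indexed: "indexed_basis 4 (T p) (frm p)"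
  using frm_basis[of p] by (simp add: symplectic_basis_def)

lemma frm_in: "i < 4 \<Longrightarrow> frm p i \<in> T p"
  by (rule indexed_basis_in[OF frm_indexed])

lemma frm_omega:
  "\<omega> p [frm p 0, frm p 1] = 0" "\<omega> p [frm p 0, frm p 2] = 1" "\<omega> p [frm p 0, frm p 3] = 0"
  "\<omega> p [frm p 1, frm p 2] = 0" "\<omega> p [frm p 1, frm p 3] = 1" "\<omega> p [frm p 2, frm p 3] = 0"
proof -
  have r: "\<And>i j. i < 2 \<Longrightarrow> j < 2 \<Longrightarrow> \<omega> p [frm p i, frm p j] = 0 \<and>
      \<omega> p [frm p (2 + i), frm p (2 + j)] = 0 \<and> \<omega> p [frm p i, frm p (2 + j)] = of_bool (i = j)"
    using frm_basis[of p] unfolding symplectic_basis_def by blast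
  show "\<omega> p [frm p 0, frm p 1] = 0" "\<omega> p [frm p 0, frm p 2] = 1" "\<omega> p [frm p 0, frm p 3] = 0"
    "\<omega> p [frm p 1, frm p 2] = 0" "\<omega> p [frm p 1, frm p 3] = 1" "\<omega> p [frm p 2, frm p 3] = 0"
    using r[of 0 1] r[of 0 0] r[of 1 0] r[of 1 1] by simp_all
qed

lemma bfrm_in: "i < 2 * m \<Longrightarrow> bfrm p i \<in> E p"
  using bfrm_basis[of p] indexed_basis_in by (auto simp: symplectic_basis_def)

lemma frame_J_in: "i < 2 * m \<Longrightarrow> frame_J m (bfrm p) i \<in> E p"
  using bfrm_in subspace_neg[OF subspace_fibre] by (auto simp: frame_J_def)

lemma endo_apply: "K \<in> endos (E p) \<Longrightarrow> x \<in> E p \<Longrightarrow> K x \<in> E p"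
  by (simp add: endos_def)

lemma pairing_bilinear: "bilinear_on (endos (E p)) (endos (E p)) (pair p)"
proof -
  interpret symplectic_space "E p" "b p" by (rule fibre_symplectic)
  note in_E = endo_apply bfrm_in frame_J_in subspace_scale[OF subspace_fibre]
  show ?thesis
    unfolding bilinear_on_def endo_pairing_def Let_def
    by (auto simp: subspace_endos[OF subspace_fibre] add_left scale_left add_right scale_right in_E
        sum.distrib sum_distrib_left)
qed

lemma form_alternating: "\<alpha> \<in> \<Omega>2 \<Longrightarrow> alternating_on 2 (T p) (endos (E p)) (\<alpha> p)"
  by (simp add: endo_forms_def)

lemma form_section:
  "\<alpha> \<in> \<Omega>2 \<Longrightarrow> X \<in> vector_fields A \<Longrightarrow> Y \<in> vector_fields A \<Longrightarrow> \<xi> \<in> secs \<Longrightarrow>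
    (\<lambda>p. \<alpha> p [X p, Y p] (\<xi> p)) \<in> secs"
  unfolding endo_forms_def by (elim CollectE conjE allE[of _ "[X, Y]"]) simp

lemma form_alt2: "\<alpha> \<in> \<Omega>2 \<Longrightarrow> alt2 (T p) (endos (E p)) (\<lambda>u v. \<alpha> p [u, v])"
  by (intro alternating_on_pair form_alternating subspace_tangent_space)

lemma form_in: "\<alpha> \<in> \<Omega>2 \<Longrightarrow> u \<in> T p \<Longrightarrow> v \<in> T p \<Longrightarrow> \<alpha> p [u, v] \<in> endos (E p)"
  using form_alt2 unfolding alt2_def by blast

lemma form_eqI:
  assumes "\<alpha> \<in> \<Omega>2" "\<gamma> \<in> \<Omega>2" "\<And>p u v. u \<in> T p \<Longrightarrow> v \<in> T p \<Longrightarrow> \<alpha> p [u, v] = \<gamma> p [u, v]"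
  shows "\<alpha> = \<gamma>"
proof (intro ext)
  fix p vs x
  show "\<alpha> p vs x = \<gamma> p vs x"
  proof (cases "length vs = 2 \<and> set vs \<subseteq> T p")
    case True
    then obtain u v where "vs = [u, v]" "u \<in> T p" "v \<in> T p"
      by (auto simp: length_Suc_conv numeral_2_eq_2)
    then show ?thesis using assms(3) by simp
  next
    case False
    show ?thesis
      unfolding alternating_on_invalid[OF form_alternating[OF assms(1)] False]
        alternating_on_invalid[OF form_alternating[OF assms(2)] False] ..
  qed
qed

section \<open>Contraction with omega and its smoothness\<close>

definition contraction :: "('m, 'v \<Rightarrow> 'v) form \<Rightarrow> 'm \<Rightarrow> 'v \<Rightarrow> 'v" where
  "contraction \<alpha> p = (\<Sum>i<2. \<alpha> p [frm p i, frame_J 2 (frm p) i])"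

lemma contraction_eq: "contraction \<alpha> p = \<alpha> p [frm p 0, frm p 2] + \<alpha> p [frm p 1, frm p 3]"
  by (simp add: contraction_def frame_J_def numeral_2_eq_2 numeral_3_eq_3)

lemma contraction_endo: "\<alpha> \<in> \<Omega>2 \<Longrightarrow> contraction \<alpha> p \<in> endos (E p)"
  unfolding contraction_eq
  by (intro subspace_add[OF subspace_endos[OF subspace_fibre]] form_in frm_in) simp_all

lemma scale_bilinear: "bilinear_on (endos (E p)) UNIV (\<lambda>K t. t *\<^sub>R K)"
  unfolding bilinear_on_def by (simp add: subspace_endos[OF subspace_fibre] algebra_simps)

lemma mult_bilinear: "bilinear_on UNIV UNIV ((*) :: real \<Rightarrow> real \<Rightarrow> real)"
  unfolding bilinear_on_def by (simp add: algebra_simps)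

text \<open>Twice the Pfaffian of the matrix of \<open>\<omega>\<close> on four tangent vectors.\<close>

abbreviation "omega_squared p \<equiv> wedge22 (*) (\<lambda>u v. \<omega> p [u, v]) (\<lambda>u v. \<omega> p [u, v])"

lemma omega_squared_alt4: "alt4 (T p) (omega_squared p)"
  by (rule alt4_wedge22[OF omega_alt2 omega_alt2 mult_bilinear])

text \<open>The sign is that of the order e_0, e_1, Je_0, Je_1: the only nonzero shuffles pair 0
  with 2 and 1 with 3, and these carry the sign -1.\<close>

lemma omega_squared_frm: "omega_squared p (frm p 0) (frm p 1) (frm p 2) (frm p 3) = - 2"
  unfolding wedge22_def frm_omega by simp

text \<open>Both sides are alternating 4-forms with endomorphism values, and on the chosen frame
  both equal minus the contraction. The left side does not mention the frame, so this determines the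
  contraction by smooth data.\<close>

lemma wedge_omega:
  assumes "\<alpha> \<in> \<Omega>2" "x \<in> T p" "y \<in> T p" "z \<in> T p" "w \<in> T p"
  shows "wedge22 (\<lambda>K t. t *\<^sub>R K) (\<lambda>u v. \<alpha> p [u, v]) (\<lambda>u v. \<omega> p [u, v]) x y z w =
    omega_squared p x y z w *\<^sub>R ((1 / 2) *\<^sub>R contraction \<alpha> p)"
proof -
  let ?G = "wedge22 (\<lambda>K t. t *\<^sub>R K) (\<lambda>u v. \<alpha> p [u, v]) (\<lambda>u v. \<omega> p [u, v])"
  let ?H = "\<lambda>x y z w. omega_squared p x y z w *\<^sub>R ((1 / 2) *\<^sub>R contraction \<alpha> p)"
  have "alt4 (T p) (\<lambda>x y z w. ?G x y z w - ?H x y z w)"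
    by (intro alt4_diff alt4_scale alt4_wedge22[OF form_alt2[OF assms(1)] omega_alt2 scale_bilinear]
        omega_squared_alt4)
  moreover have "?G (frm p 0) (frm p 1) (frm p 2) (frm p 3) - ?H (frm p 0) (frm p 1) (frm p 2) (frm p 3) = 0"
    unfolding omega_squared_frm unfolding wedge22_def frm_omega contraction_eq by simp
  ultimately have "?G x y z w - ?H x y z w = 0"
    by (rule alt4_zero[OF frm_indexed]) fact+
  then show ?thesis by simp
qed

text \<open>The frame in \<open>contraction\<close> is chosen at each point without any continuity.
  Evaluated on smooth coordinate fields, \<open>wedge_omega\<close> expresses g/2 times the
  contraction by smooth data, and g can be inverted near p.\<close>

lemma contraction_section:
  assumes \<alpha>: "\<alpha> \<in> \<Omega>2" and \<xi>: "\<xi> \<in> secs"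
  shows "(\<lambda>p. contraction \<alpha> p (\<xi> p)) \<in> secs"
proof (rule section_local)
  fix p
  obtain N and X :: "nat \<Rightarrow> 'm \<Rightarrow> 'm tangent" where l: "open N" "p \<in> N"
    "\<And>i. i < DIM('a) \<Longrightarrow> X i \<in> vector_fields A"
    "\<And>q. q \<in> N \<Longrightarrow> indexed_basis DIM('a) (T q) (\<lambda>i. X i q)"
    by (rule local_coordinate_basis[of p]) (rule that)
  have XV: "X i \<in> vector_fields A" if "i < 4" for i using l(3) that dim by simp
  have XT: "X i q \<in> T q" if "i < 4" for i q using vector_fields_tangent[OF XV[OF that]] .
  define g where "g q = omega_squared q (X 0 q) (X 1 q) (X 2 q) (X 3 q)" for q
  have g: "g \<in> smooth_funs A"
    unfolding g_def wedge22_def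
    by (intro smooth_funs_add smooth_funs_diff smooth_funs_mult omega_smooth XV) simp_all
  \<comment> \<open>If the square of omega vanished on the basis \<open>X\<close>, it would vanish
    on the symplectic frame as well, where its value is -2.\<close>
  have "g p \<noteq> 0"
  proof
    assume "g p = 0"
    then have 0: "omega_squared p (X 0 p) (X 1 p) (X 2 p) (X 3 p) = 0" by (simp only: g_def)
    have "indexed_basis 4 (T p) (\<lambda>i. X i p)" using l(4)[OF l(2)] by (simp add: dim)
    from alt4_zero[where G = "omega_squared p", OF this omega_squared_alt4 0]
    have "omega_squared p (frm p 0) (frm p 1) (frm p 2) (frm p 3) = 0" by (simp add: frm_in)
    then show False unfolding omega_squared_frm by simp
  qed
  then obtain h M where h: "h \<in> smooth_funs A" "open M" "p \<in> M"
    "\<And>q. q \<in> M \<Longrightarrow> g q \<noteq> 0 \<and> h q = inverse (g q)"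
    by (rule smooth_inverse_near[OF g]) (rule that)
  \<comment> \<open>The factor 2h undoes the factor g/2, h being the inverse of g near p.\<close>
  define \<eta> where "\<eta> q = (2 * h q) *\<^sub>R wedge22 (\<lambda>K t. t *\<^sub>R K) (\<lambda>u v. \<alpha> q [u, v]) (\<lambda>u v. \<omega> q [u, v])
      (X 0 q) (X 1 q) (X 2 q) (X 3 q) (\<xi> q)" for q
  have summand: "(\<lambda>q. \<omega> q [X i q, X j q] *\<^sub>R \<alpha> q [X k q, X l q] (\<xi> q)) \<in> secs"
    if "i < 4" "j < 4" "k < 4" "l < 4" for i j k l
    using that by (intro section_scale[OF omega_smooth form_section] \<alpha> \<xi> XV)
  have h2: "(\<lambda>q. 2 * h q) \<in> smooth_funs A" by (intro smooth_funs_mult smooth_funs_const h)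
  have "(\<lambda>q. wedge22 (\<lambda>K t. t *\<^sub>R K) (\<lambda>u v. \<alpha> q [u, v]) (\<lambda>u v. \<omega> q [u, v])
      (X 0 q) (X 1 q) (X 2 q) (X 3 q) (\<xi> q)) \<in> secs"
    unfolding wedge22_def plus_fun_apply minus_apply scaleR_fun_apply
    by (intro section_add[unfolded plus_fun_def] section_diff summand) simp_all
  then have "\<eta> \<in> secs" unfolding \<eta>_def by (rule section_scale[OF h2])
  moreover have "contraction \<alpha> q (\<xi> q) = \<eta> q" if "q \<in> M" for q
  proof -
    have "wedge22 (\<lambda>K t. t *\<^sub>R K) (\<lambda>u v. \<alpha> q [u, v]) (\<lambda>u v. \<omega> q [u, v]) (X 0 q) (X 1 q) (X 2 q) (X 3 q)
        = g q *\<^sub>R ((1 / 2) *\<^sub>R contraction \<alpha> q)"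
      unfolding g_def by (rule wedge_omega[OF \<alpha>]) (simp_all add: XT)
    then show ?thesis using h(4)[OF that] by (simp add: \<eta>_def)
  qed
  ultimately show "\<exists>N \<eta>. open N \<and> p \<in> N \<and> \<eta> \<in> secs \<and> (\<forall>q\<in>N. contraction \<alpha> q (\<xi> q) = \<eta> q)"
    using h by blast
qed

section \<open>The candidate for the Hodge operator\<close>

definition star :: "('m, 'v \<Rightarrow> 'v) form \<Rightarrow> ('m, 'v \<Rightarrow> 'v) form" where
  "star \<alpha> = tensor_form (contraction \<alpha>) \<omega> - \<alpha>"

lemma star_apply: "star \<alpha> p vs = \<omega> p vs *\<^sub>R contraction \<alpha> p - \<alpha> p vs"
  by (simp add: star_def tensor_form_def)

text \<open>The clause with analytic content is smoothness, where \<open>contraction_section\<close>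
  enters; the algebraic clauses are inherited from omega and \<alpha>.\<close>

lemma star_in:
  assumes \<alpha>: "\<alpha> \<in> \<Omega>2"
  shows "star \<alpha> \<in> \<Omega>2"
  unfolding endo_forms_def
proof (intro CollectI conjI allI impI ballI)
  fix p
  note S = subspace_endos[OF subspace_fibre[of p]]
  show "alternating_on 2 (T p) (endos (E p)) (star \<alpha> p)"
    unfolding alternating_on_def
  proof (intro conjI allI impI)
    fix vs assume vs: "length vs = 2 \<and> set vs \<subseteq> T p"
    then have "\<alpha> p vs \<in> endos (E p)"
      using form_alternating[OF \<alpha>] unfolding alternating_on_def by blast
    then show "star \<alpha> p vs \<in> endos (E p)"
      unfolding star_apply by (intro subspace_diff[OF S] subspace_scale[OF S] contraction_endo[OF \<alpha>])
  next
    fix vs assume vs: "\<not> (length vs = 2 \<and> set vs \<subseteq> T p)"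
    show "star \<alpha> p vs = 0"
      unfolding star_apply alternating_on_invalid[OF omega_alternating vs]
        alternating_on_invalid[OF form_alternating[OF \<alpha>] vs] by simp
  next
    fix vs u v and i :: nat and c :: real
    assume vs: "length vs = 2 \<and> set vs \<subseteq> T p \<and> i < 2 \<and> u \<in> T p \<and> v \<in> T p"
    show "star \<alpha> p (vs[i := c *\<^sub>R u + v]) = c *\<^sub>R star \<alpha> p (vs[i := u]) + star \<alpha> p (vs[i := v])"
      unfolding star_apply alternating_on_linear[OF form_alternating[OF \<alpha>] vs]
        alternating_on_linear[OF omega_alternating vs]
      by (simp add: algebra_simps)
  next
    fix vs and i j :: nat assume vs: "length vs = 2 \<and> set vs \<subseteq> T p \<and> i < j \<and> j < 2 \<and> vs ! i = vs ! j"
    show "star \<alpha> p vs = 0"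
      unfolding star_apply alternating_on_repeat[OF form_alternating[OF \<alpha>] vs]
        alternating_on_repeat[OF omega_alternating vs] by simp
  qed
next
  fix Xs \<xi> assume Xs: "length Xs = 2 \<and> set Xs \<subseteq> vector_fields A" and \<xi>: "\<xi> \<in> secs"
  then obtain X Y where X: "Xs = [X, Y]" "X \<in> vector_fields A" "Y \<in> vector_fields A"
    by (auto simp: length_Suc_conv numeral_2_eq_2)
  show "(\<lambda>p. star \<alpha> p (map (\<lambda>X. X p) Xs) (\<xi> p)) \<in> secs"
    using section_diff[OF section_scale[OF omega_smooth[OF X(2,3)] contraction_section[OF \<alpha> \<xi>]]
        form_section[OF \<alpha> X(2,3) \<xi>]]
    by (simp add: X(1) star_apply)
qed

text \<open>The contraction of omega is 2, so that of \<open>star \<alpha>\<close> is 2 tr \<alpha>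
  - tr \<alpha>. It follows that \<open>star\<close> is an involution.\<close>

lemma contraction_star: "contraction (star \<alpha>) p = contraction \<alpha> p"
  unfolding contraction_eq star_apply frm_omega by (simp add: algebra_simps)

lemma star_star: "star (star \<alpha>) = \<alpha>"
  by (intro ext) (simp add: star_apply contraction_star)

lemma star_add: "star (\<alpha> + \<gamma>) = star \<alpha> + star \<gamma>"
  by (intro ext) (simp add: star_apply contraction_eq algebra_simps)

lemma star_scale: "star (\<lambda>p. f p *\<^sub>R \<alpha> p) = (\<lambda>p. f p *\<^sub>R star \<alpha> p)"
  by (intro ext) (simp add: star_apply contraction_eq algebra_simps)

section \<open>The defining identity of the Hodge operator\<close>

lemma omega_swap: "\<omega> p [v, u] = - \<omega> p [u, v]"
  by (rule alternating_on_swap[OF omega_alternating subspace_tangent_space])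

text \<open>Wedging with the 0-form 1 antisymmetrises a form that is already skew: two equal terms
  arise and are divided by 2! 0!.\<close>

lemma wedge_power_1: "wedge_power \<omega> 1 = \<omega>"
proof (intro ext)
  fix p vs
  show "wedge_power \<omega> 1 p vs = \<omega> p vs"
  proof (cases "length vs = 2")
    case True
    then obtain u v where vs: "vs = [u, v]" by (auto simp: length_Suc_conv numeral_2_eq_2)
    have upt: "[0..<2] = [0, 1::nat]" by (simp add: upt_rec)
    have "wedge_power \<omega> 1 p vs =
        (\<Sum>\<sigma> | \<sigma> permutes {..<2}. of_int (sign \<sigma>) * \<omega> p [vs ! \<sigma> 0, vs ! \<sigma> 1]) / 2"
      using True by (simp add: wedge_def wedge_with_def upt)
    also have "\<dots> = (\<omega> p [u, v] - \<omega> p [v, u]) / 2"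
      by (subst sum_permutes_2[of "\<lambda>i j. \<omega> p [vs ! i, vs ! j]"]) (simp add: vs)
    finally show ?thesis using omega_swap[of p v u] by (simp add: vs)
  next
    case False
    then show ?thesis
      using alternating_on_invalid[OF omega_alternating] by (simp add: wedge_def wedge_with_def)
  qed
qed

lemma divided_power_2:
  "divided_power \<omega> 2 p vs =
    (if length vs = 4 then omega_squared p (vs ! 0) (vs ! 1) (vs ! 2) (vs ! 3) / 2 else 0)"
proof -
  have "wedge_power \<omega> 2 = wedge_with (\<lambda>_. (*)) 2 2 \<omega> \<omega>"
    using wedge_power_1 by (simp add: numeral_2_eq_2 wedge_def)
  moreover have "wedge_with (\<lambda>_. (*)) 2 2 \<omega> \<omega> p vs = omega_squared p (vs ! 0) (vs ! 1) (vs ! 2) (vs ! 3)"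
    if "length vs = 4"
    using that
  proof (rule wedge_with_2_2, intro conjI)
    fix i j k l
    show "\<omega> p [vs ! j, vs ! i] * \<omega> p [vs ! k, vs ! l] = - (\<omega> p [vs ! i, vs ! j] * \<omega> p [vs ! k, vs ! l])"
      using omega_swap[of p "vs ! j" "vs ! i"] by simp
    show "\<omega> p [vs ! i, vs ! j] * \<omega> p [vs ! l, vs ! k] = - (\<omega> p [vs ! i, vs ! j] * \<omega> p [vs ! k, vs ! l])"
      using omega_swap[of p "vs ! l" "vs ! k"] by simp
  qed
  ultimately show ?thesis
    by (simp add: divided_power_def wedge_with_def)
qed

lemma form_swap_all: "\<alpha> \<in> \<Omega>2 \<Longrightarrow> \<alpha> p [v, u] = - \<alpha> p [u, v]"
  by (rule alternating_on_swap[OF form_alternating subspace_tangent_space])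

lemma zero_endo: "0 \<in> endos (E p)"
  by (rule subspace_0[OF subspace_endos[OF subspace_fibre]])

lemma form_invalid: "\<alpha> \<in> \<Omega>2 \<Longrightarrow> \<not> (u \<in> T p \<and> v \<in> T p) \<Longrightarrow> \<alpha> p [u, v] = 0"
  by (rule alternating_on_invalid[OF form_alternating]) auto

lemma form_in_all: "\<alpha> \<in> \<Omega>2 \<Longrightarrow> \<alpha> p [u, v] \<in> endos (E p)"
  using form_in form_invalid zero_endo by metis

lemma pairing_minus:
  assumes "K \<in> endos (E p)" "L \<in> endos (E p)"
  shows "pair p (- K) L = - pair p K L" "pair p K (- L) = - pair p K L"
  using bilinear_on_minus[OF pairing_bilinear assms] .

lemma pairing_zero:
  assumes "K \<in> endos (E p)"
  shows "pair p 0 K = 0" "pair p K 0 = 0"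
  using pairing_minus[OF zero_endo assms] pairing_minus[OF assms zero_endo] by simp_all

text \<open>The formula includes lists with vectors outside the tangent space, where the forms
  vanish and skewness is trivial. Such totality lets forms be compared as functions.\<close>

lemma pairing_wedge_2_2:
  assumes \<alpha>: "\<alpha> \<in> \<Omega>2" and \<gamma>: "\<gamma> \<in> \<Omega>2"
  shows "pairing_wedge m E b 2 2 \<alpha> \<gamma> p vs =
    (if length vs = 4 then wedge22 (pair p) (\<lambda>u v. \<alpha> p [u, v]) (\<lambda>u v. \<gamma> p [u, v])
      (vs ! 0) (vs ! 1) (vs ! 2) (vs ! 3) else 0)"
proof (cases "length vs = 4")
  case True
  have "wedge_with pair 2 2 \<alpha> \<gamma> p vs = wedge22 (pair p) (\<lambda>u v. \<alpha> p [u, v]) (\<lambda>u v. \<gamma> p [u, v])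
      (vs ! 0) (vs ! 1) (vs ! 2) (vs ! 3)"
    using True
  proof (rule wedge_with_2_2, intro conjI)
    fix i j k l
    note in_E = form_in_all[OF \<alpha>] form_in_all[OF \<gamma>]
    show "pair p (\<alpha> p [vs ! j, vs ! i]) (\<gamma> p [vs ! k, vs ! l]) = - pair p (\<alpha> p [vs ! i, vs ! j]) (\<gamma> p [vs ! k, vs ! l])"
      unfolding form_swap_all[OF \<alpha>, of p "vs ! j" "vs ! i"] by (rule pairing_minus[OF in_E])
    show "pair p (\<alpha> p [vs ! i, vs ! j]) (\<gamma> p [vs ! l, vs ! k]) = - pair p (\<alpha> p [vs ! i, vs ! j]) (\<gamma> p [vs ! k, vs ! l])"
      unfolding form_swap_all[OF \<gamma>, of p "vs ! l" "vs ! k"] by (rule pairing_minus[OF in_E])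
  qed
  with True show ?thesis by (simp add: pairing_wedge_def)
qed (simp add: pairing_wedge_def wedge_with_def)

lemma form_pairing_frm:
  assumes "\<gamma> \<in> \<Omega>2"
  shows "form_pairing A \<omega> m E b 2 \<alpha> \<gamma> p =
    pair p (\<alpha> p [frm p 0, frm p 1]) (\<gamma> p [frm p 2, frm p 3]) + pair p (\<alpha> p [frm p 0, frm p 2]) (\<gamma> p [frm p 0, frm p 2]) +
    pair p (\<alpha> p [frm p 0, frm p 3]) (\<gamma> p [frm p 1, frm p 2]) + pair p (\<alpha> p [frm p 1, frm p 2]) (\<gamma> p [frm p 0, frm p 3]) +
    pair p (\<alpha> p [frm p 1, frm p 3]) (\<gamma> p [frm p 1, frm p 3]) + pair p (\<alpha> p [frm p 2, frm p 3]) (\<gamma> p [frm p 0, frm p 1])"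
proof -
  have J: "frame_J 2 (frm p) 0 = frm p 2" "frame_J 2 (frm p) 1 = frm p 3"
    "frame_J 2 (frm p) 2 = - frm p 0" "frame_J 2 (frm p) 3 = - frm p 1"
    by (simp_all add: frame_J_def)
  have neg: "- frm p i \<in> T p" if "i < 4" for i
    using subspace_neg[OF subspace_tangent_space frm_in[OF that]] .
  note minus = alternating_on_minus[OF form_alternating[OF assms] subspace_tangent_space]
  \<comment> \<open>The sign from J e_(2+i) = - e_i and the sign from reordering the arguments
    cancel. This is why no signs remain in the formula.\<close>
  have flip: "\<gamma> p [frm p j, - frm p i] = \<gamma> p [frm p i, frm p j]" if "i < 4" "j < 4" for i j
    using minus(2)[OF frm_in[OF that(2)] frm_in[OF that(1)]]
      form_swap_all[OF assms, of p "frm p j" "frm p i"] by simp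
  have flip2: "\<gamma> p [- frm p 0, - frm p 1] = \<gamma> p [frm p 0, frm p 1]"
    using minus(1)[OF frm_in neg, of 0 1] minus(2)[OF frm_in frm_in, of 0 1] by simp
  have fl: "\<gamma> p [frm p 2, - frm p 0] = \<gamma> p [frm p 0, frm p 2]" "\<gamma> p [frm p 2, - frm p 1] = \<gamma> p [frm p 1, frm p 2]"
    "\<gamma> p [frm p 3, - frm p 0] = \<gamma> p [frm p 0, frm p 3]" "\<gamma> p [frm p 3, - frm p 1] = \<gamma> p [frm p 1, frm p 3]"
    by (rule flip; simp)+
  have four: "2 * 2 = (4::nat)" by simp
  show ?thesis
    unfolding form_pairing_def Let_def half_dim four increasing_pairs_4
    by (simp del: One_nat_def add: J fl flip2)
qed

text \<open>On the frame the operator exchanges the values on the two symplectic pairs and negates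
  the other four.\<close>

lemma star_frm:
  "star \<gamma> p [frm p 0, frm p 1] = - \<gamma> p [frm p 0, frm p 1]" "star \<gamma> p [frm p 0, frm p 2] = \<gamma> p [frm p 1, frm p 3]"
  "star \<gamma> p [frm p 0, frm p 3] = - \<gamma> p [frm p 0, frm p 3]" "star \<gamma> p [frm p 1, frm p 2] = - \<gamma> p [frm p 1, frm p 2]"
  "star \<gamma> p [frm p 1, frm p 3] = \<gamma> p [frm p 0, frm p 2]" "star \<gamma> p [frm p 2, frm p 3] = - \<gamma> p [frm p 2, frm p 3]"
  unfolding star_apply frm_omega contraction_eq by simp_all

text \<open>Both sides are alternating 4-forms, so they are compared on the chosen frame. There half
  the square of omega is -1, and the six terms of the pairing match the six shuffles through
  \<open>star_frm\<close>.\<close>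

lemma star_pairing:
  assumes \<alpha>: "\<alpha> \<in> \<Omega>2" and \<gamma>: "\<gamma> \<in> \<Omega>2"
  shows "(\<lambda>p. form_pairing A \<omega> m E b 2 \<alpha> \<gamma> p *\<^sub>R divided_power \<omega> 2 p) = pairing_wedge m E b 2 2 \<alpha> (star \<gamma>)"
proof (intro ext)
  fix p vs
  let ?c = "form_pairing A \<omega> m E b 2 \<alpha> \<gamma> p"
  let ?W = "wedge22 (pair p) (\<lambda>u v. \<alpha> p [u, v]) (\<lambda>u v. star \<gamma> p [u, v])"
  note s = star_in[OF \<gamma>]
  have eq: "omega_squared p x y z w *\<^sub>R (?c / 2) = ?W x y z w" for x y z w
  proof (cases "x \<in> T p \<and> y \<in> T p \<and> z \<in> T p \<and> w \<in> T p")
    case True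
    have alt: "alt4 (T p) (\<lambda>x y z w. omega_squared p x y z w *\<^sub>R (?c / 2) - ?W x y z w)"
      by (intro alt4_diff alt4_scale omega_squared_alt4
          alt4_wedge22[OF form_alt2[OF \<alpha>] form_alt2[OF s] pairing_bilinear])
    have frm: "omega_squared p (frm p 0) (frm p 1) (frm p 2) (frm p 3) *\<^sub>R (?c / 2) -
        ?W (frm p 0) (frm p 1) (frm p 2) (frm p 3) = 0"
      unfolding omega_squared_frm form_pairing_frm[OF \<gamma>]
      unfolding wedge22_def star_frm pairing_minus[OF form_in_all[OF \<alpha>] form_in_all[OF \<gamma>]] by simp
    have "omega_squared p x y z w *\<^sub>R (?c / 2) - ?W x y z w = 0"
      using alt4_zero[where G = "\<lambda>x y z w. omega_squared p x y z w *\<^sub>R (?c / 2) - ?W x y z w",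
          OF frm_indexed alt frm] True by blast
    then show ?thesis by simp
  next
    case False
    \<comment> \<open>If some argument is not tangent, every product of two values has a zero
      factor, so both sides are 0.\<close>
    have "\<omega> p [u, v] = 0" if "\<not> (u \<in> T p \<and> v \<in> T p)" for u v
      using that by (intro alternating_on_invalid[OF omega_alternating]) auto
    then have z1: "\<omega> p [u, v] * \<omega> p [u', v'] = 0"
      if "\<not> (u \<in> T p \<and> v \<in> T p \<and> u' \<in> T p \<and> v' \<in> T p)" for u v u' v' using that by auto
    have "omega_squared p x y z w = 0"
      unfolding wedge22_def by (subst z1, use False in blast)+ simp
    moreover have z2: "pair p (\<alpha> p [u, v]) (star \<gamma> p [u', v']) = 0"
      if "\<not> (u \<in> T p \<and> v \<in> T p \<and> u' \<in> T p \<and> v' \<in> T p)" for u v u' v'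
      using that form_invalid[OF \<alpha>, of u p v] form_invalid[OF s, of u' p v']
        pairing_zero[OF form_in_all[OF \<alpha>]] pairing_zero[OF form_in_all[OF s]] by auto
    have "?W x y z w = 0"
      unfolding wedge22_def by (subst z2, use False in blast)+ simp
    ultimately show ?thesis by simp
  qed
  show "(?c *\<^sub>R divided_power \<omega> 2 p) vs = pairing_wedge m E b 2 2 \<alpha> (star \<gamma>) p vs"
    unfolding pairing_wedge_2_2[OF \<alpha> s] scaleR_fun_apply divided_power_2
    using eq[of "vs ! 0" "vs ! 1" "vs ! 2" "vs ! 3"] by (simp add: mult.commute)
qed

section \<open>Test forms and nondegeneracy of the wedge pairing\<close>

definition rank_one :: "('m \<Rightarrow> 'v) \<Rightarrow> ('m \<Rightarrow> 'v) \<Rightarrow> 'm \<Rightarrow> 'v \<Rightarrow> 'v" where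
  "rank_one \<eta> \<xi> p x = (if x \<in> E p then b p (\<eta> p) x *\<^sub>R \<xi> p else 0)"

lemma rank_one_endo:
  assumes "\<eta> \<in> secs" "\<xi> \<in> secs"
  shows "rank_one \<eta> \<xi> p \<in> endos (E p)"
proof -
  interpret symplectic_space "E p" "b p" by (rule fibre_symplectic)
  show ?thesis
    using section_in[OF assms(1), of p] section_in[OF assms(2), of p]
    by (auto simp: endos_def rank_one_def subspace_scale[OF subspace] subspace_add[OF subspace]
        add_right scale_right scaleR_add_left)
qed

text \<open>In the sum over the bundle frame, the coefficients b(\<eta>, f_i) meet L(J' f_i). By
  linearity of L and \<open>frame_J_expansion\<close> they add up to L(-\<eta>), which is the origin
  of the minus sign.\<close>

lemma pairing_rank_one:
  assumes \<eta>: "\<eta> \<in> secs" and \<xi>: "\<xi> \<in> secs" and L: "L \<in> endos (E p)"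
  shows "pair p (rank_one \<eta> \<xi> p) L = - b p (\<xi> p) (L (\<eta> p))"
proof -
  interpret symplectic_space "E p" "b p" by (rule fibre_symplectic)
  note in_E = section_in[OF \<eta>, of p] section_in[OF \<xi>, of p]
  let ?f = "bfrm p" and ?J = "frame_J m (bfrm p)"
  have LJ: "L (?J i) \<in> E p" if "i < 2 * m" for i by (rule endo_apply[OF L frame_J_in[OF that]])
  have Llin: "L (\<Sum>i\<in>I. c i *\<^sub>R ?J i) = (\<Sum>i\<in>I. c i *\<^sub>R L (?J i))" if "I \<subseteq> {..<2 * m}" for I c
    using that
  proof (induction I rule: infinite_finite_induct)
    case (insert i I)
    have "(\<Sum>i\<in>I. c i *\<^sub>R ?J i) \<in> E p" "?J i \<in> E p"
      using insert.prems frame_J_in by (auto intro!: subspace_sum[OF subspace] subspace_scale[OF subspace])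
    then show ?case
      using insert L by (simp add: endos_def subspace_scale[OF subspace])
  next
    case empty
    have "L (0 *\<^sub>R 0) = 0 *\<^sub>R L 0" using L subspace_0[OF subspace] unfolding endos_def by blast
    then show ?case by simp
  qed (auto dest: finite_subset)
  have "pair p (rank_one \<eta> \<xi> p) L = (\<Sum>i<2 * m. b p (\<eta> p) (?f i) * b p (\<xi> p) (L (?J i)))"
    unfolding endo_pairing_def Let_def
    by (rule sum.cong) (auto simp: rank_one_def bfrm_in LJ scale_left in_E)
  also have "\<dots> = b p (\<xi> p) (\<Sum>i<2 * m. b p (\<eta> p) (?f i) *\<^sub>R L (?J i))"
    using sum_right[of "{..<2 * m}" "\<lambda>i. L (?J i)" "\<xi> p"] LJ in_E by simp
  also have "(\<Sum>i<2 * m. b p (\<eta> p) (?f i) *\<^sub>R L (?J i)) = L (- \<eta> p)"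
    using Llin[OF subset_refl, of "\<lambda>i. b p (\<eta> p) (?f i)"]
    unfolding frame_J_expansion[OF bfrm_basis in_E(1)] by (rule sym)
  also have "L (- \<eta> p) = (- 1) *\<^sub>R L (\<eta> p)"
    using L[unfolded endos_def, THEN CollectD, THEN conjunct2, THEN conjunct2, THEN conjunct1,
        rule_format, OF in_E(1), of "- 1"] by simp
  also have "b p (\<xi> p) \<dots> = - b p (\<xi> p) (L (\<eta> p))"
    by (subst scale_right) (auto intro: endo_apply[OF L] in_E)
  finally show ?thesis .
qed

text \<open>Tangent vectors are applied to functions, so df(u) is u f and the scalar factor is the
  value of df wedge dg on the two vectors.\<close>

definition test_form :: "('m \<Rightarrow> 'v) \<Rightarrow> ('m \<Rightarrow> 'v) \<Rightarrow> ('m \<Rightarrow> real) \<Rightarrow> ('m \<Rightarrow> real) \<Rightarrow> ('m, 'v \<Rightarrow> 'v) form" where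
  "test_form \<eta> \<xi> f g p vs = (if length vs = 2 \<and> set vs \<subseteq> T p
     then ((vs ! 0) f * (vs ! 1) g - (vs ! 0) g * (vs ! 1) f) *\<^sub>R rank_one \<eta> \<xi> p else 0)"

lemma test_form_in:
  assumes \<eta>: "\<eta> \<in> secs" and \<xi>: "\<xi> \<in> secs" and f: "f \<in> smooth_funs A" and g: "g \<in> smooth_funs A"
  shows "test_form \<eta> \<xi> f g \<in> \<Omega>2"
  unfolding endo_forms_def
proof (intro CollectI conjI allI impI ballI)
  fix p
  note S = subspace_endos[OF subspace_fibre[of p]]
  note T = subspace_tangent_space[of p]
  show "alternating_on 2 (T p) (endos (E p)) (test_form \<eta> \<xi> f g p)"
    unfolding alternating_on_def
  proof (intro conjI allI impI)
    fix vs assume "length vs = 2 \<and> set vs \<subseteq> T p"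
    then show "test_form \<eta> \<xi> f g p vs \<in> endos (E p)"
      by (simp add: test_form_def subspace_scale[OF S] rank_one_endo[OF \<eta> \<xi>])
  next
    fix vs u v and i :: nat and c :: real
    assume *: "length vs = 2 \<and> set vs \<subseteq> T p \<and> i < 2 \<and> u \<in> T p \<and> v \<in> T p"
    then obtain x y where vs: "vs = [x, y]" "x \<in> T p" "y \<in> T p"
      by (auto simp: length_Suc_conv numeral_2_eq_2)
    have "c *\<^sub>R u + v \<in> T p" using * by (intro subspace_add[OF T] subspace_scale[OF T]) auto
    moreover have "i = 0 \<or> i = 1" using * by auto
    ultimately show "test_form \<eta> \<xi> f g p (vs[i := c *\<^sub>R u + v]) =
        c *\<^sub>R test_form \<eta> \<xi> f g p (vs[i := u]) + test_form \<eta> \<xi> f g p (vs[i := v])"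
      using * vs(2,3)
      by (elim disjE) (simp_all add: vs(1) test_form_def flip: scaleR_add_left, simp_all add: algebra_simps)
  next
    fix vs and i j :: nat
    assume *: "length vs = 2 \<and> set vs \<subseteq> T p \<and> i < j \<and> j < 2 \<and> vs ! i = vs ! j"
    then have "i = 0" "j = 1" by auto
    with * show "test_form \<eta> \<xi> f g p vs = 0" by (simp add: test_form_def)
  qed (auto simp: test_form_def)
next
  fix Xs \<zeta> assume Xs: "length Xs = 2 \<and> set Xs \<subseteq> vector_fields A" and \<zeta>: "\<zeta> \<in> secs"
  then obtain X Y where X: "Xs = [X, Y]" "X \<in> vector_fields A" "Y \<in> vector_fields A"
    by (auto simp: length_Suc_conv numeral_2_eq_2)
  have "(\<lambda>p. ((X p f * Y p g - X p g * Y p f) * b p (\<eta> p) (\<zeta> p)) *\<^sub>R \<xi> p) \<in> secs"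
    by (rule section_scale[OF smooth_funs_mult[OF smooth_funs_diff[OF smooth_funs_mult smooth_funs_mult]
            b_smooth[OF \<eta> \<zeta>]] \<xi>])
      (rule vector_fields_smooth[OF X(2) f] vector_fields_smooth[OF X(2) g]
        vector_fields_smooth[OF X(3) f] vector_fields_smooth[OF X(3) g])+
  then show "(\<lambda>p. test_form \<eta> \<xi> f g p (map (\<lambda>X. X p) Xs) (\<zeta> p)) \<in> secs"
    by (simp add: X test_form_def vector_fields_tangent rank_one_def section_in[OF \<zeta>])
qed

text \<open>Pairing with \<open>rank_one \<eta> \<xi>\<close> reads off b(\<xi>, K \<eta>) up to
  sign. Sections take every value in a fibre, so nondegeneracy of b recovers K.\<close>

lemma endo_eqI:
  assumes K: "K \<in> endos (E p)" and L: "L \<in> endos (E p)"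
    and eq: "\<And>\<eta> \<xi>. \<eta> \<in> secs \<Longrightarrow> \<xi> \<in> secs \<Longrightarrow> pair p (rank_one \<eta> \<xi> p) K = pair p (rank_one \<eta> \<xi> p) L"
  shows "K = L"
proof
  interpret symplectic_space "E p" "b p" by (rule fibre_symplectic)
  fix x
  show "K x = L x"
  proof (cases "x \<in> E p")
    case True
    note in_E = endo_apply[OF K True] endo_apply[OF L True]
    obtain \<eta> where \<eta>: "\<eta> \<in> secs" "\<eta> p = x" by (rule section_extend[OF True])
    have "K x - L x = 0"
    proof (rule nondegenerate)
      show "K x - L x \<in> E p" using in_E by (rule subspace_diff[OF subspace])
      fix y assume y: "y \<in> E p"
      obtain \<xi> where \<xi>: "\<xi> \<in> secs" "\<xi> p = y" by (rule section_extend[OF y])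
      have "b p y (K x) = b p y (L x)"
        using eq[OF \<eta>(1) \<xi>(1)] pairing_rank_one[OF \<eta>(1) \<xi>(1)] K L \<eta>(2) \<xi>(2) by simp
      then show "b p (K x - L x) y = 0"
        using diff_left[OF in_E y] skew[OF in_E(1) y] skew[OF in_E(2) y] by simp
    qed
    then show ?thesis by simp
  next
    case False
    then show ?thesis using K L by (simp add: endos_def)
  qed
qed

text \<open>With coordinate functions for f and g, a test form is nonzero on a single pair of
  coordinate fields. Its wedge with \<gamma>, evaluated on all four fields, therefore isolates the
  value of \<gamma> on the complementary pair.\<close>

lemma pairing_wedge_nondegenerate:
  assumes \<gamma>: "\<gamma> \<in> \<Omega>2" and \<delta>: "\<delta> \<in> \<Omega>2"
    and eq: "\<And>\<alpha>. \<alpha> \<in> \<Omega>2 \<Longrightarrow> pairing_wedge m E b 2 2 \<alpha> \<gamma> = pairing_wedge m E b 2 2 \<alpha> \<delta>"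
  shows "\<gamma> = \<delta>"
proof (rule form_eqI[OF \<gamma> \<delta>])
  fix p u v assume uv: "u \<in> T p" "v \<in> T p"
  obtain N and X :: "nat \<Rightarrow> 'm \<Rightarrow> 'm tangent" and x where l: "p \<in> N"
    "\<And>i. i < DIM('a) \<Longrightarrow> X i \<in> vector_fields A" "\<And>i. i < DIM('a) \<Longrightarrow> x i \<in> smooth_funs A"
    "\<And>q i j. q \<in> N \<Longrightarrow> i < DIM('a) \<Longrightarrow> j < DIM('a) \<Longrightarrow> X i q (x j) = of_bool (i = j)"
    "\<And>q. q \<in> N \<Longrightarrow> indexed_basis DIM('a) (T q) (\<lambda>i. X i q)"
    by (rule local_coordinate_basis[of p]) (rule that)
  have X: "X i p \<in> T p" "x i \<in> smooth_funs A" if "i < 4" for i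
    using l(2,3)[of i] that vector_fields_tangent dim by auto
  have Xx: "X i p (x j) = of_bool (i = j)" if "i < 4" "j < 4" for i j
    using l(4)[OF l(1)] that dim by simp
  have eb: "indexed_basis 4 (T p) (\<lambda>i. X i p)" using l(5)[OF l(1)] by (simp add: dim)
  have "\<gamma> p [X k p, X l p] = \<delta> p [X k p, X l p]" if kl: "k < l" "l < 4" for k l
  proof (rule endo_eqI[OF form_in_all[OF \<gamma>] form_in_all[OF \<delta>]])
    fix \<eta> \<xi> assume \<eta>: "\<eta> \<in> secs" and \<xi>: "\<xi> \<in> secs"
    let ?K = "rank_one \<eta> \<xi> p"
    let ?\<tau> = "\<lambda>i j. test_form \<eta> \<xi> (x i) (x j)"
    have W: "wedge22 (pair p) (\<lambda>u v. ?\<tau> i j p [u, v]) (\<lambda>u v. \<gamma> p [u, v]) (X 0 p) (X 1 p) (X 2 p) (X 3 p) =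
        wedge22 (pair p) (\<lambda>u v. ?\<tau> i j p [u, v]) (\<lambda>u v. \<delta> p [u, v]) (X 0 p) (X 1 p) (X 2 p) (X 3 p)"
      if "i < 4" "j < 4" for i j
    proof -
      have t: "?\<tau> i j \<in> \<Omega>2" by (rule test_form_in[OF \<eta> \<xi> X(2)[OF that(1)] X(2)[OF that(2)]])
      show ?thesis
        using fun_cong[OF fun_cong[OF eq[OF t]], of p "[X 0 p, X 1 p, X 2 p, X 3 p]"]
        unfolding pairing_wedge_2_2[OF t \<gamma>] pairing_wedge_2_2[OF t \<delta>] by simp
    qed
    have t: "?\<tau> i j p [X k p, X l p] =
        (of_bool (k = i) * of_bool (l = j) - of_bool (k = j) * of_bool (l = i)) *\<^sub>R ?K"
      if "i < 4" "j < 4" "k < 4" "l < 4" for i j k l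
      using that by (simp add: test_form_def X Xx)
    note z = pairing_zero(1)[OF form_in_all[OF \<gamma>]] pairing_zero(1)[OF form_in_all[OF \<delta>]]
    have "l = 1 \<or> l = 2 \<or> l = 3" using kl by auto
    then consider "k = 0" "l = 1" | "k = 0" "l = 2" | "k = 0" "l = 3" | "k = 1" "l = 2" | "k = 1" "l = 3"
      | "k = 2" "l = 3" using kl by (auto simp: less_Suc_eq numeral_2_eq_2 numeral_3_eq_3)
    then show "pair p ?K (\<gamma> p [X k p, X l p]) = pair p ?K (\<delta> p [X k p, X l p])"
    proof cases
      \<comment> \<open>In each case the indices given to \<open>W\<close> are the complement of {k,
        l} in {0, 1, 2, 3}.\<close>
      case 1 then show ?thesis using W[of 2 3] by (simp add: wedge22_def t z)
    next
      case 2 then show ?thesis using W[of 1 3] by (simp add: wedge22_def t z)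
    next
      case 3 then show ?thesis using W[of 1 2] by (simp add: wedge22_def t z)
    next
      case 4 then show ?thesis using W[of 0 3] by (simp add: wedge22_def t z)
    next
      case 5 then show ?thesis using W[of 0 2] by (simp add: wedge22_def t z)
    next
      case 6 then show ?thesis using W[of 0 1] by (simp add: wedge22_def t z)
    qed
  qed
  then show "\<gamma> p [u, v] = \<delta> p [u, v]"
    by (intro alt2_eq_on_basis[OF eb form_alt2[OF \<gamma>] form_alt2[OF \<delta>] _ uv])
qed

section \<open>Identification of the Hodge operator and its eigenforms\<close>

lemma form_lincomb:
  assumes f: "f \<in> smooth_funs A" and \<alpha>: "\<alpha> \<in> \<Omega>2" and \<gamma>: "\<gamma> \<in> \<Omega>2"
  shows "(\<lambda>p vs. f p *\<^sub>R \<alpha> p vs + \<gamma> p vs) \<in> \<Omega>2"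
  unfolding endo_forms_def
proof (intro CollectI conjI allI impI ballI)
  show "alternating_on 2 (T p) (endos (E p)) (\<lambda>vs. f p *\<^sub>R \<alpha> p vs + \<gamma> p vs)" for p
    by (intro alternating_on_lincomb subspace_endos subspace_fibre form_alternating \<alpha> \<gamma>)
next
  fix Xs \<xi> assume Xs: "length Xs = 2 \<and> set Xs \<subseteq> vector_fields A" and \<xi>: "\<xi> \<in> secs"
  then obtain X Y where X: "Xs = [X, Y]" "X \<in> vector_fields A" "Y \<in> vector_fields A"
    by (auto simp: length_Suc_conv numeral_2_eq_2)
  show "(\<lambda>p. (f p *\<^sub>R \<alpha> p (map (\<lambda>X. X p) Xs) + \<gamma> p (map (\<lambda>X. X p) Xs)) (\<xi> p)) \<in> secs"
    using section_add[OF section_scale[OF f form_section[OF \<alpha> X(2,3) \<xi>]] form_section[OF \<gamma> X(2,3) \<xi>]]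
    by (simp add: X(1) plus_fun_def)
qed

lemma form_zero: "(\<lambda>p vs. 0) \<in> \<Omega>2"
  unfolding endo_forms_def alternating_on_def
  using zero_endo section_zero by (simp add: zero_fun_def fun_eq_iff)

text \<open>Bijectivity holds because \<open>star\<close> is an involution of the 2-forms, the
  target degree 2n - k being again 2. The restriction meets the extensionality requirement.\<close>

lemma star_is_hodge_star: "is_hodge_star A \<omega> m E F b 2 (restrict star \<Omega>2)"
proof -
  have sum: "\<alpha> + \<gamma> \<in> \<Omega>2" if "\<alpha> \<in> \<Omega>2" "\<gamma> \<in> \<Omega>2" for \<alpha> \<gamma>
    using form_lincomb[OF smooth_funs_const[of 1] that] by (simp add: plus_fun_def)
  have scale: "(\<lambda>p. f p *\<^sub>R \<alpha> p) \<in> \<Omega>2" if "f \<in> smooth_funs A" "\<alpha> \<in> \<Omega>2" for f \<alpha>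
    using form_lincomb[OF that form_zero] by (simp add: scaleR_fun_def)
  have "bij_betw star \<Omega>2 \<Omega>2"
    by (rule bij_betw_byWitness[of _ star]) (auto simp: star_star star_in)
  then have "bij_betw (restrict star \<Omega>2) \<Omega>2 \<Omega>2"
    by (rule bij_betw_cong[THEN iffD1, rotated]) simp
  then show ?thesis
    unfolding is_hodge_star_def Let_def half_dim
    by (simp add: sum scale star_add star_scale star_pairing)
qed

text \<open>A competing operator sends \<gamma> to a form that pairs with every \<alpha> in the same
  way as \<open>star \<gamma>\<close>; nondegeneracy forces the two to agree, so the definite
  description yields \<open>star\<close>.\<close>

lemma hodge_star_eq:
  assumes "\<alpha> \<in> \<Omega>2"
  shows "hodge_star A \<omega> m E F b 2 \<alpha> = star \<alpha>"
proof -
  have "hodge_star A \<omega> m E F b 2 = restrict star \<Omega>2"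
    unfolding hodge_star_def
  proof (rule the_equality, rule star_is_hodge_star)
    fix H assume "is_hodge_star A \<omega> m E F b 2 H"
    then have H: "H \<in> extensional \<Omega>2" "bij_betw H \<Omega>2 \<Omega>2"
      "\<And>\<alpha> \<gamma>. \<alpha> \<in> \<Omega>2 \<Longrightarrow> \<gamma> \<in> \<Omega>2 \<Longrightarrow>
        (\<lambda>p. form_pairing A \<omega> m E b 2 \<alpha> \<gamma> p *\<^sub>R divided_power \<omega> 2 p) = pairing_wedge m E b 2 2 \<alpha> (H \<gamma>)"
      unfolding is_hodge_star_def Let_def half_dim by simp_all
    show "H = restrict star \<Omega>2"
    proof (rule extensionalityI[OF H(1) restrict_extensional])
      fix \<gamma> assume \<gamma>: "\<gamma> \<in> \<Omega>2"
      have "H \<gamma> = star \<gamma>"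
        using bij_betwE[OF H(2)] \<gamma> H(3) star_pairing
        by (intro pairing_wedge_nondegenerate star_in) auto
      then show "H \<gamma> = restrict star \<Omega>2 \<gamma>" using \<gamma> by simp
    qed
  qed
  then show ?thesis using assms by simp
qed

lemma star_fixed_iff: "star \<alpha> = \<alpha> \<longleftrightarrow> \<alpha> = tensor_form ((1 / 2) *\<^sub>R contraction \<alpha>) \<omega>"
proof -
  have "w *\<^sub>R c - a = a \<longleftrightarrow> a = w *\<^sub>R ((1 / 2) *\<^sub>R c)" for w :: real and c a :: "'v \<Rightarrow> 'v"
  proof
    assume "w *\<^sub>R c - a = a"
    then have "w *\<^sub>R c = 2 *\<^sub>R a" by (simp add: scaleR_2 algebra_simps)
    then have "(1 / 2) *\<^sub>R (w *\<^sub>R c) = a" by simp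
    then show "a = w *\<^sub>R ((1 / 2) *\<^sub>R c)" by simp
  next
    assume "a = w *\<^sub>R ((1 / 2) *\<^sub>R c)"
    then have "w *\<^sub>R c = a + a" by (simp flip: scaleR_2)
    then show "w *\<^sub>R c - a = a" by simp
  qed
  then show ?thesis
    by (simp only: fun_eq_iff[of "star \<alpha>"] fun_eq_iff[of "star \<alpha> _"] fun_eq_iff[of \<alpha>] fun_eq_iff[of "\<alpha> _"]
        star_apply tensor_form_def scaleR_fun_apply[of _ "contraction \<alpha>"])
qed

lemma star_antifixed_iff: "star \<alpha> = - \<alpha> \<longleftrightarrow> contraction \<alpha> = 0"
proof
  assume eq: "star \<alpha> = - \<alpha>"
  show "contraction \<alpha> = 0"
  proof
    fix p
    \<comment> \<open>Since omega is 1 on this pair, the equation there says that the contraction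
      minus a equals -a.\<close>
    have "star \<alpha> p [frm p 0, frm p 2] = - \<alpha> p [frm p 0, frm p 2]" by (simp only: eq) simp
    then show "contraction \<alpha> p = 0 p" unfolding star_apply frm_omega by simp
  qed
next
  assume "contraction \<alpha> = 0"
  then show "star \<alpha> = - \<alpha>" by (intro ext) (simp add: star_apply)
qed

end

theorem proposition5p1:
  fixes A :: "('m::{t2_space, second_countable_topology}, real ^ 4) atlas"
    and \<omega> :: "('m, real) form"
    and m :: nat
    and E :: "'m \<Rightarrow> 'v::real_vector set"
    and F :: "('m, 'v) frames"
    and b :: "'m \<Rightarrow> 'v \<Rightarrow> 'v \<Rightarrow> real"
    and D :: "('m \<Rightarrow> 'm tangent) \<Rightarrow> ('m \<Rightarrow> 'v) \<Rightarrow> 'm \<Rightarrow> 'v"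
  assumes "closed_manifold A"
    and "almost_symplectic_form A \<omega>"
    and "vector_bundle A (2 * m) E F"
    and "almost_symplectic_bundle A (2 * m) E F b"
    and "symplectic_connection A (2 * m) E F b D"
  shows "(hodge_star A \<omega> m E F b 2 (curvature A (2 * m) E F D) = curvature A (2 * m) E F D \<longleftrightarrow>
           curvature A (2 * m) E F D =
             tensor_form ((1 / 2) *\<^sub>R symplectic_ricci A \<omega> (2 * m) E F D) \<omega>) \<and>
         (hodge_star A \<omega> m E F b 2 (curvature A (2 * m) E F D) = - curvature A (2 * m) E F D \<longleftrightarrow>
           symplectic_ricci A \<omega> (2 * m) E F D = 0)"
proof -
  interpret symplectic_bundle_4 A m E F \<omega> b
    using assms by unfold_locales (simp_all add: closed_manifold_def)
  interpret bundle_connection A "2 * m" E F D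
    using assms(5) by unfold_locales (simp add: symplectic_connection_def)
  \<comment> \<open>Both sides are sums over the same chosen frame, the half-dimension being
    2.\<close>
  have ricci: "symplectic_ricci A \<omega> (2 * m) E F D = contraction (curvature A (2 * m) E F D)"
    by (rule ext) (simp add: symplectic_ricci_def contraction_def half_dim Let_def)
  show ?thesis
    unfolding hodge_star_eq[OF curvature_in] ricci star_fixed_iff[symmetric] star_antifixed_iff by simp
qed

end
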